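(* Let $G$ be a finitely generated infinite group with a fixed finite symmetric generating set, and let $f$ be a Floyd function. Let $\mu$ be a probability measure on $G$ whose support generates $G$ and whose random walk is transient, and let $d_{\mathcal G}$ be the Green metric associated to $\mu$. Assume that one of the following holds: (a) the support of $\mu$ is finite; or (b) $\mu$ has superexponential moment and $x^{2+\alpha}f(x)\to 0$ as $x\to\infty$ for some $\alpha>0$. Then there exists a decreasing function $A:(0,\infty)\to(0,\infty)$ such that for all $x,y,z\in G$ with $x\neq z$, $$d_{\mathcal G}(x,y)+d_{\mathcal G}(y,z)\le d_{\mathcal G}(x,z)+A\big(\delta^f_y(x,z)\big).$$
   Context: $d$ is the word metric on $G$ for the fixed finite symmetric generating set, and $\|g\|=d(e,g)$. The support of $\mu$ is $\{g\in G:\mu(g)>0\}$. The measure $\mu$ has superexponential moment if $\sum_{g\in G}c^{\|g\|}\mu(g)<\infty$ for every $c>1$. Green metric: $p_n(x,y)=\mu^{*n}(x^{-1}y)$ and $\mathcal G(x,y)=\sum_{n\ge 0}p_n(x,y)$. The random walk is transient if the probability of ever returning to the starting point is less than $1$; then $\mathcal G(x,y)<\infty$ for all $x,y$. Put $d_{\mathcal G}(x,y)=-\ln\frac{\mathcal G(x,y)}{\mathcal G(e,e)}$ (possibly asymmetric). Floyd function: a nonincreasing function $f:[0,\infty)\to(0,\infty)$ with $\sum_{k\ge0}f(k)<\infty$ and such that there is $\kappa\ge1$ with $f(n)/f(n+1)\le\kappa$ for all $n\in\mathbb N$. Floyd distance: for a vertex $v\in G$, an edge $\{a,b\}$ of the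 Cayley graph has $(f,v)$-length $f(\min(d(v,a),d(v,b)))$; the $(f,v)$-length of an edge path is the sum of the lengths of its edges; $\delta^f_v(x,y)$ is the minimal $(f,v)$-length of an edge path from $x$ to $y$. *)

theory Defs
  imports "HOL-Probability.Probability"
begin

text \<open>
  The group is a type of class \<^class>\<open>group_add\<close>. This class is not commutative: it is the library's
  class of arbitrary groups, written additively. Thus \<open>x + y\<close>, \<open>- x\<close>, \<open>0\<close> stand for
  \<open>xy\<close>, \<open>x\<^sup>-\<^sup>1\<close>, \<open>e\<close>, and \<open>- x + y\<close> stands for \<open>x\<^sup>-\<^sup>1y\<close>.
\<close>

section \<open>Generation and the word metric\<close>

inductive_set generated_subgroup :: "'a::group_add set \<Rightarrow> 'a set" for S :: "'a set" where
  zero: "0 \<in> generated_subgroup S"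
| incl: "s \<in> S \<Longrightarrow> s \<in> generated_subgroup S"
| neg: "x \<in> generated_subgroup S \<Longrightarrow> - x \<in> generated_subgroup S"
| add: "x \<in> generated_subgroup S \<Longrightarrow> y \<in> generated_subgroup S \<Longrightarrow> x + y \<in> generated_subgroup S"

inductive_set generated_semigroup :: "'a::semigroup_add set \<Rightarrow> 'a set" for T :: "'a set" where
  incl: "s \<in> T \<Longrightarrow> s \<in> generated_semigroup T"
| add: "x \<in> generated_semigroup T \<Longrightarrow> y \<in> generated_semigroup T \<Longrightarrow> x + y \<in> generated_semigroup T"

definition finite_symmetric_generating_set :: "'a::group_add set \<Rightarrow> bool" where
  "finite_symmetric_generating_set S \<longleftrightarrow>
     finite S \<and> uminus ` S = S \<and> generated_subgroup S = UNIV"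

definition word_norm :: "'a::group_add set \<Rightarrow> 'a \<Rightarrow> nat" where
  "word_norm S g = (LEAST n. \<exists>ws. length ws = n \<and> set ws \<subseteq> S \<and> sum_list ws = g)"

definition word_dist :: "'a::group_add set \<Rightarrow> 'a \<Rightarrow> 'a \<Rightarrow> nat" where
  "word_dist S x y = word_norm S (- x + y)"


section \<open>Random walks and the Green metric\<close>

definition convolve :: "'a::monoid_add pmf \<Rightarrow> 'a pmf \<Rightarrow> 'a pmf" where
  "convolve \<mu> \<nu> = map_pmf (\<lambda>(g, h). g + h) (pair_pmf \<mu> \<nu>)"

definition convolution_power :: "'a::monoid_add pmf \<Rightarrow> nat \<Rightarrow> 'a pmf" where
  "convolution_power \<mu> n = (convolve \<mu> ^^ n) (return_pmf 0)"

definition transition_prob :: "'a::group_add pmf \<Rightarrow> nat \<Rightarrow> 'a \<Rightarrow> 'a \<Rightarrow> real" where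
  "transition_prob \<mu> n x y = pmf (convolution_power \<mu> n) (- x + y)"

text \<open>
  The increments of the walk are independent with law \<open>\<mu>\<close>, i.e. they are distributed according to
  the infinite product measure; the walk starts at the identity.
\<close>

definition walk_position :: "(nat \<Rightarrow> 'a::monoid_add) \<Rightarrow> nat \<Rightarrow> 'a" where
  "walk_position \<omega> n = sum_list (map \<omega> [0..<n])"

definition return_probability :: "'a::monoid_add pmf \<Rightarrow> real" where
  "return_probability \<mu> =
     measure (PiM UNIV (\<lambda>_::nat. measure_pmf \<mu>)) {\<omega>. \<exists>n\<ge>1. walk_position \<omega> n = 0}"

definition transient :: "'a::monoid_add pmf \<Rightarrow> bool" where
  "transient \<mu> \<longleftrightarrow> return_probability \<mu> < 1"

text \<open>
  The two real-valued definitions below are meaningful under the standing assumptions: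
  transience makes the series converge, and every value of the Green function is positive when
  the support of \<open>\<mu>\<close> generates the group as a semigroup.
\<close>

definition green :: "'a::group_add pmf \<Rightarrow> 'a \<Rightarrow> 'a \<Rightarrow> real" where
  "green \<mu> x y = (\<Sum>n. transition_prob \<mu> n x y)"

definition green_dist :: "'a::group_add pmf \<Rightarrow> 'a \<Rightarrow> 'a \<Rightarrow> real" where
  "green_dist \<mu> x y = - ln (green \<mu> x y / green \<mu> 0 0)"

definition superexponential_moment :: "'a::group_add set \<Rightarrow> 'a pmf \<Rightarrow> bool" where
  "superexponential_moment S \<mu> \<longleftrightarrow>
     (\<forall>c::real. c > 1 \<longrightarrow> (\<lambda>g. c ^ word_norm S g * pmf \<mu> g) summable_on UNIV)"


section \<open>Floyd functions and the Floyd distance\<close>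

text \<open>Only the values on \<open>[0,\<infinity>)\<close> matter.\<close>

definition floyd_function :: "(real \<Rightarrow> real) \<Rightarrow> bool" where
  "floyd_function f \<longleftrightarrow>
     (\<forall>x\<ge>0. f x > 0) \<and> antimono_on {0..} f \<and> summable (\<lambda>k::nat. f (real k)) \<and>
     (\<exists>\<kappa>\<ge>1. \<forall>n::nat. f (real n) / f (real (n + 1)) \<le> \<kappa>)"

definition cayley_edge :: "'a::group_add set \<Rightarrow> 'a \<Rightarrow> 'a \<Rightarrow> bool" where
  "cayley_edge S a b \<longleftrightarrow> a \<noteq> b \<and> - a + b \<in> S"

text \<open>An edge path is given by the nonempty list of its successive vertices.\<close>

definition edge_paths :: "'a::group_add set \<Rightarrow> 'a \<Rightarrow> 'a \<Rightarrow> 'a list set" where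
  "edge_paths S x y =
     {p. p \<noteq> [] \<and> hd p = x \<and> last p = y \<and> successively (cayley_edge S) p}"

definition floyd_edge_length ::
  "'a::group_add set \<Rightarrow> (real \<Rightarrow> real) \<Rightarrow> 'a \<Rightarrow> 'a \<Rightarrow> 'a \<Rightarrow> real" where
  "floyd_edge_length S f v a b = f (real (min (word_dist S v a) (word_dist S v b)))"

definition floyd_path_length ::
  "'a::group_add set \<Rightarrow> (real \<Rightarrow> real) \<Rightarrow> 'a \<Rightarrow> 'a list \<Rightarrow> real" where
  "floyd_path_length S f v p = (\<Sum>(a, b)\<leftarrow>zip p (tl p). floyd_edge_length S f v a b)"

text \<open>
  An infimum, since the minimum over the edge paths need not be attained:
  shorter and shorter detours may run further and further away from \<open>v\<close>.
\<close>

definition floyd_dist ::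
  "'a::group_add set \<Rightarrow> (real \<Rightarrow> real) \<Rightarrow> 'a \<Rightarrow> 'a \<Rightarrow> 'a \<Rightarrow> real" where
  "floyd_dist S f v x y = (INF p\<in>edge_paths S x y. floyd_path_length S f v p)"

end

theory Submission
  imports Defs
begin

text \<open>
  Exponentiating the definition of the Green metric turns the claim into an inequality of Ancona
  type: for every \<open>t > 0\<close> there is \<open>C\<close> with \<open>G(x,z) \<le> C G(x,y) G(y,z)\<close> whenever the Floyd distance
  of \<open>x\<close> and \<open>z\<close> seen from \<open>y\<close> is at least \<open>t\<close>; the function \<open>A\<close> is then assembled from the
  constants for \<open>t = 1/(n+1)\<close>. Everything is left-invariant, so \<open>y\<close> may be taken to be the
  identity. Below \<open>N\<close> is the word norm, \<open>D\<close> the Floyd distance seen from the identity, and \<open>gr\<close> the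
  Green function with values in the extended nonnegative reals. Either alternative of the
  hypothesis on \<open>\<mu>\<close> makes \<open>a ^ N\<close> integrable for every \<open>a \<ge> 1\<close> (\<open>exponential_moments\<close>).

  Geometry. Two points whose word geodesic stays far from the identity, measured by the Gromov
  product, are close for \<open>D\<close> (\<open>D_gromov\<close>). Hence every element \<open>g\<close> of large norm acts with
  north-south dynamics: it sends everything that is not \<open>D\<close>-close to \<open>- g\<close> into a small neighbourhood
  of \<open>g\<close> (\<open>D_contract\<close>). From this one gets three cases (\<open>floyd_trichotomy\<close>). Either points at
  Floyd distance at least \<open>t\<close> cannot both be far from the identity. Or there is an element \<open>a\<close> with two
  distinct poles. If some conjugate of \<open>a\<close> has poles disjoint from those of \<open>a\<close>, ping-pong gives a
  paradoxical decomposition of the group; if not, every conjugate of \<open>a\<close> has a nontrivial power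
  in common with \<open>a\<close>, and the group lies within bounded distance of the powers of \<open>a\<close>.

  In the first case the Harnack inequality is enough (\<open>ancona_near\<close>). In the last case the walk has
  to jump from one end to the other; a jump from \<open>v\<close> to \<open>w\<close> across the identity has length about
  \<open>N v + N w\<close>, and the exponential moments outweigh the Harnack constants and the number of
  possible jumps (\<open>ancona_across\<close>).

  In the paradoxical case convolution with the lazy version of \<open>\<mu>\<close> contracts the square-summable
  functions, so its transition probabilities decay exponentially (\<open>exponential_decay\<close>), and passing
  to the lazy walk only doubles the Green function (\<open>gr_lazy\<close>). A trajectory that avoids the ball
  \<open>B\<^sub>n\<close> of radius \<open>n\<close> and joins points at Floyd distance \<open>\<epsilon>\<close> needs total jump length about
  \<open>\<epsilon> / f(n/2)\<close>. With \<open>\<epsilon>\<^sub>n = M n f(n/2)\<close> this is \<open>M n\<close>, and by exponential decay and exponential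
  moments such trajectories contribute at most \<open>exp(- \<theta> M n)\<close>, which for large \<open>M\<close> is negligible
  against \<open>G(x,0) G(0,z)\<close> for \<open>x, z\<close> in the ball \<open>B\<^sub>2\<^sub>n\<close>. Decomposing the walk from \<open>x\<close> at the first
  visit \<open>w\<close> to \<open>B\<^sub>n\<close>, only those \<open>w\<close> matter that are \<open>\<epsilon>\<^sub>n\<close>-close to \<open>x\<close>, so that the inequality for
  \<open>x\<close> reduces to the inequality for \<open>w\<close> at the price of \<open>\<epsilon>\<^sub>n\<close> in Floyd distance
  (\<open>ancona_one_scale\<close>). Since \<open>f\<close> is summable and monotone, Cauchy condensation makes
  the sum of \<open>\<epsilon>\<^sub>n\<close> over the powers \<open>n\<close> of 2 finite; starting from a scale where the remaining sum is
  small compared with \<open>t\<close> one descends to a fixed ball and uses Harnack there (\<open>ancona_of_decay\<close>).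
\<close>

section \<open>Word norm and Floyd distance\<close>

lemma minus_translate: "- (g + a) + (g + b) = - a + (b :: 'a :: group_add)"
  by (simp add: minus_add add.assoc del: add_uminus_conv_diff)

lemma minus_add_telescope: "(- x + y) + (- y + z) = - x + (z :: 'a :: group_add)"
  by (simp add: add.assoc)

locale cayley_group =
  fixes S :: "'a::group_add set"
  assumes gen: "finite_symmetric_generating_set S"
begin

abbreviation N :: "'a \<Rightarrow> nat" where "N \<equiv> word_norm S"

lemma finite_S: "finite S"
  using gen unfolding finite_symmetric_generating_set_def by blast

lemma uminus_S: "s \<in> S \<Longrightarrow> - s \<in> S"
  using gen unfolding finite_symmetric_generating_set_def by blast

lemma ex_word: "\<exists>ws. set ws \<subseteq> S \<and> sum_list ws = g"
proof -
  have "g \<in> generated_subgroup S"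
    using gen unfolding finite_symmetric_generating_set_def by blast
  then show ?thesis
  proof induction
    case zero
    then show ?case by (intro exI[of _ "[]"]) auto
  next
    case (incl s)
    then show ?case by (intro exI[of _ "[s]"]) auto
  next
    case (neg x)
    then obtain ws where ws: "set ws \<subseteq> S" "sum_list ws = x" by auto
    have "sum_list (rev (map uminus ws)) = - sum_list ws"
      by (induction ws) (auto simp: minus_add)
    then show ?case
      using ws uminus_S by (intro exI[of _ "rev (map uminus ws)"]) auto
  next
    case (add x y)
    then obtain us vs where "set us \<subseteq> S" "sum_list us = x" "set vs \<subseteq> S" "sum_list vs = y"
      by auto
    then show ?case by (intro exI[of _ "us @ vs"]) auto
  qed
qed

lemma N_sum_list_le: "set ws \<subseteq> S \<Longrightarrow> N (sum_list ws) \<le> length ws"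
  unfolding word_norm_def by (rule Least_le) auto

lemma ex_geodesic_word: "\<exists>ws. length ws = N g \<and> set ws \<subseteq> S \<and> sum_list ws = g"
  unfolding word_norm_def
proof (rule LeastI_ex)
  show "\<exists>n ws. length ws = n \<and> set ws \<subseteq> S \<and> sum_list ws = g"
    using ex_word[of g] by auto
qed

lemma N_0 [simp]: "N 0 = 0"
  using N_sum_list_le[of "[]"] by simp

lemma N_add: "N (x + y) \<le> N x + N y"
proof -
  obtain us vs where u: "length us = N x" "set us \<subseteq> S" "sum_list us = x"
    and v: "length vs = N y" "set vs \<subseteq> S" "sum_list vs = y"
    using ex_geodesic_word by meson
  from N_sum_list_le[of "us @ vs"] u v show ?thesis by auto
qed

lemma N_minus_le: "N (- x) \<le> N x"
proof -
  obtain us where u: "length us = N x" "set us \<subseteq> S" "sum_list us = x"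
    using ex_geodesic_word by meson
  have "sum_list (rev (map uminus us)) = - sum_list us"
    by (induction us) (auto simp: minus_add)
  moreover have "set (rev (map uminus us)) \<subseteq> S" using u uminus_S by auto
  ultimately show ?thesis using N_sum_list_le[of "rev (map uminus us)"] u by auto
qed

lemma N_minus [simp]: "N (- x) = N x"
  using N_minus_le[of x] N_minus_le[of "- x"] by simp

lemma N_S: "s \<in> S \<Longrightarrow> N s \<le> 1"
  using N_sum_list_le[of "[s]"] by simp

lemma N_dist_commute: "N (- x + y) = N (- y + x)"
  using N_minus[of "- x + y"] by (simp add: minus_add)

lemma N_dist_triangle: "N (- x + z) \<le> N (- x + y) + N (- y + z)"
  using N_add[of "- x + y" "- y + z"] by (simp only: minus_add_telescope)

lemma N_add_ge: "N x \<le> N (x + y) + N y"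
  using N_add[of "x + y" "- y"] by (simp add: add.assoc)

lemma N_add_ge_right: "N y \<le> N (x + y) + N x"
  using N_add[of "- x" "x + y"] by (simp add: add.assoc[symmetric])

lemma N_split:
  assumes "i \<le> N g"
  shows "\<exists>h k. g = h + k \<and> N h = i \<and> N k = N g - i"
proof -
  obtain ws where ws: "length ws = N g" "set ws \<subseteq> S" "sum_list ws = g"
    using ex_geodesic_word by meson
  let ?h = "sum_list (take i ws)" and ?k = "sum_list (drop i ws)"
  have g: "g = ?h + ?k" using ws by (metis append_take_drop_id sum_list_append)
  have "set (take i ws) \<subseteq> S" "set (drop i ws) \<subseteq> S"
    using ws set_take_subset[of i ws] set_drop_subset[of i ws] by blast+
  then have "N ?h \<le> i" "N ?k \<le> N g - i"
    using N_sum_list_le[of "take i ws"] N_sum_list_le[of "drop i ws"] ws(1) assms by simp_all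
  moreover have "N g \<le> N ?h + N ?k" using N_add g by metis
  ultimately have "N ?h = i" "N ?k = N g - i" using assms by linarith+
  with g show ?thesis by blast
qed

lemma N_Suc_split:
  assumes "N g = Suc n"
  shows "\<exists>h s. g = h + s \<and> N h = n \<and> s \<in> S"
proof -
  obtain ws where ws: "length ws = N g" "set ws \<subseteq> S" "sum_list ws = g"
    using ex_geodesic_word by meson
  then have ne: "ws \<noteq> []" using assms by auto
  let ?h = "sum_list (butlast ws)" and ?k = "last ws"
  have g: "g = ?h + ?k" using ws ne
    by (metis append_butlast_last_id sum_list.Cons sum_list.Nil sum_list_append add.right_neutral)
  have k: "?k \<in> S" using ws ne by (meson last_in_set subsetD)
  have "N ?h \<le> n" using N_sum_list_le[of "butlast ws"] ws assms
    by (metis diff_Suc_1 dual_order.trans in_set_butlastD length_butlast subset_iff)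
  moreover have "N g \<le> N ?h + N ?k" using N_add g by metis
  ultimately have "N ?h = n" using N_S[OF k] assms by linarith
  with g k show ?thesis by blast
qed

lemma ball_subset_words:
  "{g. N g \<le> n} \<subseteq> sum_list ` {ws. set ws \<subseteq> insert 0 S \<and> length ws = n}"
proof
  have replicate_zero: "sum_list (replicate k (0::'a)) = 0" for k by (induction k) auto
  fix g assume "g \<in> {g. N g \<le> n}"
  then have "N g \<le> n" by simp
  obtain ws where ws: "length ws = N g" "set ws \<subseteq> S" "sum_list ws = g"
    using ex_geodesic_word by meson
  have "sum_list (ws @ replicate (n - N g) 0) = g"
    using ws by (simp add: replicate_zero)
  moreover have "length (ws @ replicate (n - N g) 0) = n" using ws \<open>N g \<le> n\<close> by simp
  moreover have "set (ws @ replicate (n - N g) 0) \<subseteq> insert 0 S" using ws by auto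
  ultimately show "g \<in> sum_list ` {ws. set ws \<subseteq> insert 0 S \<and> length ws = n}"
    by (intro image_eqI[of _ _ "ws @ replicate (n - N g) 0"]) auto
qed

lemma finite_ball: "finite {g. N g \<le> n}"
  by (rule finite_subset[OF ball_subset_words])
     (simp add: finite_S finite_lists_length_eq)

lemma card_ball: "card {g. N g \<le> n} \<le> Suc (card S) ^ n"
proof -
  have "card {g. N g \<le> n} \<le> card (sum_list ` {ws. set ws \<subseteq> insert 0 S \<and> length ws = n})"
    by (rule card_mono[OF _ ball_subset_words]) (simp add: finite_S finite_lists_length_eq)
  also have "\<dots> \<le> card {ws. set ws \<subseteq> insert 0 S \<and> length ws = n}"
    by (rule card_image_le) (simp add: finite_S finite_lists_length_eq)
  also have "\<dots> = card (insert 0 S) ^ n" by (rule card_lists_length_eq) (simp add: finite_S)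
  also have "\<dots> \<le> Suc (card S) ^ n"
    by (rule power_mono) (auto simp: finite_S card_insert_if)
  finally show ?thesis .
qed

lemma countable_UNIV_group: "countable (UNIV :: 'a set)"
proof -
  have "(UNIV :: 'a set) = (\<Union>n. {g. N g \<le> n})" by auto
  then show ?thesis using finite_ball by (metis countable_UN countableI_type countable_finite)
qed

end

locale floyd_group = cayley_group S for S :: "'a::group_add set" +
  fixes f :: "real \<Rightarrow> real"
  assumes floyd: "floyd_function f"
begin

abbreviation F :: "nat \<Rightarrow> real" where "F k \<equiv> f (real k)"

lemma F_pos: "F k > 0" and F_summable: "summable F"
  and F_antimono: "i \<le> j \<Longrightarrow> F j \<le> F i"
  using floyd unfolding floyd_function_def monotone_on_def by auto

lemma f_nonneg [simp]: "0 \<le> x \<Longrightarrow> 0 \<le> f x"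
  using floyd unfolding floyd_function_def by (simp add: less_imp_le)

lemma F_nonneg: "0 \<le> F k" by simp

definition tail :: "nat \<Rightarrow> real" where "tail m = (\<Sum>k. F (k + m))"

lemma tail_summable: "summable (\<lambda>k. F (k + m))"
  using F_summable by (subst summable_iff_shift)

lemma tail_nonneg [simp]: "0 \<le> tail m"
  unfolding tail_def by (rule suminf_nonneg[OF tail_summable]) (rule F_nonneg)

lemma tail_Suc: "tail m = F m + tail (Suc m)"
  unfolding tail_def using suminf_split_head[OF tail_summable[of m]] by simp

lemma tail_antimono: "m \<le> n \<Longrightarrow> tail n \<le> tail m"
proof (induction n rule: dec_induct)
  case (step n) then show ?case using tail_Suc[of n] F_nonneg[of n] by linarith
qed simp

lemma tail_tendsto_0: "tail \<longlonglongrightarrow> 0"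
proof -
  have "tail = (\<lambda>m. suminf F - (\<Sum>k<m. F k))"
    unfolding tail_def using suminf_minus_initial_segment[OF F_summable] by auto
  moreover have "(\<lambda>m. suminf F - (\<Sum>k<m. F k)) \<longlonglongrightarrow> suminf F - suminf F"
    by (intro tendsto_intros summable_LIMSEQ F_summable)
  ultimately show ?thesis by simp
qed

lemma ex_tail_less: "\<eta> > 0 \<Longrightarrow> \<exists>m. 2 * tail m < \<eta>"
proof -
  assume "\<eta> > 0"
  then have "eventually (\<lambda>m. tail m < \<eta> / 2) sequentially"
    using order_tendstoD(2)[OF tail_tendsto_0, of "\<eta>/2"] by simp
  then obtain m where "tail m < \<eta> / 2" by (auto simp: eventually_sequentially)
  then show ?thesis by (intro exI[of _ m]) simp
qed

abbreviation L :: "'a \<Rightarrow> 'a list \<Rightarrow> real" where "L \<equiv> floyd_path_length S f"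

lemma edge_nonneg [simp]: "0 \<le> floyd_edge_length S f v a b"
  unfolding floyd_edge_length_def by simp

lemma L_singleton [simp]: "L v [x] = 0"
  and L_Nil [simp]: "L v [] = 0"
  and L_Cons2 [simp]: "L v (x # y # p) = floyd_edge_length S f v x y + L v (y # p)"
  unfolding floyd_path_length_def by simp_all

lemma L_nonneg: "0 \<le> L v p"
  by (induction p rule: induct_list012) auto

lemma L_append: "p \<noteq> [] \<Longrightarrow> q \<noteq> [] \<Longrightarrow> last p = hd q \<Longrightarrow> L v (p @ tl q) = L v p + L v q"
proof (induction p rule: induct_list012)
  case (2 x) then show ?case by (cases q) auto
qed auto

lemma L_snoc: "p \<noteq> [] \<Longrightarrow> L v (p @ [x]) = L v p + floyd_edge_length S f v (last p) x"
  by (induction p rule: induct_list012) auto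

lemma L_rev: "L v (rev p) = L v p"
proof (induction p rule: induct_list012)
  case (3 x y p)
  have "L v (rev (x # y # p)) = L v (rev (y # p) @ [x])" by simp
  also have "\<dots> = L v (rev (y # p)) + floyd_edge_length S f v y x"
    by (subst L_snoc) auto
  finally show ?case using 3 by (simp add: floyd_edge_length_def min.commute)
qed auto

lemma cayley_edge_sym: "cayley_edge S a b \<Longrightarrow> cayley_edge S b a"
  unfolding cayley_edge_def using uminus_S[of "- a + b"] by (auto simp: minus_add)

lemma edge_paths_append:
  assumes "p \<in> edge_paths S x y" "q \<in> edge_paths S y z"
  shows "p @ tl q \<in> edge_paths S x z"
proof (cases q)
  case (Cons c q')
  show ?thesis
  proof (cases q')
    case Nil
    then show ?thesis using assms Cons unfolding edge_paths_def by auto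
  next
    case (Cons d q'')
    have "last p = c" "successively (cayley_edge S) (c # d # q'')"
      using assms \<open>q = c # q'\<close> Cons unfolding edge_paths_def by auto
    then show ?thesis using assms \<open>q = c # q'\<close> Cons unfolding edge_paths_def
      by (simp add: successively_append_iff)
  qed
qed (use assms in \<open>auto simp: edge_paths_def\<close>)

lemma edge_paths_rev: "p \<in> edge_paths S x y \<Longrightarrow> rev p \<in> edge_paths S y x"
  unfolding edge_paths_def
  by (auto simp: hd_rev last_rev successively_rev
       intro: successively_mono[of "cayley_edge S"] cayley_edge_sym)

lemma edge_paths_map: "p \<in> edge_paths S x y \<Longrightarrow> map ((+) g) p \<in> edge_paths S (g + x) (g + y)"
proof -
  have "cayley_edge S (g + a) (g + b) = cayley_edge S a b" for a b
    unfolding cayley_edge_def by (simp add: minus_translate)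
  then show "p \<in> edge_paths S x y \<Longrightarrow> ?thesis" 
    unfolding edge_paths_def by (auto simp: hd_map last_map successively_map)
qed

lemma edge_paths_nonempty: "edge_paths S x y \<noteq> {}"
proof (induction "N (- x + y)" arbitrary: y)
  case 0
  then obtain ws where "length ws = 0" "sum_list ws = - x + y" using ex_geodesic_word by metis
  then have "- x + y = 0" by simp
  then have "x = y" by (metis add.inverse_inverse minus_unique)
  then have "[x] \<in> edge_paths S x y" unfolding edge_paths_def by simp
  then show ?case by blast
next
  case (Suc n)
  then obtain h s where hs: "- x + y = h + s" "N h = n" "s \<in> S" using N_Suc_split by metis
  have eq: "- x + (y - s) = h"
    using hs(1) by (metis add_diff_cancel diff_conv_add_uminus add.assoc)
  then obtain p where p: "p \<in> edge_paths S x (y - s)" using Suc(1)[of "y - s"] hs(2) by auto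
  show ?case
  proof (cases "s = 0")
    case True then show ?thesis using p by auto
  next
    case False
    then have "y - s \<noteq> y" by (metis diff_conv_add_uminus add_0_right add_left_imp_eq neg_equal_0_iff_equal)
    then have "[y - s, y] \<in> edge_paths S (y - s) y"
      unfolding edge_paths_def cayley_edge_def using hs(3) by (auto simp: minus_diff_eq)
    then show ?thesis using edge_paths_append[OF p] by auto
  qed
qed

definition D :: "'a \<Rightarrow> 'a \<Rightarrow> real" where "D x z = floyd_dist S f 0 x z"

lemma floyd_dist_le: "p \<in> edge_paths S x z \<Longrightarrow> floyd_dist S f v x z \<le> L v p"
  unfolding floyd_dist_def
  by (rule cINF_lower) (auto intro!: bdd_belowI[of _ 0] L_nonneg)

lemma floyd_dist_ge: "(\<And>p. p \<in> edge_paths S x z \<Longrightarrow> c \<le> L v p) \<Longrightarrow> c \<le> floyd_dist S f v x z"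
  unfolding floyd_dist_def by (rule cINF_greatest) (auto simp: edge_paths_nonempty)

lemma floyd_dist_translate: "floyd_dist S f v x z = D (- v + x) (- v + z)"
proof (rule antisym)
  have *: "L (g + v) (map ((+) g) p) = L v p" for g v p
    by (induction p rule: induct_list012)
       (auto simp: floyd_edge_length_def word_dist_def minus_translate)
  show "D (- v + x) (- v + z) \<le> floyd_dist S f v x z"
  proof (rule floyd_dist_ge)
    fix p assume "p \<in> edge_paths S x z"
    from edge_paths_map[OF this, of "- v"] have "D (- v + x) (- v + z) \<le> L 0 (map ((+) (- v)) p)"
      unfolding D_def by (rule floyd_dist_le)
    then show "D (- v + x) (- v + z) \<le> L v p" using *[of "- v" v p] by simp
  qed
  show "floyd_dist S f v x z \<le> D (- v + x) (- v + z)"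
    unfolding D_def
  proof (rule floyd_dist_ge)
    fix p assume "p \<in> edge_paths S (- v + x) (- v + z)"
    from edge_paths_map[OF this, of v] have "map ((+) v) p \<in> edge_paths S x z"
      by (simp add: add.assoc[symmetric])
    then have "floyd_dist S f v x z \<le> L v (map ((+) v) p)" by (rule floyd_dist_le)
    then show "floyd_dist S f v x z \<le> L 0 p" using *[of v 0 p] by simp
  qed
qed

lemma D_nonneg [simp]: "0 \<le> D x z"
  unfolding D_def by (rule floyd_dist_ge) (rule L_nonneg)

lemma D_refl [simp]: "D x x = 0"
proof (rule antisym)
  have "[x] \<in> edge_paths S x x" unfolding edge_paths_def by simp
  from floyd_dist_le[OF this, of 0] show "D x x \<le> 0" unfolding D_def by simp
qed simp

lemma D_commute_le: "D x z \<le> D z x"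
  unfolding D_def
proof (rule floyd_dist_ge)
  fix p assume "p \<in> edge_paths S z x"
  from floyd_dist_le[OF edge_paths_rev[OF this], of 0] show "floyd_dist S f 0 x z \<le> L 0 p"
    by (simp add: L_rev)
qed

lemma D_commute: "D x z = D z x"
  using D_commute_le by (rule antisym) (rule D_commute_le)

lemma D_triangle: "D x z \<le> D x y + D y z"
proof -
  have "D x z - D y z \<le> D x y"
    unfolding D_def[of x y]
  proof (rule floyd_dist_ge)
    fix p assume p: "p \<in> edge_paths S x y"
    have "D x z - L 0 p \<le> D y z"
      unfolding D_def[of y z]
    proof (rule floyd_dist_ge)
      fix q assume q: "q \<in> edge_paths S y z"
      have "D x z \<le> L 0 (p @ tl q)" unfolding D_def
        by (rule floyd_dist_le[OF edge_paths_append[OF p q]])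
      also have "\<dots> = L 0 p + L 0 q"
        using p q unfolding edge_paths_def by (intro L_append) auto
      finally show "D x z - L 0 p \<le> L 0 q" by simp
    qed
    then show "D x z - D y z \<le> L 0 p" by simp
  qed
  then show ?thesis by simp
qed

lemma D_edge: "s \<in> S \<Longrightarrow> D x (x + s) \<le> F (min (N x) (N (x + s)))"
proof (cases "s = 0")
  case False
  assume "s \<in> S"
  then have "[x, x + s] \<in> edge_paths S x (x + s)"
    unfolding edge_paths_def cayley_edge_def using False
    by (auto simp: add.assoc[symmetric] dest: add_left_imp_eq[of x 0, simplified])
  from floyd_dist_le[OF this, of 0] show ?thesis
    unfolding D_def by (simp add: floyd_edge_length_def word_dist_def)
qed auto

text \<open>
  The first edge of every path that leaves \<open>x\<close> has an end at distance at most
  \<open>N x\<close> from the identity, so its length is at least \<open>f (N x)\<close>.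
\<close>

lemma D_pos: "x \<noteq> z \<Longrightarrow> 0 < D x z"
proof -
  assume "x \<noteq> z"
  have "F (N x) \<le> D x z" unfolding D_def
  proof (rule floyd_dist_ge)
    fix p assume p: "p \<in> edge_paths S x z"
    then obtain y q where q: "p = x # y # q" using \<open>x \<noteq> z\<close> unfolding edge_paths_def
      by (cases p rule: remdups_adj.cases) auto
    have "F (N x) \<le> floyd_edge_length S f 0 x y"
      unfolding floyd_edge_length_def word_dist_def by (auto intro!: F_antimono)
    then show "F (N x) \<le> L 0 p" using q L_nonneg[of 0 "y # q"] by simp
  qed
  then show ?thesis using F_pos[of "N x"] by linarith
qed

text \<open>
  Moving a point by \<open>g\<close> changes its norm by at most \<open>N g\<close>, hence edge
  lengths by a factor of at most \<open>\<kappa> ^ N g\<close>. So left translations are Lipschitz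
  for the Floyd distance.
\<close>

lemma ex_lipschitz: "\<exists>K>0. \<forall>x z. D (g + x) (g + z) \<le> K * D x z"
proof -
  obtain \<kappa> where k: "\<kappa> \<ge> 1" "\<And>n. F n / F (n + 1) \<le> \<kappa>"
    using floyd unfolding floyd_function_def by auto
  have k1: "F n \<le> \<kappa> * F (Suc n)" for n
    using k(2)[of n] F_pos[of "n + 1"] by (simp add: divide_le_eq add.commute)
  have kn: "F n \<le> \<kappa> ^ i * F (n + i)" for n i
  proof (induction i)
    case (Suc i)
    have "\<kappa> ^ i * F (n + i) \<le> \<kappa> ^ i * (\<kappa> * F (Suc (n + i)))"
      using k1[of "n + i"] k(1) by (intro mult_left_mono) auto
    then show ?case using Suc by (simp add: ac_simps)
  qed simp
  let ?K = "\<kappa> ^ N g"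
  have K: "?K > 0" using k(1) by simp
  have edge: "floyd_edge_length S f 0 (g + a) (g + b) \<le> ?K * floyd_edge_length S f 0 a b" for a b
  proof -
    let ?m = "min (N (g + a)) (N (g + b))"
    have "min (N a) (N b) \<le> ?m + N g"
      using N_add_ge_right[of a g] N_add_ge_right[of b g] by linarith
    then have "?K * F (?m + N g) \<le> ?K * F (min (N a) (N b))"
      using K by (intro mult_left_mono F_antimono) auto
    with kn[of ?m "N g"] show ?thesis
      unfolding floyd_edge_length_def word_dist_def by simp
  qed
  have path: "L 0 (map ((+) g) p) \<le> ?K * L 0 p" for p
  proof (induction p rule: induct_list012)
    case (3 x y p)
    then show ?case using edge[of x y] by (simp add: distrib_left)
  qed auto
  have "D (g + x) (g + z) \<le> ?K * D x z" for x z
  proof -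
    have "D (g + x) (g + z) / ?K \<le> D x z" unfolding D_def[of x z]
    proof (rule floyd_dist_ge)
      fix p assume "p \<in> edge_paths S x z"
      from floyd_dist_le[OF edge_paths_map[OF this, of g], of 0] path[of p]
      have "D (g + x) (g + z) \<le> ?K * L 0 p" unfolding D_def by linarith
      then show "D (g + x) (g + z) / ?K \<le> L 0 p" using K by (simp add: field_simps)
    qed
    then show ?thesis using K by (simp add: field_simps)
  qed
  then show ?thesis using K by blast
qed

text \<open>
  Walking from \<open>x\<close> along a geodesic for \<open>w\<close>, the norm drops by at most
  one per step, so the edges have lengths at most \<open>f (N x - 1), f (N x - 2),
  \<dots>\<close>.
\<close>

lemma D_le_tail:
  "N w \<le> N x \<Longrightarrow> D x (x + w) \<le> tail (N x - N w)"
proof (induction "N w" arbitrary: w)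
  case 0
  then obtain ws where "length ws = 0" "sum_list ws = w" using ex_geodesic_word by metis
  then show ?case by simp
next
  case (Suc n)
  then obtain h s where hs: "w = h + s" "N h = n" "s \<in> S" using N_Suc_split by metis
  let ?m = "N x - N w"
  have m: "N x - N h = Suc ?m" using Suc hs by auto
  have "D x (x + w) \<le> D x (x + h) + D (x + h) (x + h + s)"
    using D_triangle[of x "x + w" "x + h"] hs by (simp add: add.assoc)
  also have "D x (x + h) \<le> tail (Suc ?m)" using Suc(1)[of h] hs Suc(2,3) m by auto
  also have "D (x + h) (x + h + s) \<le> F (min (N (x + h)) (N (x + h + s)))"
    by (rule D_edge) fact
  also have "\<dots> \<le> F ?m"
    using N_add_ge[of x h] N_add_ge[of x w] hs Suc(2) by (intro F_antimono) (auto simp: add.assoc)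
  finally show ?case using tail_Suc[of ?m] by simp
qed

text \<open>
  The same path, with every edge estimated by the worst one.
\<close>

lemma D_le_mult: "D x (x + w) \<le> N w * F (N x - N w)"
proof (induction "N w" arbitrary: w)
  case 0
  then obtain ws where "length ws = 0" "sum_list ws = w" using ex_geodesic_word by metis
  then show ?case by simp
next
  case (Suc n)
  then obtain h s where hs: "w = h + s" "N h = n" "s \<in> S" using N_Suc_split by metis
  let ?m = "N x - N w"
  have "D x (x + w) \<le> D x (x + h) + D (x + h) (x + h + s)"
    using D_triangle[of x "x + w" "x + h"] hs by (simp add: add.assoc)
  also have "D x (x + h) \<le> n * F (N x - N h)" using Suc(1)[of h] hs by auto
  also have "\<dots> \<le> n * F ?m" using hs Suc(2) by (intro mult_left_mono F_antimono) auto
  also have "D (x + h) (x + h + s) \<le> F (min (N (x + h)) (N (x + h + s)))"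
    by (rule D_edge) fact
  also have "\<dots> \<le> F ?m"
    using N_add_ge[of x h] N_add_ge[of x w] hs Suc(2) by (intro F_antimono) (auto simp: add.assoc)
  finally show ?case using Suc(2)[symmetric] by (simp add: distrib_right)
qed

text \<open>
  The hypothesis says that the Gromov product of \<open>x\<close> and \<open>z\<close> at the
  identity is at least \<open>m\<close>. A geodesic from \<open>x\<close> to \<open>z\<close> can
  then be cut at a point that is reached from either end without the lower bounds for the norm
  given by the triangle inequality dropping below \<open>m\<close>.
\<close>

lemma D_gromov:
  assumes "2 * m + N (- x + z) \<le> N x + N z"
  shows "D x z \<le> 2 * tail m"
proof -
  let ?d = "N (- x + z)"
  have xz: "x + (- x + z) = z" by (simp add: add.assoc[symmetric])
  have zx: "z + (- z + x) = x" by (simp add: add.assoc[symmetric])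
  have a: "N x \<le> N z + ?d" using N_add[of z "- z + x"] zx N_dist_commute[of x z] by simp
  have b: "N z \<le> N x + ?d" using N_add[of x "- x + z"] xz by simp
  define i where "i = min ?d (N x - m)"
  have i: "i \<le> ?d" unfolding i_def by simp
  obtain h k where hk: "- x + z = h + k" "N h = i" "N k = ?d - i" using N_split[OF i] by metis
  have z: "z = x + h + k" using xz hk(1) by (simp add: add.assoc)
  have h: "N h \<le> N x" "m \<le> N x - N h" using hk assms a b unfolding i_def by auto
  have k: "N (- k) \<le> N z" "m \<le> N z - N (- k)" using hk assms a b unfolding i_def by auto
  have "D x z \<le> D x (x + h) + D (x + h) z" by (rule D_triangle)
  also have "D (x + h) z = D z (z + (- k))" using z D_commute by (simp add: add.assoc[symmetric])
  also have "D z (z + (- k)) \<le> tail m"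
    using D_le_tail[OF k(1)] tail_antimono[OF k(2)] by linarith
  also have "D x (x + h) \<le> tail m"
    using D_le_tail[OF h(1)] tail_antimono[OF h(2)] by linarith
  finally show ?thesis by simp
qed

text \<open>
  North-south dynamics: \<open>N (g + w)\<close> is the distance of \<open>w\<close> and \<open>-
  g\<close>. If these are Floyd-far, it is large by \<open>D_gromov\<close>, and this makes the
  Gromov product of \<open>g + w\<close> and \<open>g\<close> large.
\<close>

lemma D_contract:
  assumes "2 * tail m < e" "2 * m \<le> N g" "e \<le> D w (- g)"
  shows "D (g + w) g < e"
proof -
  have "\<not> 2 * m + N (- w + - g) \<le> N w + N (- g)"
    using D_gromov[of m w "- g"] assms by linarith
  moreover have "N (- w + - g) = N (g + w)" using N_minus[of "g + w"] by (simp add: minus_add)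
  moreover have "N (- (g + w) + g) = N w" by (simp add: minus_add add.assoc)
  ultimately have "2 * m + N (- (g + w) + g) \<le> N (g + w) + N g" using assms(2) by simp
  from D_gromov[OF this] show ?thesis using assms(1) by linarith
qed

end

section \<open>Loxodromic elements\<close>

definition pw :: "'a::group_add \<Rightarrow> nat \<Rightarrow> 'a" where "pw a n = sum_list (replicate n a)"

lemma pw_0 [simp]: "pw a 0 = 0" and pw_Suc: "pw a (Suc n) = a + pw a n"
  and pw_1 [simp]: "pw a (Suc 0) = a"
  by (simp_all add: pw_def)

lemma pw_add: "pw a (m + n) = pw a m + pw a n"
  by (simp add: pw_def replicate_add)

lemma pw_Suc2: "pw a (Suc n) = pw a n + a"
  using pw_add[of a n 1] by simp

lemma minus_pw: "- pw a n = pw (- a) n"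
proof (induction n)
  case (Suc n)
  have "- pw a (Suc n) = - pw a n + - a" by (simp only: pw_Suc minus_add)
  then show ?case by (simp only: Suc pw_Suc2)
qed simp

lemma pw_cancel_left: "n \<le> k \<Longrightarrow> pw (- a) n + pw a k = pw a (k - n)"
  using pw_add[of a n "k - n"] minus_add_cancel[of "pw a n" "pw a (k - n)"]
  by (simp add: minus_pw[symmetric])

lemma pw_cancel_right: "n \<le> k \<Longrightarrow> pw a k + pw (- a) n = pw a (k - n)"
  using pw_add[of a "k - n" n] by (simp add: minus_pw[symmetric] add.assoc)

lemma pw_mixed: "\<exists>l. pw (- a) n + pw a k = pw a l \<or> pw (- a) n + pw a k = pw (- a) l"
proof (cases "n \<le> k")
  case True then show ?thesis using pw_cancel_left by blast
next
  case False then show ?thesis using pw_cancel_right[of k n "- a"] by auto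
qed

context cayley_group begin

lemma N_pw_le: "N (pw a n) \<le> n * N a"
proof (induction n)
  case (Suc n)
  then show ?case using N_add[of a "pw a n"] by (simp add: pw_Suc)
qed simp

end

context floyd_group begin

lemma D_near: "D x (x + h) \<le> 2 * tail (N x - N h)"
proof (rule D_gromov)
  have "N x \<le> N (x + h) + N h" by (rule N_add_ge)
  moreover have "N h \<le> N (x + h) + N x" by (rule N_add_ge_right)
  ultimately show "2 * (N x - N h) + N (- x + (x + h)) \<le> N x + N (x + h)"
    by (simp add: add.assoc[symmetric])
qed

text \<open>
  Monotone summable sequences are \<open>o(1/r)\<close>.
\<close>

lemma mult_F_tendsto_0: "(\<lambda>r. real r * F (r - c)) \<longlonglongrightarrow> 0"
proof -
  have half: "real k * F (2 * k) \<le> tail k" for k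
  proof -
    have "(\<Sum>i<k. F (2 * k)) \<le> (\<Sum>i<k. F (i + k))"
      by (intro sum_mono F_antimono) simp
    also have "\<dots> \<le> tail k" unfolding tail_def
      by (intro sum_le_suminf tail_summable) auto
    finally show ?thesis by simp
  qed
  let ?u = "\<lambda>r. 2 * tail ((r - c) div 2) + (1 + real c) * F (2 * ((r - c) div 2))"
  have lim: "filterlim (\<lambda>r. (r - c) div 2) at_top sequentially"
    unfolding filterlim_at_top
  proof
    fix Z :: nat
    show "eventually (\<lambda>r. Z \<le> (r - c) div 2) sequentially"
      by (rule eventually_sequentiallyI[of "2 * Z + c"]) auto
  qed
  have lim2: "filterlim (\<lambda>r. 2 * ((r - c) div 2)) at_top sequentially"
    by (rule filterlim_at_top_mono[OF lim]) auto
  have "?u \<longlonglongrightarrow> 2 * 0 + (1 + real c) * 0"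
    by (intro tendsto_intros filterlim_compose[OF tail_tendsto_0 lim]
          filterlim_compose[OF summable_LIMSEQ_zero[OF F_summable] lim2])
  then have u: "?u \<longlonglongrightarrow> 0" by simp
  show ?thesis
  proof (rule tendsto_sandwich[OF _ _ tendsto_const u])
    show "eventually (\<lambda>r. 0 \<le> real r * F (r - c)) sequentially" by simp
    show "eventually (\<lambda>r. real r * F (r - c) \<le> ?u r) sequentially"
    proof (intro always_eventually allI)
      fix r
      let ?k = "(r - c) div 2"
      have "real r * F (r - c) \<le> (2 * real ?k + 1 + real c) * F (2 * ?k)"
        by (intro mult_mono F_antimono) auto
      also have "\<dots> = 2 * (real ?k * F (2 * ?k)) + (1 + real c) * F (2 * ?k)"
        by (simp add: algebra_simps)
      finally show "real r * F (r - c) \<le> ?u r" using half[of ?k] by linarith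
    qed
  qed
qed

lemma D_pw_le_sum:
  "D v (v + pw a n) \<le> (\<Sum>j<n. N a * F (N (v + pw a j) - N a))"
proof (induction n)
  case (Suc n)
  have "D v (v + pw a (Suc n)) \<le> D v (v + pw a n) + D (v + pw a n) (v + pw a n + a)"
    using D_triangle[of v "v + pw a (Suc n)" "v + pw a n"] by (simp add: pw_Suc2 add.assoc)
  also have "D (v + pw a n) (v + pw a n + a) \<le> N a * F (N (v + pw a n) - N a)"
    by (rule D_le_mult)
  finally show ?case using Suc by simp
qed simp

text \<open>
  A stand-in for the stability of quasi-geodesics: if the orbit segment \<open>v, v + a, \<dots>,
  v + n a\<close> stays at distance at least \<open>r\<close> from the identity, linear growth of
  the norm along it makes the sum of its edge lengths small, by comparison with the point of the
  segment closest to the identity.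
\<close>

lemma axis_near_origin:
  assumes growth: "\<And>n. n \<le> N (pw a n)" and "\<eta> > 0"
  shows "\<exists>R. \<forall>v n. \<eta> \<le> D v (v + pw a n) \<longrightarrow> (\<exists>j\<le>n. N (v + pw a j) \<le> R)"
proof -
  let ?c = "N a"
  let ?B = "\<lambda>r. 2 * (?c * (2 * (real r * F (r - ?c)) + tail (r - ?c)))"
  have lim: "filterlim (\<lambda>r. r - ?c) at_top sequentially"
    unfolding filterlim_at_top
  proof
    fix Z :: nat
    show "eventually (\<lambda>r. Z \<le> r - ?c) sequentially"
      by (rule eventually_sequentiallyI[of "Z + ?c"]) auto
  qed
  have "?B \<longlonglongrightarrow> 2 * (real ?c * (2 * 0 + 0))"
    by (intro tendsto_intros mult_F_tendsto_0 filterlim_compose[OF tail_tendsto_0 lim])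
  then have "eventually (\<lambda>r. ?B r < \<eta>) sequentially"
    using \<open>\<eta> > 0\<close> by (intro order_tendstoD(2)) auto
  then have "eventually (\<lambda>r. ?c \<le> r \<and> ?B r < \<eta>) sequentially"
    by (intro eventually_conj eventually_ge_at_top)
  then obtain R where R0: "\<forall>r\<ge>R. ?c \<le> r \<and> ?B r < \<eta>"
    unfolding eventually_sequentially ..
  then have "?c \<le> R" by blast
  have R: "?B r < \<eta>" if "r \<ge> R" for r using R0 that by blast
  have "\<exists>j\<le>n. N (v + pw a j) \<le> R" if big: "\<eta> \<le> D v (v + pw a n)" for v n
  proof (rule ccontr)
    assume far: "\<not> (\<exists>j\<le>n. N (v + pw a j) \<le> R)"
    obtain j0 where j0: "j0 \<le> n" "\<And>j. j \<le> n \<Longrightarrow> N (v + pw a j0) \<le> N (v + pw a j)"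
      using ex_has_least_nat[of "\<lambda>j. j \<le> n" n "\<lambda>j. N (v + pw a j)"] by blast
    define r where "r = N (v + pw a j0)"
    have "\<not> N (v + pw a j0) \<le> R" using far j0(1) by blast
    then have "r \<ge> R" unfolding r_def by linarith
    define h where "h i = F (max r (i - r) - ?c)" for i
    have h_tail: "h (i + 2 * r) = F (i + (r - ?c))" for i
    proof -
      have "max r (i + 2 * r - r) - ?c = i + (r - ?c)"
        using \<open>r \<ge> R\<close> \<open>R \<ge> ?c\<close> by simp
      then show ?thesis unfolding h_def by (simp only:)
    qed
    have h_nonneg: "0 \<le> h i" for i unfolding h_def by simp
    have "summable (\<lambda>i. h (i + 2 * r))" unfolding h_tail by (rule tail_summable)
    then have h_summable: "summable h" by (simp only: summable_iff_shift)
    have "suminf h = (\<Sum>i. h (i + 2 * r)) + (\<Sum>i<2 * r. h i)"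
      by (rule suminf_split_initial_segment[OF h_summable])
    also have "(\<Sum>i. h (i + 2 * r)) = tail (r - ?c)" unfolding h_tail tail_def ..
    also have "(\<Sum>i<2 * r. h i) \<le> (\<Sum>i<2 * r. F (r - ?c))"
      unfolding h_def by (intro sum_mono F_antimono) simp
    finally have h_sum: "suminf h \<le> 2 * (real r * F (r - ?c)) + tail (r - ?c)" by simp
    have part: "(\<Sum>j\<in>J. h (d j)) \<le> suminf h" if "finite J" "inj_on d J" for d :: "nat \<Rightarrow> nat" and J
    proof -
      have "(\<Sum>j\<in>J. h (d j)) = sum h (d ` J)" by (simp add: sum.reindex[OF that(2)])
      also have "\<dots> \<le> suminf h" using that h_nonneg by (intro sum_le_suminf h_summable) auto
      finally show ?thesis .
    qed
    have apart: "k - i \<le> N (v + pw a i) + N (v + pw a k)" if "i \<le> k" for i k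
    proof -
      have "k - i \<le> N (pw a (k - i))" by (rule growth)
      also have "pw a (k - i) = - (v + pw a i) + (v + pw a k)"
        unfolding minus_translate minus_pw pw_cancel_left[OF that] ..
      also have "N \<dots> \<le> N (v + pw a i) + N (v + pw a k)"
        using N_add[of "- (v + pw a i)" "v + pw a k"] by (simp only: N_minus)
      finally show ?thesis .
    qed
    \<comment> \<open>With \<open>i = \<bar>j - j0\<bar>\<close>, both \<open>r\<close> and \<open>i - r\<close>
      are lower bounds for the norm of the \<open>j\<close>-th point.\<close>
    have low: "F (N (v + pw a j) - ?c) \<le> h (max j j0 - min j j0)" if "j < n" for j
    proof -
      have "max j j0 - min j j0 \<le> N (v + pw a j) + r"
        using apart[of j j0] apart[of j0 j] unfolding r_def by linarith
      moreover have "r \<le> N (v + pw a j)" using j0(2)[of j] that unfolding r_def by simp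
      ultimately show ?thesis unfolding h_def by (intro F_antimono) linarith
    qed
    have "\<eta> \<le> (\<Sum>j<n. ?c * F (N (v + pw a j) - ?c))" using big D_pw_le_sum[of v a n] by linarith
    also have "\<dots> \<le> (\<Sum>j<n. ?c * h (max j j0 - min j j0))"
      using low by (intro sum_mono mult_left_mono) auto
    also have "\<dots> = ?c * ((\<Sum>j<j0. h (j0 - j)) + (\<Sum>j=j0..<n. h (j - j0)))"
    proof -
      have split: "{..<n} = {..<j0} \<union> {j0..<n}" using j0(1) by auto
      have "(\<Sum>j<n. h (max j j0 - min j j0)) =
          (\<Sum>j<j0. h (max j j0 - min j j0)) + (\<Sum>j=j0..<n. h (max j j0 - min j j0))"
        unfolding split by (rule sum.union_disjoint) auto
      also have "(\<Sum>j<j0. h (max j j0 - min j j0)) = (\<Sum>j<j0. h (j0 - j))"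
        by (rule sum.cong) (auto simp: max_def min_def)
      also have "(\<Sum>j=j0..<n. h (max j j0 - min j j0)) = (\<Sum>j=j0..<n. h (j - j0))"
        by (rule sum.cong) (auto simp: max_def min_def)
      finally show ?thesis by (simp only: sum_distrib_left[symmetric])
    qed
    also have "\<dots> \<le> ?c * (suminf h + suminf h)"
      by (intro mult_left_mono add_mono part) (auto simp: inj_on_def)
    also have "\<dots> = 2 * (?c * suminf h)" by simp
    also have "\<dots> \<le> ?B r" using h_sum by (intro mult_left_mono) auto
    finally show False using R[OF \<open>r \<ge> R\<close>] by simp
  qed
  then show ?thesis by blast
qed


text \<open>
  The powers of \<open>a\<close> go to infinity towards two distinct ends. The number
  \<open>m\<close> turns the separation into norm estimates: a Gromov product of at least
  \<open>m\<close> forces a Floyd distance below \<open>e\<close>.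
\<close>

definition loxodromic :: "'a \<Rightarrow> real \<Rightarrow> nat \<Rightarrow> bool" where
  "loxodromic a e m \<longleftrightarrow> 2 * tail m < e \<and>
     (\<forall>n\<ge>1. \<forall>k\<ge>1. e \<le> D (pw a n) (pw (- a) k)) \<and> (\<forall>n. n \<le> N (pw a n))"

lemma loxodromic_minus: "loxodromic a e m \<Longrightarrow> loxodromic (- a) e m"
  unfolding loxodromic_def by (simp add: D_commute minus_pw[symmetric])

lemma loxodromic_pos: "loxodromic a e m \<Longrightarrow> e > 0"
  unfolding loxodromic_def using tail_nonneg[of m] by linarith

text \<open>
  If \<open>a\<close> and \<open>- a\<close> are far apart, contraction keeps all positive powers
  close to \<open>a\<close> and all negative powers close to \<open>- a\<close>. The resulting
  bound on the Gromov product of \<open>n a\<close> and \<open>- a\<close> makes the norm of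
  \<open>n a\<close> increase with \<open>n\<close>.
\<close>

lemma loxodromicI:
  assumes m: "2 * tail m < e" and a: "2 * m \<le> N a" "3 * e \<le> D a (- a)"
  shows "loxodromic a e m"
proof -
  have e: "e > 0" using m tail_nonneg[of m] by linarith
  have pole: "D (pw b (Suc n)) b < e" if "2 * m \<le> N b" "3 * e \<le> D b (- b)" for b n
  proof (induction n)
    case (Suc n)
    have "e \<le> D (pw b (Suc n)) (- b)"
      using D_triangle[of b "- b" "pw b (Suc n)"] D_commute[of b "pw b (Suc n)"] Suc that(2) e
      by linarith
    from D_contract[OF m that(1) this] show ?case by (simp only: pw_Suc[of b "Suc n"])
  qed (use e in simp)
  have far: "e \<le> D (pw a n) (pw (- a) k)" if nk: "n \<ge> 1" "k \<ge> 1" for n k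
  proof -
    obtain n' k' where n: "n = Suc n'" "k = Suc k'" using nk by (cases n; cases k) auto
    have "D (pw a n) a < e" "D (pw (- a) k) (- a) < e"
      using pole[of a n'] pole[of "- a" k'] a n by (auto simp: D_commute)
    moreover have "D a (- a) \<le> D a (pw a n) + D (pw a n) (pw (- a) k) + D (pw (- a) k) (- a)"
      using D_triangle[of a "- a" "pw a n"] D_triangle[of "pw a n" "- a" "pw (- a) k"] by linarith
    ultimately show ?thesis using a(2) D_commute[of a "pw a n"] by linarith
  qed
  have "n \<le> N (pw a n)" for n
  proof (induction n)
    case (Suc n)
    show ?case
    proof (cases "n = 0")
      case True
      have "N a \<noteq> 0"
      proof
        assume "N a = 0"
        then have "D a (- a) \<le> 2 * tail m" using a(1) by (intro D_gromov) (use N_add[of "- a" "- a"] in auto)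
        then show False using a(2) m e by linarith
      qed
      then show ?thesis using True by simp
    next
      case False
      have "\<not> D (pw a n) (- a) \<le> 2 * tail m" using far[of n 1] False m by simp
      then have "\<not> 2 * m + N (- pw a n + - a) \<le> N (pw a n) + N (- a)"
        using D_gromov[of m "pw a n" "- a"] by blast
      moreover have "N (- pw a n + - a) = N (pw a (Suc n))"
        unfolding pw_Suc N_minus[of "a + pw a n", symmetric] minus_add ..
      ultimately show ?thesis using Suc a(1) by simp
    qed
  qed simp
  then show ?thesis unfolding loxodromic_def using m far by blast
qed

text \<open>
  Let \<open>x\<close> and \<open>z\<close> have large norm and be Floyd-separated. One of them is
  Floyd-far from its inverse, or else \<open>- x\<close> is close to \<open>x\<close> and \<open>-
  z\<close> to \<open>z\<close>, and then \<open>x - z\<close> is close to \<open>x\<close> while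
  its inverse \<open>z - x\<close> is close to \<open>z\<close>. The factor \<open>7 = 3 + 3 +
  1\<close> leaves \<open>e \<le> D (- z) (- x)\<close> for the contraction in the second case.
\<close>

lemma ex_loxodromic:
  assumes "t > 0" and far: "\<And>R. \<exists>x z. t \<le> D x z \<and> R < N x \<and> R < N z"
  shows "\<exists>a e m. loxodromic a e m"
proof -
  define e where "e = t / 7"
  have "e > 0" using \<open>t > 0\<close> by (simp add: e_def)
  obtain m where m: "2 * tail m < e" using ex_tail_less[OF \<open>e > 0\<close>] by blast
  obtain x z where xz: "7 * e \<le> D x z" "2 * m < N x" "2 * m < N z"
    using far[of "2 * m"] unfolding e_def by auto
  show ?thesis
  proof (cases "3 * e \<le> D x (- x) \<or> 3 * e \<le> D z (- z)")
    case True
    then show ?thesis using loxodromicI[OF m] xz(2,3) less_imp_le by metis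
  next
    case False
    have far': "e \<le> D (- z) (- x)"
      using D_triangle[of x z "- x"] D_triangle[of "- x" z "- z"] False xz(1)
        D_commute[of "- z" "- x"] D_commute[of "- z" z] by linarith
    have 1: "D (x + - z) x < e" using xz far' by (intro D_contract[OF m]) auto
    have 2: "D (z + - x) z < e" using xz far' by (intro D_contract[OF m]) (auto simp: D_commute)
    have eq: "- (x + - z) = z + - x" by (simp only: minus_add minus_minus)
    have "3 * e \<le> D (x + - z) (- (x + - z))"
      using D_triangle[of x z "x + - z"] D_triangle[of "x + - z" z "z + - x"] 1 2 xz(1) \<open>e > 0\<close>
        D_commute[of x "x + - z"] unfolding eq by linarith
    moreover have "2 * m \<le> N (x + - z)"
    proof -
      have "\<not> 2 * m + N (- (- z) + - x) \<le> N (- z) + N (- x)"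
        using D_gromov[of m "- z" "- x"] far' m by linarith
      moreover have "N (- (- z) + - x) = N (x + - z)"
        unfolding N_minus[of "x + - z", symmetric] eq by (simp only: minus_minus)
      ultimately show ?thesis using xz(2,3) by simp
    qed
    ultimately show ?thesis using loxodromicI[OF m] by blast
  qed
qed


lemma loxodromic_growth: "loxodromic a e m \<Longrightarrow> n \<le> N (pw a n)"
  and loxodromic_far: "loxodromic a e m \<Longrightarrow> 1 \<le> n \<Longrightarrow> 1 \<le> k \<Longrightarrow> e \<le> D (pw a n) (pw (- a) k)"
  and loxodromic_tail: "loxodromic a e m \<Longrightarrow> 2 * tail m < e"
  unfolding loxodromic_def by blast+

text \<open>
  The powers of \<open>a\<close> converge to a pole: seen from \<open>n a\<close>, the identity
  and \<open>k a\<close> lie on opposite sides, so the norms of \<open>n a\<close> and \<open>(k -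
  n) a\<close> nearly add up to that of \<open>k a\<close>.
\<close>

lemma loxodromic_cauchy_aux:
  assumes a: "loxodromic a e m" and "n \<le> k"
  shows "D (pw a n) (pw a k) \<le> 2 * tail (n - m)"
proof (cases "n = k \<or> n \<le> m")
  case True
  have "N (- pw a n + pw a k) \<le> N (pw a n) + N (pw a k)"
    using N_add[of "- pw a n" "pw a k"] by (simp only: N_minus)
  moreover have "n \<le> N (pw a n)" by (rule loxodromic_growth[OF a])
  ultimately show ?thesis using True by (intro D_gromov) auto
next
  case False
  let ?p = "pw a n" and ?q = "pw a (k - n)"
  have k: "pw a k = ?p + ?q" using pw_add[of a n "k - n"] assms(2) by simp
  have "e \<le> D (pw (- a) n) ?q"
    using loxodromic_far[OF a, of "k - n" n] False assms(2) D_commute by auto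
  then have "\<not> 2 * m + N (- pw (- a) n + ?q) \<le> N (pw (- a) n) + N ?q"
    using D_gromov[of m "pw (- a) n" ?q] loxodromic_tail[OF a] by linarith
  then have "N ?p + N ?q < 2 * m + N (pw a k)"
    by (simp add: minus_pw[symmetric] k)
  moreover have "n \<le> N ?p" by (rule loxodromic_growth[OF a])
  moreover have "- ?p + pw a k = ?q" by (simp add: k add.assoc[symmetric])
  ultimately show ?thesis using False by (intro D_gromov) auto
qed

lemma loxodromic_cauchy:
  assumes a: "loxodromic a e m" and "n0 \<le> n" "n0 \<le> k"
  shows "D (pw a n) (pw a k) \<le> 2 * tail (n0 - m)"
proof -
  have *: "D (pw a n) (pw a k) \<le> 2 * tail (n0 - m)" if "n0 \<le> n" "n \<le> k" for n k
  proof -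
    have "tail (n - m) \<le> tail (n0 - m)" using that by (intro tail_antimono) simp
    with loxodromic_cauchy_aux[OF a that(2)] show ?thesis by linarith
  qed
  show ?thesis
  proof (cases "n \<le> k")
    case True then show ?thesis using * assms by blast
  next
    case False then show ?thesis using *[of k n] assms D_commute by simp
  qed
qed

text \<open>
  If \<open>g + n b\<close> and \<open>k a\<close> converge to the same pole, then, seen from
  \<open>k a\<close>, the orbit \<open>g, g + b, g + 2 b, \<dots>\<close> leads from one pole of
  \<open>a\<close> to the other and hence passes at bounded distance from \<open>k a\<close>, for
  every large \<open>k\<close>. Balls being finite, two of the differences \<open>- k a + g + j
  b\<close> coincide.
\<close>

lemma common_end_imp_relation:
  assumes a: "loxodromic a e m" and growth: "\<And>n. n \<le> N (pw b n)"
    and asym: "\<And>\<eta>. \<eta> > 0 \<Longrightarrow> \<exists>n0. \<forall>n\<ge>n0. \<forall>k\<ge>n0. D (g + pw b n) (pw a k) < \<eta>"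
  shows "\<exists>i\<ge>1. \<exists>j\<ge>1. pw a i + g = g + pw b j \<or> pw a i + g = g + pw (- b) j"
proof -
  have e: "e > 0" by (rule loxodromic_pos[OF a])
  obtain R where R: "\<And>v n. e / 4 \<le> D v (v + pw b n) \<Longrightarrow> \<exists>j\<le>n. N (v + pw b j) \<le> R"
    using axis_near_origin[OF growth, of "e / 4"] e by (meson divide_pos_pos zero_less_numeral)
  obtain m' where m': "2 * tail m' < e / 4" using ex_tail_less[of "e / 4"] e by auto
  define k0 where "k0 = Suc (m' + N g)"
  \<comment> \<open>Translated by \<open>- k a\<close>, the point \<open>k a\<close> becomes the identity.\<close>
  have near: "\<exists>j. N (pw (- a) k + g + pw b j) \<le> R" if "k \<ge> k0" for k
  proof -
    obtain K where K: "K > 0" "\<And>x z. D (pw (- a) k + x) (pw (- a) k + z) \<le> K * D x z"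
      using ex_lipschitz by blast
    obtain n0 where n0: "\<And>n l. n \<ge> n0 \<Longrightarrow> l \<ge> n0 \<Longrightarrow> D (g + pw b n) (pw a l) < e / (4 * K)"
      using asym[of "e / (4 * K)"] e K(1) by (meson divide_pos_pos mult_pos_pos zero_less_numeral)
    define l where "l = max n0 (k + 1)"
    define v where "v = pw (- a) k + g"
    have l: "n0 \<le> l" "k \<le> l" "1 \<le> l - k" unfolding l_def by auto
    have "pw (- a) k + pw a l = pw a (l - k)" by (rule pw_cancel_left[OF l(2)])
    then have "D (v + pw b n0) (pw a (l - k)) \<le> K * D (g + pw b n0) (pw a l)"
      using K(2)[of "g + pw b n0" "pw a l"] by (simp add: v_def add.assoc)
    also have "\<dots> < K * (e / (4 * K))"
      using n0[of n0 l] l K(1) by (intro mult_strict_left_mono) auto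
    also have "\<dots> = e / 4" using K(1) by simp
    finally have 1: "D (v + pw b n0) (pw a (l - k)) < e / 4" .
    have "D (pw (- a) k) v \<le> 2 * tail (N (pw (- a) k) - N g)"
      unfolding v_def by (rule D_near)
    also have "\<dots> \<le> 2 * tail m'"
      using loxodromic_growth[OF loxodromic_minus[OF a], of k] that
      by (intro mult_left_mono tail_antimono) (auto simp: k0_def)
    finally have 2: "D (pw (- a) k) v < e / 4" using m' by simp
    have 3: "e \<le> D (pw a (l - k)) (pw (- a) k)"
      using loxodromic_far[OF a l(3), of k] that by (auto simp: k0_def)
    have "e / 4 \<le> D v (v + pw b n0)"
      using 1 2 3 e D_triangle[of "pw a (l - k)" "pw (- a) k" "v + pw b n0"]
        D_triangle[of "v + pw b n0" "pw (- a) k" v]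
        D_commute[of v "v + pw b n0"] D_commute[of v "pw (- a) k"]
        D_commute[of "v + pw b n0" "pw a (l - k)"] by linarith
    from R[OF this] show ?thesis unfolding v_def by blast
  qed
  define J where "J k = (SOME j. N (pw (- a) k + g + pw b j) \<le> R)" for k
  define h where "h k = pw (- a) k + g + pw b (J k)" for k
  have h: "N (h k) \<le> R" if "k \<ge> k0" for k
    unfolding h_def J_def using someI_ex[OF near[OF that]] .
  have "\<not> inj_on h {k0..}"
  proof
    assume "inj_on h {k0..}"
    moreover have "finite (h ` {k0..})"
      using h by (intro finite_subset[OF _ finite_ball[of R]]) auto
    ultimately have "finite {k0..}" using finite_imageD by blast
    then show False using infinite_Ici by blast
  qed
  obtain k k' where kk: "k < k'" "h k = h k'"
  proof -
    assume *: "\<And>k k'. k < k' \<Longrightarrow> h k = h k' \<Longrightarrow> thesis"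
    obtain x y where "h x = h y" "x \<noteq> y"
      using \<open>\<not> inj_on h {k0..}\<close> unfolding inj_on_def by blast
    then show thesis using *[of x y] *[of y x] by (cases x y rule: linorder_cases) auto
  qed
  define i where "i = k' - k"
  have "pw (- a) k' = pw (- a) k + pw (- a) i"
    using pw_add[of "- a" k i] kk(1) by (simp add: i_def)
  then have "pw (- a) k + (g + pw b (J k)) = pw (- a) k + (pw (- a) i + g + pw b (J k'))"
    using kk(2) by (simp add: h_def add.assoc)
  then have "g + pw b (J k) = - pw a i + g + pw b (J k')"
    by (simp only: add_left_cancel minus_pw)
  then have "pw a i + (g + pw b (J k)) = g + pw b (J k')"
    by (simp only: add.assoc[symmetric] right_minus add_0_left)
  then have "pw a i + g + pw b (J k) + pw (- b) (J k) = g + pw b (J k') + pw (- b) (J k)"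
    by (simp only: add.assoc)
  then have rel: "pw a i + g = g + (pw b (J k') + pw (- b) (J k))"
    by (simp only: add.assoc minus_pw[symmetric] right_minus add_0_right)
  have i: "i \<ge> 1" using kk(1) by (simp add: i_def)
  show ?thesis
  proof (cases "J k < J k'")
    case True
    then show ?thesis using rel pw_cancel_right[of "J k" "J k'" b] i
      by (intro exI[of _ i] conjI exI[of _ "J k' - J k"]) auto
  next
    case False
    then have rel': "pw a i + g = g + pw (- b) (J k - J k')"
      using rel pw_cancel_left[of "J k'" "J k" "- b"] by simp
    moreover have "J k \<noteq> J k'"
    proof
      assume "J k = J k'"
      then have "pw a i + g = 0 + g" using rel' by simp
      then have "pw a i = 0" by (simp only: add_right_cancel)
      then show False using loxodromic_growth[OF a, of i] i by simp
    qed
    ultimately show ?thesis using False i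
      by (intro exI[of _ i] conjI exI[of _ "J k - J k'"]) auto
  qed
qed


section \<open>Paradoxical, two-ended, or Floyd-small groups\<close>

text \<open>
  Some nontrivial powers of \<open>a\<close> and of its conjugate by \<open>g\<close> agree;
  geometrically, \<open>g\<close> preserves the pair of poles of \<open>a\<close>.
\<close>

definition power_relation :: "'a \<Rightarrow> 'a \<Rightarrow> bool" where
  "power_relation a g \<longleftrightarrow>
     (\<exists>i\<ge>1. \<exists>j\<ge>1. \<exists>c\<in>{a, - a}. pw a i + g = g + pw c j)"

lemma power_relation_minus:
  assumes "power_relation (- a) g"
  shows "power_relation a g"
proof -
  obtain i j c where ij: "i \<ge> 1" "j \<ge> 1" and c: "c \<in> {- a, a}" and eq: "pw (- a) i + g = g + pw c j"
    using assms unfolding power_relation_def by auto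
  have "g = pw a i + (pw (- a) i + g)"
    by (simp only: minus_pw[symmetric] add.assoc[symmetric] right_minus add_0_left)
  also have "\<dots> = pw a i + g + pw c j" by (simp only: eq add.assoc)
  finally have "pw a i + g + pw c j + pw (- c) j = g + pw (- c) j" by simp
  then have "pw a i + g = g + pw (- c) j"
    by (simp only: minus_pw[symmetric] add.assoc right_minus add_0_right)
  then show ?thesis unfolding power_relation_def
    using ij c by (intro exI[of _ i] exI[of _ j] conjI bexI[of _ "- c"]) auto
qed

text \<open>
  Failing a relation, \<open>g\<close> moves no pole of \<open>a\<close> to a pole of
  \<open>a\<close>. A single pair of far points that are separated yields uniform separation,
  because both sequences converge.
\<close>

lemma poles_apart:
  assumes a: "loxodromic a e m" and no: "\<not> power_relation a g"
    and sign: "\<alpha> \<in> {a, - a}" "\<beta> \<in> {a, - a}"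
  shows "\<exists>\<eta>>0. \<exists>n0. \<forall>n\<ge>n0. \<forall>k\<ge>n0. \<eta> \<le> D (g + pw \<beta> n) (pw \<alpha> k)"
proof -
  have lox: "loxodromic \<alpha> e m" "loxodromic \<beta> e m" using sign a loxodromic_minus by auto
  have "\<not> power_relation \<alpha> g" using no sign power_relation_minus by auto
  moreover have "\<beta> \<in> {\<alpha>, - \<alpha>}" "- \<beta> \<in> {\<alpha>, - \<alpha>}" using sign by auto
  ultimately have "\<not> (\<exists>i\<ge>1. \<exists>j\<ge>1. pw \<alpha> i + g = g + pw \<beta> j \<or> pw \<alpha> i + g = g + pw (- \<beta>) j)"
    unfolding power_relation_def by blast
  then have "\<not> (\<forall>\<eta>>0. \<exists>n0. \<forall>n\<ge>n0. \<forall>k\<ge>n0. D (g + pw \<beta> n) (pw \<alpha> k) < \<eta>)"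
    using common_end_imp_relation[OF lox(1), of \<beta> g] loxodromic_growth[OF lox(2)] by blast
  then obtain \<eta> where \<eta>: "\<eta> > 0"
      "\<And>n0. \<exists>n\<ge>n0. \<exists>k\<ge>n0. \<eta> \<le> D (g + pw \<beta> n) (pw \<alpha> k)"
    by (meson linorder_not_less)
  obtain K where K: "K > 0" "\<And>x z. D (g + x) (g + z) \<le> K * D x z"
    using ex_lipschitz by blast
  obtain m' where "2 * tail m' < \<eta> / (2 * (K + 1))"
    using ex_tail_less[of "\<eta> / (2 * (K + 1))"] \<eta>(1) K(1) by auto
  then have m': "(K + 1) * (2 * tail m') < \<eta> / 2"
    using K(1) by (simp add: field_simps)
  have "\<eta> / 2 \<le> D (g + pw \<beta> n) (pw \<alpha> k)" if n: "n \<ge> m' + m" and k: "k \<ge> m' + m" for n k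
  proof -
    obtain n' k' where nk: "n' \<ge> m' + m" "k' \<ge> m' + m" "\<eta> \<le> D (g + pw \<beta> n') (pw \<alpha> k')"
      using \<eta>(2) by blast
    have 1: "D (g + pw \<beta> n') (g + pw \<beta> n) \<le> K * (2 * tail m')"
      using K(2)[of "pw \<beta> n'" "pw \<beta> n"] loxodromic_cauchy[OF lox(2) nk(1) n] K(1)
      by (simp add: order_trans[OF _ mult_left_mono])
    have 2: "D (pw \<alpha> k) (pw \<alpha> k') \<le> 2 * tail m'"
      using loxodromic_cauchy[OF lox(1) k nk(2)] by simp
    have "K * (2 * tail m') + 2 * tail m' = (K + 1) * (2 * tail m')"
      by (simp add: algebra_simps)
    then show ?thesis
      using D_triangle[of "g + pw \<beta> n'" "pw \<alpha> k'" "g + pw \<beta> n"]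
        D_triangle[of "g + pw \<beta> n" "pw \<alpha> k'" "pw \<alpha> k"] 1 2 nk(3) m' by linarith
  qed
  then show ?thesis using \<eta>(1) by (intro exI[of _ "\<eta> / 2"] conjI exI[of _ "m' + m"]) auto
qed

text \<open>
  Ping-pong with \<open>A = n a\<close> and its conjugate \<open>B = g + n a - g\<close>, whose
  poles are mutually far: \<open>P\<close> and \<open>Q\<close> are neighbourhoods of the two
  poles of \<open>A\<close>, and \<open>Y\<close> is one of the pair of poles of \<open>B\<close>.
  The inclusions are paradoxical: an invariant mean would give \<open>P \<union> Q\<close> full
  measure and \<open>Y\<close> at least half.
\<close>

lemma paradox_of_no_relation:
  assumes a: "loxodromic a e m" and no: "\<not> power_relation a g"
  shows "\<exists>(A::'a) (B::'a) P Q Y. P \<inter> Q = {} \<and> P \<inter> Y = {} \<and> Q \<inter> Y = {} \<and>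
    (\<forall>w. w \<notin> P \<longrightarrow> A + w \<in> Q) \<and> (\<forall>w. w \<notin> Y \<longrightarrow> B + w \<in> Y)"
proof -
  have e: "e > 0" by (rule loxodromic_pos[OF a])
  have "\<exists>\<eta>>0. \<exists>n0. \<forall>\<alpha>\<in>{a, - a}. \<forall>\<beta>\<in>{a, - a}. \<forall>n\<ge>n0. \<eta> \<le> D (g + pw \<beta> n) (pw \<alpha> n)"
  proof -
    have pair: "\<exists>\<eta>>0. \<exists>n0. \<forall>n\<ge>n0. \<eta> \<le> D (g + pw \<beta> n) (pw \<alpha> n)"
      if "\<alpha> \<in> {a, - a}" "\<beta> \<in> {a, - a}" for \<alpha> \<beta>
      using poles_apart[OF a no that] by blast
    obtain h1 n1 where 1: "h1 > 0" "\<forall>n\<ge>n1. h1 \<le> D (g + pw a n) (pw a n)" using pair[of a a] by blast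
    obtain h2 n2 where 2: "h2 > 0" "\<forall>n\<ge>n2. h2 \<le> D (g + pw (- a) n) (pw a n)" using pair[of a "- a"] by blast
    obtain h3 n3 where 3: "h3 > 0" "\<forall>n\<ge>n3. h3 \<le> D (g + pw a n) (pw (- a) n)" using pair[of "- a" a] by blast
    obtain h4 n4 where 4: "h4 > 0" "\<forall>n\<ge>n4. h4 \<le> D (g + pw (- a) n) (pw (- a) n)" using pair[of "- a" "- a"] by blast
    define h where "h = min (min h1 h2) (min h3 h4)"
    have h: "h > 0" "h \<le> h1" "h \<le> h2" "h \<le> h3" "h \<le> h4" using 1 2 3 4 by (auto simp: h_def)
    have "\<forall>\<alpha>\<in>{a, - a}. \<forall>\<beta>\<in>{a, - a}. h \<le> D (g + pw \<beta> n) (pw \<alpha> n)" if "n \<ge> n1 + n2 + n3 + n4" for n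
    proof -
      have "n1 \<le> n" "n2 \<le> n" "n3 \<le> n" "n4 \<le> n" using that by linarith+
      then have "h1 \<le> D (g + pw a n) (pw a n)" "h2 \<le> D (g + pw (- a) n) (pw a n)"
        "h3 \<le> D (g + pw a n) (pw (- a) n)" "h4 \<le> D (g + pw (- a) n) (pw (- a) n)"
        using 1(2) 2(2) 3(2) 4(2) by blast+
      with h show ?thesis by (simp add: order_trans[of h])
    qed
    with h(1) show ?thesis by blast
  qed
  then obtain \<eta> n0 where \<eta>: "\<eta> > 0"
    "\<And>\<alpha> \<beta> n. \<alpha> \<in> {a, - a} \<Longrightarrow> \<beta> \<in> {a, - a} \<Longrightarrow> n \<ge> n0 \<Longrightarrow> \<eta> \<le> D (g + pw \<beta> n) (pw \<alpha> n)"
    by blast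
  \<comment> \<open>\<open>B\<close> differs from \<open>g + n a\<close> by a bounded right factor, which
    costs one \<open>\<epsilon>\<close>; the bound \<open>e / 2\<close> separates
    \<open>P\<close> from \<open>Q\<close>.\<close>
  define \<epsilon> where "\<epsilon> = min (\<eta> / 4) (e / 2)"
  have \<epsilon>: "\<epsilon> > 0" "4 * \<epsilon> \<le> \<eta>" "2 * \<epsilon> \<le> e" using \<eta>(1) e by (auto simp: \<epsilon>_def)
  obtain m' where m': "2 * tail m' < \<epsilon>" using ex_tail_less[OF \<epsilon>(1)] by blast
  define n where "n = n0 + 2 * m' + 2 * N g + 1"
  define A where "A = pw a n"
  define B where "B = g + pw a n + - g"
  have mA: "- A = pw (- a) n" by (simp add: A_def minus_pw)
  have mB: "- B = g + pw (- a) n + - g"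
    unfolding B_def minus_add minus_minus minus_pw by (simp only: add.assoc)
  have grow: "n \<le> N (pw \<beta> n)" if "\<beta> \<in> {a, - a}" for \<beta>
    using that loxodromic_growth[OF a] loxodromic_growth[OF loxodromic_minus[OF a]] by auto
  have grow_g: "n - N g \<le> N (g + pw \<beta> n)" if "\<beta> \<in> {a, - a}" for \<beta>
    using grow[OF that] N_add_ge_right[of "pw \<beta> n" g] by linarith
  have NA: "2 * m' \<le> N A" using grow[of a] by (simp add: A_def n_def)
  have NB: "2 * m' \<le> N B"
    using grow_g[of a] N_add_ge[of "g + pw a n" "- g"] by (simp add: B_def n_def)
  have conj: "D (g + pw \<beta> n) (g + pw \<beta> n + - g) < \<epsilon>" if "\<beta> \<in> {a, - a}" for \<beta>
  proof -
    have "D (g + pw \<beta> n) (g + pw \<beta> n + - g) \<le> 2 * tail (N (g + pw \<beta> n) - N (- g))"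
      by (rule D_near)
    also have "\<dots> \<le> 2 * tail m'"
      using grow_g[OF that] by (intro mult_left_mono tail_antimono) (auto simp: n_def)
    finally show ?thesis using m' by linarith
  qed
  have apart: "3 * \<epsilon> \<le> D \<alpha> \<beta>" if "\<alpha> \<in> {A, - A}" "\<beta> \<in> {B, - B}" for \<alpha> \<beta>
  proof -
    have "\<alpha> = pw a n \<or> \<alpha> = pw (- a) n" using that(1) unfolding mA by (simp add: A_def)
    then obtain \<alpha>' where \<alpha>: "\<alpha>' \<in> {a, - a}" "\<alpha> = pw \<alpha>' n" by blast
    have "\<beta> = g + pw a n + - g \<or> \<beta> = g + pw (- a) n + - g"
      using that(2) unfolding mB by (simp only: B_def insert_iff empty_iff) blast
    then obtain \<beta>' where \<beta>: "\<beta>' \<in> {a, - a}" "\<beta> = g + pw \<beta>' n + - g" by blast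
    have "\<eta> \<le> D (g + pw \<beta>' n) \<alpha>" using \<eta>(2)[OF \<alpha>(1) \<beta>(1), of n] \<alpha>(2) by (simp add: n_def)
    moreover have "D (g + pw \<beta>' n) \<beta> < \<epsilon>" using conj[OF \<beta>(1)] \<beta>(2) by simp
    ultimately show ?thesis
      using D_triangle[of "g + pw \<beta>' n" \<alpha> \<beta>] D_commute[of \<alpha> \<beta>] \<epsilon> by linarith
  qed
  have AA: "2 * \<epsilon> \<le> D A (- A)"
    using loxodromic_far[OF a, of n n] \<epsilon>(3) unfolding mA by (simp add: A_def n_def)
  define P where "P = {w. D w (- A) < \<epsilon>}"
  define Q where "Q = {w. D w A < \<epsilon>}"
  define Y where "Y = {w. D w B < \<epsilon> \<or> D w (- B) < \<epsilon>}"
  have disj: False if "D w x < \<epsilon>" "D w y < \<epsilon>" "2 * \<epsilon> \<le> D x y" for w x y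
    using that D_triangle[of x y w] D_commute[of w x] by linarith
  have "P \<inter> Q = {}"
    unfolding P_def Q_def using disj[OF _ _ AA] by blast
  moreover have "P \<inter> Y = {}" "Q \<inter> Y = {}"
  proof -
    have "False" if "D w \<alpha> < \<epsilon>" "D w \<beta> < \<epsilon>" "\<alpha> \<in> {A, - A}" "\<beta> \<in> {B, - B}" for w \<alpha> \<beta>
      using disj[OF that(1,2)] apart[OF that(3,4)] \<epsilon>(1) by linarith
    then show "P \<inter> Y = {}" "Q \<inter> Y = {}" unfolding P_def Q_def Y_def by blast+
  qed
  moreover have "A + w \<in> Q" if "w \<notin> P" for w
    using that D_contract[OF m' NA, of w] unfolding P_def Q_def by simp
  moreover have "B + w \<in> Y" if "w \<notin> Y" for w
    using that D_contract[OF m' NB, of w] unfolding Y_def by simp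
  ultimately show ?thesis by blast
qed

text \<open>
  The relation says that the line \<open>\<int> c\<close> translated by \<open>g\<close> has the
  same two poles as \<open>\<int> a\<close>. So it joins far points that are Floyd-separated, and
  has to come near the identity.
\<close>

lemma near_axis_of_relations:
  assumes a: "loxodromic a e m" and rel: "\<And>g. power_relation a g"
  shows "\<exists>R. \<forall>g. \<exists>l. N (g + pw a l) \<le> R \<or> N (g + pw (- a) l) \<le> R"
proof -
  have e: "e > 0" by (rule loxodromic_pos[OF a])
  obtain R1 where R1: "\<And>v n. e / 4 \<le> D v (v + pw a n) \<Longrightarrow> \<exists>j\<le>n. N (v + pw a j) \<le> R1"
    using axis_near_origin[OF loxodromic_growth[OF a], of "e / 4"] e
    by (meson divide_pos_pos zero_less_numeral)
  obtain R2 where R2: "\<And>v n. e / 4 \<le> D v (v + pw (- a) n) \<Longrightarrow> \<exists>j\<le>n. N (v + pw (- a) j) \<le> R2"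
    using axis_near_origin[OF loxodromic_growth[OF loxodromic_minus[OF a]], of "e / 4"] e
    by (meson divide_pos_pos zero_less_numeral)
  define R where "R = max R1 R2"
  have R: "\<exists>j\<le>n. N (v + pw c j) \<le> R" if big: "e / 4 \<le> D v (v + pw c n)" "c \<in> {a, - a}" for v n c
  proof (cases "c = a")
    case True
    have "\<exists>j\<le>n. N (v + pw a j) \<le> R1" using R1[of v n] big(1) unfolding True by blast
    then show ?thesis unfolding True R_def by (meson max.coboundedI1)
  next
    case False
    then have c: "c = - a" using big(2) by blast
    have "\<exists>j\<le>n. N (v + pw (- a) j) \<le> R2" using R2[of v n] big(1) unfolding c by blast
    then show ?thesis unfolding c R_def by (meson max.coboundedI2)
  qed
  obtain m' where m': "2 * tail m' < e / 4" using ex_tail_less[of "e / 4"] e by auto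
  have "\<exists>l. N (g + pw a l) \<le> R \<or> N (g + pw (- a) l) \<le> R" for g
  proof -
    obtain i j c where ij: "i \<ge> 1" "j \<ge> 1" and c: "c \<in> {a, - a}" and eq: "pw a i + g = g + pw c j"
      using rel[of g] unfolding power_relation_def by blast
    have pos: "pw a (t * i) + g = g + pw c (t * j)" for t
    proof (induction t)
      case (Suc t)
      have "pw a (Suc t * i) + g = pw a i + (pw a (t * i) + g)" by (simp add: pw_add add.assoc)
      also have "\<dots> = (pw a i + g) + pw c (t * j)" unfolding Suc by (simp only: add.assoc)
      also have "\<dots> = g + pw c (Suc t * j)" unfolding eq by (simp add: pw_add add.assoc)
      finally show ?case .
    qed simp
    have neg: "pw (- a) (t * i) + g = g + pw (- c) (t * j)" for t
    proof -
      have "pw (- a) (t * i) + g = - pw a (t * i) + (g + pw c (t * j)) + - pw c (t * j)"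
        by (simp only: minus_pw[symmetric] add.assoc right_minus add_0_right)
      also have "\<dots> = g + - pw c (t * j)"
        unfolding pos[symmetric] by (simp only: add.assoc[symmetric] left_minus add_0_left)
      finally show ?thesis by (simp only: minus_pw)
    qed
    define t where "t = Suc (m' + N g)"
    have ti: "t \<le> t * i" using mult_le_mono2[OF ij(1), of t] by simp
    have ti1: "1 \<le> t * i" using ti by (simp add: t_def)
    have near: "D (pw b (t * i)) (pw b (t * i) + g) < e / 4" if "b \<in> {a, - a}" for b
    proof -
      have "t * i \<le> N (pw b (t * i))"
        using that loxodromic_growth[OF a] loxodromic_growth[OF loxodromic_minus[OF a]] by auto
      then have "2 * tail (N (pw b (t * i)) - N g) \<le> 2 * tail m'"
        using ti by (intro mult_left_mono tail_antimono) (auto simp: t_def)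
      with D_near[of "pw b (t * i)" g] m' show ?thesis by linarith
    qed
    define v where "v = g + pw (- c) (t * j)"
    have v1: "v = pw (- a) (t * i) + g" by (simp only: v_def neg)
    have "v + pw c (2 * (t * j)) = g + pw c (t * j)"
      unfolding v_def using pw_cancel_left[of "t * j" "2 * (t * j)" c]
      by (simp add: add.assoc mult.commute)
    also have "\<dots> = pw a (t * i) + g" by (simp only: pos)
    finally have v2: "v + pw c (2 * (t * j)) = pw a (t * i) + g" .
    have n1: "D (pw a (t * i)) (v + pw c (2 * (t * j))) < e / 4"
      unfolding v2 by (rule near) simp
    have n2: "D (pw (- a) (t * i)) v < e / 4"
      unfolding v1 by (rule near) simp
    have "e / 4 \<le> D v (v + pw c (2 * (t * j)))"
      using n1 n2 loxodromic_far[OF a ti1 ti1] e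
        D_triangle[of "pw a (t * i)" "pw (- a) (t * i)" "v + pw c (2 * (t * j))"]
        D_triangle[of "v + pw c (2 * (t * j))" "pw (- a) (t * i)" v]
        D_commute[of v "v + pw c (2 * (t * j))"] D_commute[of v "pw (- a) (t * i)"]
      by linarith
    from R[OF this c] obtain q where "N (v + pw c q) \<le> R" by blast
    moreover obtain l where "pw (- c) (t * j) + pw c q = pw c l \<or> pw (- c) (t * j) + pw c q = pw (- c) l"
      using pw_mixed by blast
    ultimately have "N (g + pw c l) \<le> R \<or> N (g + pw (- c) l) \<le> R"
      unfolding v_def by (auto simp only: add.assoc)
    then show ?thesis using c by auto
  qed
  then show ?thesis by blast
qed

text \<open>
  \<open>V\<close> is one end of the group: up to a constant, distances between \<open>V\<close>
  and its complement are measured through the identity, while two far points on the same side are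
  Floyd-close.
\<close>

definition two_ended_by :: "'a set \<Rightarrow> nat \<Rightarrow> bool" where
  "two_ended_by V c \<longleftrightarrow>
     (\<forall>v\<in>V. \<forall>w. w \<notin> V \<longrightarrow> N v + N w \<le> N (- v + w) + c) \<and>
     (\<forall>t>0. \<exists>R. \<forall>x z. (x \<in> V \<longleftrightarrow> z \<in> V) \<longrightarrow> t \<le> D x z \<longrightarrow> N x \<le> R \<or> N z \<le> R)"

lemma two_ended_of_near_axis:
  assumes a: "loxodromic a e m"
    and near: "\<And>g. \<exists>l. N (g + pw a l) \<le> R \<or> N (g + pw (- a) l) \<le> R"
  shows "\<exists>V c. two_ended_by V c"
proof -
  define V where "V = {h. \<exists>l. N (- h + pw a l) \<le> R}"
  have outside: "\<exists>l\<ge>1. N (- h + pw (- a) l) \<le> R" if "h \<notin> V" for h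
  proof -
    obtain l where l: "N (- h + pw a l) \<le> R \<or> N (- h + pw (- a) l) \<le> R" using near[of "- h"] by blast
    with that have l': "N (- h + pw (- a) l) \<le> R" unfolding V_def by blast
    have "l \<noteq> 0"
    proof
      assume "l = 0"
      then have "N (- h + pw a 0) \<le> R" using l' by simp
      then show False using that unfolding V_def by blast
    qed
    then show ?thesis using l' by (intro exI[of _ l]) auto
  qed
  have N_le: "N h \<le> N p + N (- h + p)" for h p
    using N_add[of p "- p + h"] N_dist_commute[of h p] by (simp add: add.assoc[symmetric])
  have cross: "N v + N w \<le> N (- v + w) + (4 * R + 2 * m)" if vw: "v \<in> V" "w \<notin> V" for v w
  proof -
    obtain l where l: "N (- v + pw a l) \<le> R" using vw(1) unfolding V_def by blast
    obtain k where k: "k \<ge> 1" "N (- w + pw (- a) k) \<le> R" using outside[OF vw(2)] by blast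
    have "N (pw a l) + N (pw (- a) k) \<le> N (- pw a l + pw (- a) k) + 2 * m"
    proof (cases "l = 0")
      case False
      then have "\<not> D (pw a l) (pw (- a) k) \<le> 2 * tail m"
        using loxodromic_far[OF a, of l k] k(1) loxodromic_tail[OF a] by auto
      then have "\<not> 2 * m + N (- pw a l + pw (- a) k) \<le> N (pw a l) + N (pw (- a) k)"
        using D_gromov by blast
      then show ?thesis by linarith
    qed simp
    moreover have "N (- pw a l + pw (- a) k) \<le> R + N (- v + w) + R"
      using N_dist_triangle[of "pw a l" "pw (- a) k" v] N_dist_triangle[of v "pw (- a) k" w]
        N_dist_commute[of v "pw a l"] l k(2) by linarith
    moreover have "N v \<le> N (pw a l) + R" "N w \<le> N (pw (- a) k) + R"
      using N_le[of v "pw a l"] N_le[of w "pw (- a) k"] l k(2) by linarith+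
    ultimately show ?thesis by linarith
  qed
  have same: "\<exists>R'. \<forall>x z. (\<exists>l. N (- x + pw b l) \<le> R) \<longrightarrow> (\<exists>k. N (- z + pw b k) \<le> R) \<longrightarrow>
      t \<le> D x z \<longrightarrow> N x \<le> R' \<or> N z \<le> R'"
    if "t > 0" and b: "b \<in> {a, - a}" for t b
  proof -
    have lox: "loxodromic b e m" using a b loxodromic_minus by auto
    obtain m' where m': "2 * tail m' < t / 3" using ex_tail_less[of "t / 3"] \<open>t > 0\<close> by auto
    define R' where "R' = R + m' + (m' + m) * N b"
    have far: "m' + m \<le> l" "D x (pw b l) \<le> 2 * tail m'" 
      if "N (- x + pw b l) \<le> R" "R' < N x" for x l
    proof -
      have "N x \<le> l * N b + R" using N_le[of x "pw b l"] N_pw_le[of b l] that(1) by linarith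
      then have "(m' + m) * N b < l * N b" using that(2) unfolding R'_def by linarith
      then show "m' + m \<le> l" by (simp add: mult_less_cancel2)
      have "D x (pw b l) \<le> 2 * tail (N x - N (- x + pw b l))"
        using D_near[of x "- x + pw b l"] by (simp add: add.assoc[symmetric])
      also have "\<dots> \<le> 2 * tail m'"
        using that unfolding R'_def by (intro mult_left_mono tail_antimono) linarith+
      finally show "D x (pw b l) \<le> 2 * tail m'" .
    qed
    have "D x z < t" if xz: "N (- x + pw b l) \<le> R" "N (- z + pw b k) \<le> R" "R' < N x" "R' < N z" for x z l k
    proof -
      have "D (pw b l) (pw b k) \<le> 2 * tail m'"
        using loxodromic_cauchy[OF lox far(1)[OF xz(1,3)] far(1)[OF xz(2,4)]] by simp
      then show ?thesis
        using far(2)[OF xz(1,3)] far(2)[OF xz(2,4)] m' D_triangle[of x z "pw b l"]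
          D_triangle[of "pw b l" z "pw b k"] D_commute[of z "pw b k"] by linarith
    qed
    then show ?thesis by (intro exI[of _ R']) (meson not_le)
  qed
  have "\<exists>R'. \<forall>x z. (x \<in> V \<longleftrightarrow> z \<in> V) \<longrightarrow> t \<le> D x z \<longrightarrow> N x \<le> R' \<or> N z \<le> R'" if t: "t > 0" for t
  proof -
    obtain R1 where R1: "\<And>x z l k. N (- x + pw a l) \<le> R \<Longrightarrow> N (- z + pw a k) \<le> R \<Longrightarrow>
      t \<le> D x z \<Longrightarrow> N x \<le> R1 \<or> N z \<le> R1" using same[OF t, of a] by blast
    obtain R2 where R2: "\<And>x z l k. N (- x + pw (- a) l) \<le> R \<Longrightarrow> N (- z + pw (- a) k) \<le> R \<Longrightarrow>
      t \<le> D x z \<Longrightarrow> N x \<le> R2 \<or> N z \<le> R2" using same[OF t, of "- a"] by blast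
    have "N x \<le> max R1 R2 \<or> N z \<le> max R1 R2" if xz: "x \<in> V \<longleftrightarrow> z \<in> V" "t \<le> D x z" for x z
    proof (cases "x \<in> V")
      case True
      then have "z \<in> V" using xz(1) by simp
      from True obtain l where "N (- x + pw a l) \<le> R" unfolding V_def by blast
      moreover from \<open>z \<in> V\<close> obtain k where "N (- z + pw a k) \<le> R" unfolding V_def by blast
      ultimately show ?thesis using R1[of x l z k] xz(2) by (auto simp: le_max_iff_disj)
    next
      case False
      then have "z \<notin> V" using xz(1) by simp
      from outside[OF False] obtain l where "N (- x + pw (- a) l) \<le> R" by blast
      moreover from outside[OF \<open>z \<notin> V\<close>] obtain k where "N (- z + pw (- a) k) \<le> R" by blast
      ultimately show ?thesis using R2[of x l z k] xz(2) by (auto simp: le_max_iff_disj)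
    qed
    then show ?thesis by blast
  qed
  then have "two_ended_by V (4 * R + 2 * m)" unfolding two_ended_by_def using cross by simp
  then show ?thesis by blast
qed

theorem floyd_trichotomy:
  obtains
    (small) "\<And>t. t > 0 \<Longrightarrow> \<exists>R. \<forall>x z. t \<le> D x z \<longrightarrow> N x \<le> R \<or> N z \<le> R"
  | (paradoxical) A B :: 'a and P Q Y :: "'a set" where "P \<inter> Q = {}" "P \<inter> Y = {}" "Q \<inter> Y = {}"
      "\<And>w. w \<notin> P \<Longrightarrow> A + w \<in> Q" "\<And>w. w \<notin> Y \<Longrightarrow> B + w \<in> Y"
  | (two_ended) V c where "two_ended_by V c"
proof (cases "\<forall>t>0. \<exists>R. \<forall>x z. t \<le> D x z \<longrightarrow> N x \<le> R \<or> N z \<le> R")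
  case True
  show ?thesis by (rule small) (use True in simp)
next
  case False
  then obtain t where t: "t > 0" "\<not> (\<exists>R. \<forall>x z. t \<le> D x z \<longrightarrow> N x \<le> R \<or> N z \<le> R)"
    by blast
  have "\<exists>x z. t \<le> D x z \<and> R < N x \<and> R < N z" for R
    using t(2) by (simp add: not_le)
  from ex_loxodromic[OF t(1) this] obtain a e m where a: "loxodromic a e m" by blast
  show ?thesis
  proof (cases "\<forall>g. power_relation a g")
    case True
    then have rel: "power_relation a g" for g by blast
    obtain R where "\<forall>g. \<exists>l. N (g + pw a l) \<le> R \<or> N (g + pw (- a) l) \<le> R"
      using near_axis_of_relations[OF a rel] by blast
    then have near: "\<exists>l. N (g + pw a l) \<le> R \<or> N (g + pw (- a) l) \<le> R" for g by simp
    from two_ended_of_near_axis[OF a near] obtain V c where "two_ended_by V c" by blast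
    then show ?thesis by (rule two_ended)
  next
    case False
    then obtain g where "\<not> power_relation a g" by blast
    from paradox_of_no_relation[OF a this] obtain A B :: 'a and P Q Y :: "'a set" where
      "P \<inter> Q = {}" "P \<inter> Y = {}" "Q \<inter> Y = {}"
      "\<forall>w. w \<notin> P \<longrightarrow> A + w \<in> Q" "\<forall>w. w \<notin> Y \<longrightarrow> B + w \<in> Y" by blast
    then show ?thesis by - (rule paradoxical[of P Q Y A B]; blast)
  qed
qed

end

section \<open>Random walks\<close>

text \<open>
  The probability of a walk from \<open>x\<close> to be at \<open>z\<close> at time
  \<open>n\<close> without having been in \<open>B\<close> before time \<open>n\<close>. The end
  point itself may lie in \<open>B\<close>.
\<close>

primrec taboo :: "'a::group_add pmf \<Rightarrow> 'a set \<Rightarrow> nat \<Rightarrow> 'a \<Rightarrow> 'a \<Rightarrow> ennreal" where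
  "taboo \<mu> B 0 x z = of_bool (x = z)"
| "taboo \<mu> B (Suc n) x z = (if x \<in> B then 0 else \<integral>\<^sup>+ s. taboo \<mu> B n (x + s) z \<partial>\<mu>)"

abbreviation prb :: "'a::group_add pmf \<Rightarrow> nat \<Rightarrow> 'a \<Rightarrow> 'a \<Rightarrow> ennreal" where
  "prb \<mu> \<equiv> taboo \<mu> {}"

definition hit :: "'a::group_add pmf \<Rightarrow> 'a set \<Rightarrow> 'a \<Rightarrow> 'a \<Rightarrow> ennreal" where
  "hit \<mu> B x z = (\<Sum>n. taboo \<mu> B n x z)"

abbreviation gr :: "'a::group_add pmf \<Rightarrow> 'a \<Rightarrow> 'a \<Rightarrow> ennreal" where
  "gr \<mu> \<equiv> hit \<mu> {}"

definition tsum :: "'a::group_add pmf \<Rightarrow> 'a set \<Rightarrow> nat \<Rightarrow> 'a \<Rightarrow> 'a \<Rightarrow> ennreal" where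
  "tsum \<mu> B n x z = (\<Sum>k<n. taboo \<mu> B k x z)"

lemma taboo_le_prb: "taboo \<mu> B n x z \<le> prb \<mu> n x z"
  by (induction n arbitrary: x) (auto intro: nn_integral_mono)

lemma prb_translate: "prb \<mu> n (g + x) (g + z) = prb \<mu> n x z"
  by (induction n arbitrary: x) (simp_all add: add.assoc)

lemma convolution_power_Suc: "convolution_power \<mu> (Suc n) = convolve \<mu> (convolution_power \<mu> n)"
  unfolding convolution_power_def by simp

lemma convolve_eq_bind: "convolve \<mu> \<nu> = bind_pmf \<mu> (\<lambda>s. map_pmf ((+) s) \<nu>)"
  unfolding convolve_def pair_pmf_def by (simp add: map_bind_pmf map_pmf_def bind_assoc_pmf bind_return_pmf)

lemma prb_eq_pmf: "prb \<mu> n x z = ennreal (pmf (convolution_power \<mu> n) (- x + z))"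
proof (induction n arbitrary: x)
  case 0
  have "(- x + z = 0) = (x = z)" by (metis add.inverse_inverse add_eq_0_iff)
  then show ?case by (auto simp: convolution_power_def pmf_return indicator_def)
next
  case (Suc n)
  have "pmf (map_pmf ((+) s) (convolution_power \<mu> n)) (- x + z) = pmf (convolution_power \<mu> n) (- (x + s) + z)" for s
    using pmf_map_inj'[of "(+) s" "convolution_power \<mu> n" "- s + (- x + z)"]
    by (simp only: add.assoc[symmetric] right_minus add_0_left minus_add) (simp add: inj_on_def)
  then show ?case
    using Suc by (simp add: convolution_power_Suc convolve_eq_bind ennreal_pmf_bind)
qed

lemma prb_le_1: "prb \<mu> n x z \<le> 1"
  unfolding prb_eq_pmf using pmf_le_1 by (simp add: ennreal_le_1)

lemma prb_mult_le: "prb \<mu> n x y * prb \<mu> m y z \<le> prb \<mu> (n + m) x z"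
proof (induction n arbitrary: x)
  case (Suc n)
  have "prb \<mu> (Suc n) x y * prb \<mu> m y z = (\<integral>\<^sup>+ s. prb \<mu> n (x + s) y * prb \<mu> m y z \<partial>\<mu>)"
    by (simp add: nn_integral_multc)
  also have "\<dots> \<le> (\<integral>\<^sup>+ s. prb \<mu> (n + m) (x + s) z \<partial>\<mu>)"
    by (intro nn_integral_mono Suc)
  finally show ?case by simp
qed simp

lemma nn_integral_pmf_swap:
  fixes \<mu> :: "'a pmf" and \<nu> :: "'b pmf"
  shows
  "(\<integral>\<^sup>+ s. \<integral>\<^sup>+ t. f s t \<partial>\<nu> \<partial>\<mu>) = (\<integral>\<^sup>+ t. \<integral>\<^sup>+ s. f s t \<partial>\<mu> \<partial>\<nu>)"
proof -
  have "(\<integral>\<^sup>+ s. \<integral>\<^sup>+ t. f s t \<partial>\<nu> \<partial>\<mu>) = (\<integral>\<^sup>+ p. f (fst p) (snd p) \<partial>pair_pmf \<mu> \<nu>)"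
    by (simp add: nn_integral_pair_pmf')
  also have "pair_pmf \<mu> \<nu> = map_pmf (\<lambda>(t, s). (s, t)) (pair_pmf \<nu> \<mu>)" by (rule pair_commute_pmf)
  also have "(\<integral>\<^sup>+ p. f (fst p) (snd p) \<partial>map_pmf (\<lambda>(t, s). (s, t)) (pair_pmf \<nu> \<mu>)) =
      (\<integral>\<^sup>+ t. \<integral>\<^sup>+ s. f s t \<partial>\<mu> \<partial>\<nu>)"
    by (simp add: nn_integral_pair_pmf')
  finally show ?thesis .
qed

lemma prb_Suc_right: "prb \<mu> (Suc n) x z = (\<integral>\<^sup>+ s. prb \<mu> n x (z - s) \<partial>\<mu>)"
proof (induction n arbitrary: x)
  case 0
  have "(x + s = z) = (x = z - s)" for s by (auto simp: add_diff_eq[symmetric])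
  then show ?case by simp
next
  case (Suc n)
  have "prb \<mu> (Suc (Suc n)) x z = (\<integral>\<^sup>+ s. \<integral>\<^sup>+ t. prb \<mu> n (x + s) (z - t) \<partial>\<mu> \<partial>\<mu>)"
    using Suc by simp
  also have "\<dots> = (\<integral>\<^sup>+ t. \<integral>\<^sup>+ s. prb \<mu> n (x + s) (z - t) \<partial>\<mu> \<partial>\<mu>)"
    by (rule nn_integral_pmf_swap)
  finally show ?case by simp
qed

lemma prb_reversed: "prb (map_pmf uminus \<mu>) n x z = prb \<mu> n z x"
proof (induction n arbitrary: x)
  case (Suc n)
  then show ?case by (subst prb_Suc_right) simp
qed (auto simp: eq_commute)

lemma gr_reversed: "gr (map_pmf uminus \<mu>) x z = gr \<mu> z x"
  unfolding hit_def prb_reversed ..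

lemma gr_translate: "gr \<mu> (g + x) (g + z) = gr \<mu> x z"
  unfolding hit_def prb_translate ..

lemma tsum_Suc:
  "tsum \<mu> B (Suc n) x z =
     of_bool (x = z) + (if x \<in> B then 0 else \<integral>\<^sup>+ s. tsum \<mu> B n (x + s) z \<partial>\<mu>)"
  unfolding tsum_def by (subst sum.lessThan_Suc_shift) (simp add: nn_integral_sum)

lemma tsum_0 [simp]: "tsum \<mu> B 0 x z = 0"
  unfolding tsum_def by simp

lemma tsum_mono: "n \<le> m \<Longrightarrow> tsum \<mu> B n x z \<le> tsum \<mu> B m x z"
  unfolding tsum_def by (intro sum_mono2) auto

lemma tsum_le_hit: "tsum \<mu> B n x z \<le> hit \<mu> B x z"
  unfolding tsum_def hit_def by (intro sum_le_suminf) auto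

lemma hit_le: "(\<And>n. tsum \<mu> B n x z \<le> c) \<Longrightarrow> hit \<mu> B x z \<le> c"
  unfolding tsum_def hit_def by (rule suminf_le_const) auto

lemma hit_rec:
  "hit \<mu> B x z = of_bool (x = z) + (if x \<in> B then 0 else \<integral>\<^sup>+ s. hit \<mu> B (x + s) z \<partial>\<mu>)"
proof -
  have "hit \<mu> B x z = (\<Sum>n. taboo \<mu> B (n + 1) x z) + (\<Sum>n<1. taboo \<mu> B n x z)"
    unfolding hit_def by (rule suminf_offset) simp
  also have "\<dots> = (\<Sum>n. taboo \<mu> B (Suc n) x z) + of_bool (x = z)" by simp
  also have "(\<Sum>n. taboo \<mu> B (Suc n) x z) = (if x \<in> B then 0 else \<integral>\<^sup>+ s. hit \<mu> B (x + s) z \<partial>\<mu>)"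
    unfolding hit_def by (simp add: nn_integral_suminf)
  finally show ?thesis by (simp add: add.commute)
qed

lemma prb_mult_gr_le: "prb \<mu> n x y * gr \<mu> y z \<le> gr \<mu> x z"
proof -
  have "prb \<mu> n x y * gr \<mu> y z = (\<Sum>m. prb \<mu> n x y * prb \<mu> m y z)"
    unfolding hit_def by simp
  also have "\<dots> \<le> (\<Sum>m. prb \<mu> (m + n) x z)"
    by (intro suminf_le) (auto simp: add.commute[of _ n] prb_mult_le)
  also have "\<dots> \<le> gr \<mu> x z"
    unfolding hit_def by (subst suminf_offset[of "\<lambda>m. prb \<mu> m x z" n]) auto
  finally show ?thesis .
qed

lemma gr_mult_prb_le: "gr \<mu> x y * prb \<mu> n y z \<le> gr \<mu> x z"
proof -
  have "gr \<mu> x y * prb \<mu> n y z = (\<Sum>m. prb \<mu> m x y * prb \<mu> n y z)"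
    unfolding hit_def by simp
  also have "\<dots> \<le> (\<Sum>m. prb \<mu> (m + n) x z)"
    by (intro suminf_le) (auto simp: prb_mult_le)
  also have "\<dots> \<le> gr \<mu> x z"
    unfolding hit_def by (subst suminf_offset[of "\<lambda>m. prb \<mu> m x z" n]) auto
  finally show ?thesis .
qed

lemma hit_refl: "1 \<le> hit \<mu> B x x"
  by (subst hit_rec) simp

text \<open>
  Decomposition of the walk at its first visit to \<open>B\<close>, for the truncated sums. In
  this form it also serves to bound the Green function of a transient walk.
\<close>

lemma tsum_le_hit_decomposition:
  assumes "finite B"
  shows "tsum \<mu> {} n x z \<le> (if z \<in> B then 0 else hit \<mu> B x z) + (\<Sum>w\<in>B. hit \<mu> B x w * tsum \<mu> {} n w z)"
proof (induction n arbitrary: x)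
  case (Suc n)
  show ?case
  proof (cases "x \<in> B")
    case True
    have "tsum \<mu> {} (Suc n) x z \<le> hit \<mu> B x x * tsum \<mu> {} (Suc n) x z"
      using mult_right_mono[OF hit_refl[of \<mu> B x], of "tsum \<mu> {} (Suc n) x z"] by simp
    also have "\<dots> \<le> (\<Sum>w\<in>B. hit \<mu> B x w * tsum \<mu> {} (Suc n) w z)"
      using True assms by (intro member_le_sum) auto
    finally show ?thesis by (simp add: add_increasing)
  next
    case False
    have "(\<integral>\<^sup>+ s. tsum \<mu> {} n (x + s) z \<partial>\<mu>) \<le>
      (\<integral>\<^sup>+ s. (if z \<in> B then 0 else hit \<mu> B (x + s) z) + (\<Sum>w\<in>B. hit \<mu> B (x + s) w * tsum \<mu> {} n w z) \<partial>\<mu>)"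
      by (intro nn_integral_mono Suc)
    also have "\<dots> = (if z \<in> B then 0 else \<integral>\<^sup>+ s. hit \<mu> B (x + s) z \<partial>\<mu>) +
        (\<Sum>w\<in>B. (\<integral>\<^sup>+ s. hit \<mu> B (x + s) w \<partial>\<mu>) * tsum \<mu> {} n w z)"
      by (simp add: nn_integral_add nn_integral_sum nn_integral_multc)
    also have "(\<Sum>w\<in>B. (\<integral>\<^sup>+ s. hit \<mu> B (x + s) w \<partial>\<mu>) * tsum \<mu> {} n w z) \<le>
       (\<Sum>w\<in>B. hit \<mu> B x w * tsum \<mu> {} (Suc n) w z)"
    proof (intro sum_mono mult_mono)
      fix w
      show "(\<integral>\<^sup>+ s. hit \<mu> B (x + s) w \<partial>\<mu>) \<le> hit \<mu> B x w"
        by (subst (2) hit_rec) (use False in simp)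
    qed (auto intro: tsum_mono)
    finally have "(\<integral>\<^sup>+ s. tsum \<mu> {} n (x + s) z \<partial>\<mu>) \<le>
      (if z \<in> B then 0 else \<integral>\<^sup>+ s. hit \<mu> B (x + s) z \<partial>\<mu>) + (\<Sum>w\<in>B. hit \<mu> B x w * tsum \<mu> {} (Suc n) w z)"
      by (simp add: add_left_mono)
    then have "of_bool (x = z) + (\<integral>\<^sup>+ s. tsum \<mu> {} n (x + s) z \<partial>\<mu>) \<le>
      of_bool (x = z) + (if z \<in> B then 0 else \<integral>\<^sup>+ s. hit \<mu> B (x + s) z \<partial>\<mu>) + (\<Sum>w\<in>B. hit \<mu> B x w * tsum \<mu> {} (Suc n) w z)"
      by (simp add: add_left_mono add.assoc)
    moreover have "of_bool (x = z) + (if z \<in> B then 0 else \<integral>\<^sup>+ s. hit \<mu> B (x + s) z \<partial>\<mu>) =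
        (if z \<in> B then 0 else hit \<mu> B x z)"
      using False by (auto simp: hit_rec[of \<mu> B x z])
    ultimately show ?thesis by (simp only: tsum_Suc[of \<mu> "{}"]) simp
  qed
qed simp

lemma gr_le_hit_decomposition:
  assumes "finite B"
  shows "gr \<mu> x z \<le> (if z \<in> B then 0 else hit \<mu> B x z) + (\<Sum>w\<in>B. hit \<mu> B x w * gr \<mu> w z)"
proof (rule hit_le)
  fix n
  have "(\<Sum>w\<in>B. hit \<mu> B x w * tsum \<mu> {} n w z) \<le> (\<Sum>w\<in>B. hit \<mu> B x w * gr \<mu> w z)"
    by (intro sum_mono mult_left_mono tsum_le_hit) auto
  with tsum_le_hit_decomposition[OF assms, of \<mu> n x z]
  show "tsum \<mu> {} n x z \<le> (if z \<in> B then 0 else hit \<mu> B x z) + (\<Sum>w\<in>B. hit \<mu> B x w * gr \<mu> w z)"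
    by (rule order_trans[OF _ add_left_mono])
qed

text \<open>
  The converse bound: a first visit to \<open>B\<close> at \<open>w\<close> followed by a walk
  from \<open>w\<close> to \<open>z\<close> is a walk from \<open>x\<close> to \<open>z\<close>.
\<close>

lemma hit_decomposition_le_gr:
  assumes "finite B"
  shows "(\<Sum>w\<in>B. hit \<mu> B x w * gr \<mu> w z) \<le> gr \<mu> x z"
proof -
  have part: "(\<Sum>w\<in>B. tsum \<mu> B n x w * gr \<mu> w z) \<le> gr \<mu> x z" for n
  proof (induction n arbitrary: x)
    case (Suc n)
    show ?case
    proof (cases "x \<in> B")
      case True
      have "(\<Sum>w\<in>B. tsum \<mu> B (Suc n) x w * gr \<mu> w z) = (\<Sum>w\<in>B. if x = w then gr \<mu> w z else 0)"
        using True by (intro sum.cong) (auto simp: tsum_Suc)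
      also have "\<dots> = gr \<mu> x z" using True assms by simp
      finally show ?thesis by simp
    next
      case False
      have "(\<Sum>w\<in>B. tsum \<mu> B (Suc n) x w * gr \<mu> w z) =
          (\<Sum>w\<in>B. (\<integral>\<^sup>+ s. tsum \<mu> B n (x + s) w \<partial>\<mu>) * gr \<mu> w z)"
        using False by (intro sum.cong) (auto simp: tsum_Suc)
      also have "\<dots> = (\<integral>\<^sup>+ s. (\<Sum>w\<in>B. tsum \<mu> B n (x + s) w * gr \<mu> w z) \<partial>\<mu>)"
        by (simp add: nn_integral_sum nn_integral_multc)
      also have "\<dots> \<le> (\<integral>\<^sup>+ s. gr \<mu> (x + s) z \<partial>\<mu>)"
        by (intro nn_integral_mono Suc)
      also have "\<dots> \<le> gr \<mu> x z" by (subst (2) hit_rec) simp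
      finally show ?thesis .
    qed
  qed simp
  have "(\<Sum>w\<in>B. hit \<mu> B x w * gr \<mu> w z) = (\<Sum>w\<in>B. \<Sum>n. taboo \<mu> B n x w * gr \<mu> w z)"
    unfolding hit_def[of \<mu> B] by simp
  also have "\<dots> = (\<Sum>n. \<Sum>w\<in>B. taboo \<mu> B n x w * gr \<mu> w z)"
    by (rule suminf_sum[symmetric]) simp
  also have "\<dots> \<le> gr \<mu> x z"
  proof (rule suminf_le_const)
    fix n
    have "(\<Sum>k<n. \<Sum>w\<in>B. taboo \<mu> B k x w * gr \<mu> w z) = (\<Sum>w\<in>B. tsum \<mu> B n x w * gr \<mu> w z)"
      unfolding tsum_def by (subst sum.swap) (simp add: sum_distrib_right)
    then show "(\<Sum>k<n. \<Sum>w\<in>B. taboo \<mu> B k x w * gr \<mu> w z) \<le> gr \<mu> x z" using part by simp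
  qed simp
  finally show ?thesis .
qed

section \<open>Transience\<close>

lemma walk_position_Suc: "walk_position \<omega> (Suc n) = walk_position \<omega> n + \<omega> n"
  unfolding walk_position_def by simp

lemma walk_position_0 [simp]: "walk_position \<omega> 0 = 0"
  unfolding walk_position_def by simp

lemma walk_position_case_nat: "walk_position (case_nat s \<omega>) (Suc n) = s + walk_position \<omega> n"
  by (induction n) (simp_all add: walk_position_Suc add.assoc)

abbreviation path_space :: "'a pmf \<Rightarrow> (nat \<Rightarrow> 'a) measure" where
  "path_space \<mu> \<equiv> PiM UNIV (\<lambda>_::nat. measure_pmf \<mu>)"

text \<open>
  The product sigma-algebra has discrete factors; countability of the group makes sums of
  coordinates measurable.
\<close>

lemma measurable_walk_position:
  assumes "countable (UNIV :: 'a::monoid_add set)"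
  shows "(\<lambda>\<omega>. walk_position \<omega> n) \<in> path_space \<mu> \<rightarrow>\<^sub>M count_space (UNIV :: 'a set)"
proof (induction n)
  case (Suc n)
  have "(\<lambda>\<omega>. g + \<omega> n) \<in> path_space \<mu> \<rightarrow>\<^sub>M count_space UNIV" for g
    by (rule measurable_compose[OF measurable_component_singleton[of n UNIV "\<lambda>_. measure_pmf \<mu>"]]) auto
  then show ?case unfolding walk_position_Suc
    by (rule measurable_compose_countable'[OF _ Suc assms])
qed simp

lemma measurable_walk_event:
  assumes "countable (UNIV :: 'a::monoid_add set)"
  shows "{\<omega>. P (walk_position \<omega> n :: 'a)} \<in> sets (path_space \<mu>)"
proof -
  have "(\<lambda>\<omega>. walk_position \<omega> n) -` {g. P g} \<inter> space (path_space \<mu>) \<in> sets (path_space \<mu>)"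
    by (rule measurable_sets[OF measurable_walk_position[OF assms]]) simp
  then show ?thesis by (simp add: vimage_def space_PiM)
qed

lemma emeasure_path_space_shift:
  assumes "A \<in> sets (path_space \<mu>)"
  shows "emeasure (path_space \<mu>) A = (\<integral>\<^sup>+ s. emeasure (path_space \<mu>) {\<omega>. case_nat s \<omega> \<in> A} \<partial>\<mu>)"
proof -
  interpret sequence_space "measure_pmf \<mu>" by unfold_locales
  let ?f = "\<lambda>(s, \<omega>). case_nat s \<omega>"
  have f: "?f \<in> measure_pmf \<mu> \<Otimes>\<^sub>M path_space \<mu> \<rightarrow>\<^sub>M path_space \<mu>" by measurable
  have "emeasure (path_space \<mu>) A = emeasure (distr (measure_pmf \<mu> \<Otimes>\<^sub>M path_space \<mu>) (path_space \<mu>) ?f) A"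
    unfolding PiM_iter ..
  also have "\<dots> = emeasure (measure_pmf \<mu> \<Otimes>\<^sub>M path_space \<mu>) (?f -` A \<inter> space (measure_pmf \<mu> \<Otimes>\<^sub>M path_space \<mu>))"
    by (rule emeasure_distr[OF f assms])
  also have "\<dots> = (\<integral>\<^sup>+ s. emeasure (path_space \<mu>) (Pair s -` (?f -` A \<inter> space (measure_pmf \<mu> \<Otimes>\<^sub>M path_space \<mu>))) \<partial>\<mu>)"
    by (rule P.emeasure_pair_measure_alt) (rule measurable_sets[OF f assms])
  also have "\<dots> = (\<integral>\<^sup>+ s. emeasure (path_space \<mu>) {\<omega>. case_nat s \<omega> \<in> A} \<partial>\<mu>)"
    by (intro nn_integral_cong arg_cong[where f = "emeasure (path_space \<mu>)"]) (auto simp: space_pair_measure space_PiM)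
  finally show ?thesis .
qed

lemma emeasure_first_hit:
  assumes "countable (UNIV :: 'a::group_add set)"
  shows "emeasure (path_space \<mu>) {\<omega>. x + walk_position \<omega> n = (z::'a) \<and> (\<forall>i<n. x + walk_position \<omega> i \<notin> B)} = taboo \<mu> B n x z"
proof (induction n arbitrary: x)
  case 0
  interpret sequence_space "measure_pmf \<mu>" by unfold_locales
  have "emeasure (path_space \<mu>) (UNIV :: (nat \<Rightarrow> 'a) set) = 1"
    using P.emeasure_space_1 by (simp add: space_PiM)
  then show ?case by (cases "x = z") simp_all
next
  case (Suc n)
  let ?A = "{\<omega>. x + walk_position \<omega> (Suc n) = z \<and> (\<forall>i<Suc n. x + walk_position \<omega> i \<notin> B)}"
  have "?A = {\<omega>. x + walk_position \<omega> (Suc n) = z} \<inter> (\<Inter>i\<in>{..<Suc n}. {\<omega>. x + walk_position \<omega> i \<notin> B})" by auto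
  also have "\<dots> \<in> sets (path_space \<mu>)"
    by (intro sets.Int sets.finite_INT measurable_walk_event assms) auto
  finally have A: "?A \<in> sets (path_space \<mu>)" .
  have shift: "{\<omega>. case_nat s \<omega> \<in> ?A} =
     (if x \<in> B then {} else {\<omega>. (x + s) + walk_position \<omega> n = z \<and> (\<forall>i<n. (x + s) + walk_position \<omega> i \<notin> B)})" for s
    by (auto simp: walk_position_case_nat add.assoc less_Suc_eq_0_disj)
  show ?case
    unfolding emeasure_path_space_shift[OF A] shift using Suc by simp
qed

lemma first_return_eq_return_probability:
  fixes \<mu> :: "'a::group_add pmf"
  assumes countable: "countable (UNIV :: 'a set)"
  shows "(\<integral>\<^sup>+ s. hit \<mu> {0} s 0 \<partial>\<mu>) = ennreal (return_probability \<mu>)"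
proof -
  interpret sequence_space "measure_pmf \<mu>" by unfold_locales
  define E where "E n = {\<omega>. walk_position \<omega> (Suc n) = (0::'a) \<and> (\<forall>i<n. walk_position \<omega> (Suc i) \<noteq> 0)}" for n
  have E: "E n \<in> sets (path_space \<mu>)" for n
  proof -
    have "E n = {\<omega>. walk_position \<omega> (Suc n) = 0} \<inter> (\<Inter>i\<in>{..<n}. {\<omega>. walk_position \<omega> (Suc i) \<noteq> 0})"
      unfolding E_def by auto
    also have "\<dots> \<in> sets (path_space \<mu>)"
    proof (cases "n = 0")
      case True
      then show ?thesis using measurable_walk_event[OF countable, of "\<lambda>g. g = 0" "Suc 0" \<mu>] by auto
    next
      case False
      then show ?thesis by (intro sets.Int sets.finite_INT measurable_walk_event countable) auto
    qed
    finally show ?thesis .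
  qed
  have emE: "emeasure (path_space \<mu>) (E n) = (\<integral>\<^sup>+ s. taboo \<mu> {0} n s 0 \<partial>\<mu>)" for n
  proof -
    have "{\<omega>. case_nat s \<omega> \<in> E n} = {\<omega>. s + walk_position \<omega> n = 0 \<and> (\<forall>i<n. s + walk_position \<omega> i \<notin> {0})}" for s
      unfolding E_def by (auto simp: walk_position_case_nat)
    then show ?thesis
      unfolding emeasure_path_space_shift[OF E] using emeasure_first_hit[OF countable, of \<mu> _ n 0 "{0}"] by simp
  qed
  have "disjoint_family E"
    unfolding disjoint_family_on_def
  proof (intro ballI impI)
    fix m n :: nat assume "m \<noteq> n"
    then show "E m \<inter> E n = {}" unfolding E_def by (cases m n rule: linorder_cases) auto
  qed
  then have "(\<Sum>n. emeasure (path_space \<mu>) (E n)) = emeasure (path_space \<mu>) (\<Union>n. E n)"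
    using E by (intro suminf_emeasure) auto
  also have "(\<Union>n. E n) = {\<omega>. \<exists>n\<ge>1. walk_position \<omega> n = 0}"
  proof (intro equalityI subsetI)
    fix \<omega> assume "\<omega> \<in> {\<omega>. \<exists>n\<ge>1. walk_position \<omega> n = (0::'a)}"
    then obtain n where "walk_position \<omega> (Suc n) = 0" using Suc_le_D by auto
    then have "\<exists>n. walk_position \<omega> (Suc n) = 0 \<and> (\<forall>i<n. walk_position \<omega> (Suc i) \<noteq> 0)"
      using exists_least_iff[of "\<lambda>n. walk_position \<omega> (Suc n) = 0"] by blast
    then show "\<omega> \<in> (\<Union>n. E n)" unfolding E_def by auto
  qed (auto simp: E_def)
  also have "emeasure (path_space \<mu>) \<dots> = ennreal (return_probability \<mu>)"
    unfolding return_probability_def by (rule P.emeasure_eq_measure)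
  finally show ?thesis unfolding emE hit_def by (simp add: nn_integral_suminf)
qed

text \<open>
  With \<open>r < 1\<close> the return probability, the truncated Green functions satisfy
  \<open>G\<^sub>n\<^sub>+\<^sub>1 \<le> 1 + r G\<^sub>n\<close> and stay below the fixed point
  \<open>1 / (1 - r)\<close>.
\<close>

lemma transient_imp_gr_finite:
  assumes countable: "countable (UNIV :: 'a::group_add set)" and "transient (\<mu> :: 'a pmf)"
  shows "gr \<mu> 0 0 < \<top>"
proof -
  define r where "r = return_probability \<mu>"
  have r: "r < 1" "0 \<le> r" using assms(2) unfolding transient_def r_def return_probability_def by auto
  have "tsum \<mu> {} n 0 0 \<le> ennreal (1 / (1 - r))" for n
  proof (induction n)
    case (Suc n)
    have "tsum \<mu> {} (Suc n) 0 0 = 1 + (\<integral>\<^sup>+ s. tsum \<mu> {} n s 0 \<partial>\<mu>)" by (simp add: tsum_Suc)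
    also have "(\<integral>\<^sup>+ s. tsum \<mu> {} n s 0 \<partial>\<mu>) \<le> (\<integral>\<^sup>+ s. hit \<mu> {0} s 0 * tsum \<mu> {} n 0 0 \<partial>\<mu>)"
      using tsum_le_hit_decomposition[of "{0}" \<mu> n _ 0] by (intro nn_integral_mono) simp
    also have "\<dots> = ennreal r * tsum \<mu> {} n 0 0"
      using first_return_eq_return_probability[OF countable, of \<mu>] by (simp add: nn_integral_multc r_def)
    also have "\<dots> \<le> ennreal r * ennreal (1 / (1 - r))" by (intro mult_left_mono Suc) simp
    also have "ennreal r * ennreal (1 / (1 - r)) = ennreal (r * (1 / (1 - r)))"
      by (rule ennreal_mult'[symmetric]) (rule r(2))
    also have "1 + \<dots> = ennreal (1 + r * (1 / (1 - r)))"
      by (subst ennreal_plus) (use r in auto)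
    also have "1 + r * (1 / (1 - r)) = 1 / (1 - r)" using r by (simp add: field_simps)
    finally show ?case by (simp add: add_left_mono)
  qed simp
  then have "gr \<mu> 0 0 \<le> ennreal (1 / (1 - r))" by (rule hit_le)
  also have "\<dots> < \<top>" by simp
  finally show ?thesis .
qed

section \<open>The lazy walk\<close>

definition lazy :: "'a::group_add pmf \<Rightarrow> 'a pmf" where
  "lazy \<mu> = bind_pmf (bernoulli_pmf (1/2)) (\<lambda>b. if b then return_pmf 0 else \<mu>)"

lemma nn_integral_lazy: "(\<integral>\<^sup>+ s. h s \<partial>lazy \<mu>) = inverse 2 * h 0 + inverse 2 * (\<integral>\<^sup>+ s. h s \<partial>\<mu>)"
  unfolding lazy_def by (simp add: mult.commute)

text \<open>
  The Green function is the least solution of its defining equation.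
\<close>

lemma gr_le_supersolution:
  fixes \<mu> :: "'a::group_add pmf"
  assumes "\<And>x. of_bool (x = z) + (\<integral>\<^sup>+ s. u (x + s) \<partial>\<mu>) \<le> u x"
  shows "gr \<mu> x z \<le> u x"
proof (rule hit_le)
  fix n
  show "tsum \<mu> {} n x z \<le> u x"
  proof (induction n arbitrary: x)
    case (Suc n)
    have "tsum \<mu> {} (Suc n) x z \<le> of_bool (x = z) + (\<integral>\<^sup>+ s. u (x + s) \<partial>\<mu>)"
      unfolding tsum_Suc by (auto intro!: add_left_mono nn_integral_mono Suc)
    also have "\<dots> \<le> u x" by (rule assms)
    finally show ?case .
  qed simp
qed

lemma half_add_half: "inverse 2 * a + inverse 2 * a = (a :: ennreal)"
proof -
  have "ennreal (1/2) + ennreal (1/2) = ennreal (1/2 + 1/2)" by (rule ennreal_plus[symmetric]) auto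
  then have "inverse 2 + inverse 2 = (1 :: ennreal)" by simp
  then show ?thesis by (metis distrib_right mult_1)
qed

lemma gr_lazy:
  assumes fin: "\<And>x. gr \<mu> x z < \<top>"
  shows "gr (lazy \<mu>) x z = 2 * gr \<mu> x z"
proof (rule antisym)
  have half2: "inverse 2 * (2 * a) = a" for a :: ennreal
    using half_add_half[of a] by (simp add: mult_2 distrib_left)
  show le: "gr (lazy \<mu>) x z \<le> 2 * gr \<mu> x z" for x
  proof (rule gr_le_supersolution[where u = "\<lambda>x. 2 * gr \<mu> x z"])
    fix x
    have "(\<integral>\<^sup>+ s. 2 * gr \<mu> (x + s) z \<partial>lazy \<mu>) =
        inverse 2 * (2 * gr \<mu> x z) + inverse 2 * (2 * (\<integral>\<^sup>+ s. gr \<mu> (x + s) z \<partial>\<mu>))"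
      unfolding nn_integral_lazy by (simp add: nn_integral_cmult)
    then have "of_bool (x = z) + (\<integral>\<^sup>+ s. 2 * gr \<mu> (x + s) z \<partial>lazy \<mu>) =
      gr \<mu> x z + (of_bool (x = z) + (\<integral>\<^sup>+ s. gr \<mu> (x + s) z \<partial>\<mu>))"
      unfolding half2 by (simp only: ac_simps)
    also have "\<dots> = 2 * gr \<mu> x z" using hit_rec[of \<mu> "{}" x z] by (simp add: mult_2)
    finally show "of_bool (x = z) + (\<integral>\<^sup>+ s. 2 * gr \<mu> (x + s) z \<partial>lazy \<mu>) \<le> 2 * gr \<mu> x z" by simp
  qed
  have finl: "gr (lazy \<mu>) x z < \<top>" for x
    using le[of x] fin[of x] by (simp add: ennreal_mult_less_top order_le_less_trans)
  have "gr \<mu> x z \<le> inverse 2 * gr (lazy \<mu>) x z"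
  proof (rule gr_le_supersolution[where u = "\<lambda>x. inverse 2 * gr (lazy \<mu>) x z"])
    fix x
    let ?g = "gr (lazy \<mu>)"
    have "inverse 2 * ?g x z + inverse 2 * ?g x z = ?g x z" by (rule half_add_half)
    also have "\<dots> = inverse 2 * ?g x z + (of_bool (x = z) + inverse 2 * (\<integral>\<^sup>+ s. ?g (x + s) z \<partial>\<mu>))"
      by (subst hit_rec) (simp add: nn_integral_lazy ac_simps)
    finally have "inverse 2 * ?g x z = of_bool (x = z) + inverse 2 * (\<integral>\<^sup>+ s. ?g (x + s) z \<partial>\<mu>)"
      using finl[of x] by (subst (asm) ennreal_add_left_cancel) (auto simp: ennreal_mult_eq_top_iff)
    then show "of_bool (x = z) + (\<integral>\<^sup>+ s. inverse 2 * ?g (x + s) z \<partial>\<mu>) \<le> inverse 2 * ?g x z"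
      by (simp add: nn_integral_cmult)
  qed
  then have "2 * gr \<mu> x z \<le> 2 * (inverse 2 * gr (lazy \<mu>) x z)" by (intro mult_left_mono) auto
  then show "2 * gr \<mu> x z \<le> gr (lazy \<mu>) x z" using half2 by (simp add: mult.left_commute)
qed

section \<open>Exponential decay on paradoxical groups\<close>

lemma nn_integral_pmf_ge: "ennreal (pmf \<mu> s) * h s \<le> (\<integral>\<^sup>+ s. h s \<partial>\<mu>)"
proof -
  have "ennreal (pmf \<mu> s) * h s = (\<integral>\<^sup>+ x. h x * indicator {s} x \<partial>\<mu>)"
    by (simp add: emeasure_pmf_single mult.commute)
  also have "\<dots> \<le> (\<integral>\<^sup>+ s. h s \<partial>\<mu>)"
    by (intro nn_integral_mono) (auto simp: indicator_def)
  finally show ?thesis .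
qed

lemma nn_integral_pmf_count_space_swap:
  fixes \<mu> :: "'a pmf"
  shows
  "(\<integral>\<^sup>+ x. \<integral>\<^sup>+ s. h s x \<partial>\<mu> \<partial>count_space UNIV) =
   (\<integral>\<^sup>+ s. \<integral>\<^sup>+ x. h s x \<partial>count_space UNIV \<partial>\<mu>)"
proof -
  have "(\<integral>\<^sup>+ x. \<integral>\<^sup>+ s. h s x \<partial>\<mu> \<partial>count_space UNIV) =
      (\<integral>\<^sup>+ x. \<integral>\<^sup>+ s. (case (x, s) of (x, s) \<Rightarrow> ennreal (pmf \<mu> s) * h s x) \<partial>count_space UNIV \<partial>count_space UNIV)"
    by (simp add: nn_integral_measure_pmf)
  also have "\<dots> = (\<integral>\<^sup>+ s. \<integral>\<^sup>+ x. (case (x, s) of (x, s) \<Rightarrow> ennreal (pmf \<mu> s) * h s x) \<partial>count_space UNIV \<partial>count_space UNIV)"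
    by (rule trans[OF nn_integral_fst_count_space nn_integral_snd_count_space[symmetric]])
  also have "\<dots> = (\<integral>\<^sup>+ s. \<integral>\<^sup>+ x. h s x \<partial>count_space UNIV \<partial>\<mu>)"
    by (simp add: nn_integral_measure_pmf nn_integral_cmult)
  finally show ?thesis .
qed

definition sqnorm :: "('a \<Rightarrow> real) \<Rightarrow> ennreal" where
  "sqnorm f = (\<integral>\<^sup>+ x. ennreal ((f x)\<^sup>2) \<partial>count_space UNIV)"

lemma sqnorm_shift: "sqnorm (\<lambda>x. f (g + x)) = sqnorm (f :: 'a::group_add \<Rightarrow> real)"
proof -
  have "bij ((+) g)" by (rule bij_plus)
  from nn_integral_bij_count_space[OF this, of "\<lambda>x. ennreal ((f x)\<^sup>2)"] show ?thesis
    unfolding sqnorm_def .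
qed

lemma sqnorm_add_le:
  assumes "\<And>x. h x = f x + g x"
  shows "sqnorm h \<le> 2 * sqnorm f + 2 * sqnorm g"
proof -
  have "ennreal ((h x)\<^sup>2) \<le> 2 * ennreal ((f x)\<^sup>2) + 2 * ennreal ((g x)\<^sup>2)" for x
  proof -
    have "(h x)\<^sup>2 \<le> 2 * (f x)\<^sup>2 + 2 * (g x)\<^sup>2"
      using sum_squares_bound[of "f x" "g x"] by (simp add: assms power2_sum)
    then have "ennreal ((h x)\<^sup>2) \<le> ennreal (2 * (f x)\<^sup>2 + 2 * (g x)\<^sup>2)" by (rule ennreal_leI)
    also have "\<dots> = 2 * ennreal ((f x)\<^sup>2) + 2 * ennreal ((g x)\<^sup>2)"
      by (simp add: ennreal_plus ennreal_mult)
    finally show ?thesis .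
  qed
  then have "sqnorm h \<le> (\<integral>\<^sup>+ x. 2 * ennreal ((f x)\<^sup>2) + 2 * ennreal ((g x)\<^sup>2) \<partial>count_space UNIV)"
    unfolding sqnorm_def by (intro nn_integral_mono) auto
  also have "\<dots> = 2 * sqnorm f + 2 * sqnorm g"
    unfolding sqnorm_def by (simp add: nn_integral_add nn_integral_cmult)
  finally show ?thesis .
qed

definition variation :: "('a::group_add \<Rightarrow> real) \<Rightarrow> 'a \<Rightarrow> ennreal" where
  "variation f g = sqnorm (\<lambda>x. f (- g + x) - f x)"

text \<open>
  The Dirichlet form of the walk, up to a factor.
\<close>

definition energy :: "'a::group_add pmf \<Rightarrow> ('a \<Rightarrow> real) \<Rightarrow> ennreal" where
  "energy \<mu> f = (\<integral>\<^sup>+ s. variation f s \<partial>\<mu>)"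

text \<open>
  On the support of \<open>\<mu>\<close> this is one term of the integral; a translation by a sum
  is estimated in two steps.
\<close>

lemma variation_le_energy:
  assumes "g \<in> generated_semigroup (set_pmf \<mu>)"
  shows "\<exists>C\<ge>0. \<forall>f. variation f g \<le> ennreal C * energy \<mu> f"
  using assms
proof induction
  case (incl s)
  then have p: "pmf \<mu> s > 0" by (simp add: pmf_positive)
  have "variation f s \<le> ennreal (1 / pmf \<mu> s) * energy \<mu> f" for f
  proof -
    have "variation f s = ennreal (1 / pmf \<mu> s) * (ennreal (pmf \<mu> s) * variation f s)"
      using p by (simp add: mult.assoc[symmetric] ennreal_mult[symmetric])
    also have "\<dots> \<le> ennreal (1 / pmf \<mu> s) * energy \<mu> f"
      unfolding energy_def by (intro mult_left_mono nn_integral_pmf_ge) simp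
    finally show ?thesis .
  qed
  then show ?case using p by (intro exI[of _ "1 / pmf \<mu> s"]) auto
next
  case (add g h)
  then obtain C1 C2 where C: "C1 \<ge> 0" "\<And>f. variation f g \<le> ennreal C1 * energy \<mu> f"
    "C2 \<ge> 0" "\<And>f. variation f h \<le> ennreal C2 * energy \<mu> f" by blast
  have "variation f (g + h) \<le> ennreal (2 * C1 + 2 * C2) * energy \<mu> f" for f
  proof -
    have "variation f (g + h) \<le> 2 * sqnorm (\<lambda>x. f (- h + (- g + x)) - f (- g + x)) + 2 * variation f g"
      unfolding variation_def
      by (rule sqnorm_add_le) (simp add: minus_add add.assoc del: add_uminus_conv_diff)
    also have "sqnorm (\<lambda>x. f (- h + (- g + x)) - f (- g + x)) = variation f h"
      unfolding variation_def using sqnorm_shift[of "\<lambda>x. f (- h + x) - f x" "- g"] by simp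
    also have "2 * variation f h + 2 * variation f g \<le> 2 * (ennreal C2 * energy \<mu> f) + 2 * (ennreal C1 * energy \<mu> f)"
      by (intro add_mono mult_left_mono C) auto
    also have "\<dots> = (2 * ennreal C2 + 2 * ennreal C1) * energy \<mu> f" by (simp add: distrib_right mult.assoc)
    also have "2 * ennreal C2 + 2 * ennreal C1 = ennreal (2 * C1 + 2 * C2)"
      using C by (simp add: ennreal_plus ennreal_mult add.commute)
    finally show ?thesis .
  qed
  then show ?case using C by (intro exI[of _ "2 * C1 + 2 * C2"]) auto
qed

definition mass :: "('a \<Rightarrow> real) \<Rightarrow> 'a set \<Rightarrow> ennreal" where
  "mass f E = (\<integral>\<^sup>+ x. ennreal ((f x)\<^sup>2) * indicator E x \<partial>count_space UNIV)"

lemma mass_disjoint_Un: "E \<inter> E' = {} \<Longrightarrow> mass f (E \<union> E') = mass f E + mass f E'"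
  unfolding mass_def
  by (subst nn_integral_add[symmetric]) (auto intro!: nn_integral_cong simp: indicator_def)

lemma mass_Compl: "mass f E + mass f (- E) = sqnorm f"
  unfolding mass_def sqnorm_def
  by (subst nn_integral_add[symmetric]) (auto intro!: nn_integral_cong simp: indicator_def)

lemma mass_le_sqnorm: "mass f E \<le> sqnorm f"
  unfolding mass_def sqnorm_def by (intro nn_integral_mono) (auto simp: indicator_def)

text \<open>
  Almost invariance of the measure with density \<open>f\<^sup>2\<close>. It rests on \<open>(u -
  v)\<^sup>2 \<le> 5/4 u\<^sup>2 + 5 v\<^sup>2\<close>; the factor \<open>5/4\<close> is close
  enough to 1 for exploiting a paradoxical decomposition.
\<close>

lemma mass_shift_le:
  fixes f :: "'a::group_add \<Rightarrow> real"
  assumes "\<And>w. w \<in> E \<Longrightarrow> A + w \<in> Q"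
  shows "mass f E \<le> ennreal (5/4) * mass f Q + 5 * variation f (- A)"
proof -
  have "ennreal ((f x)\<^sup>2) * indicator E x \<le>
      ennreal (5/4) * (ennreal ((f (A + x))\<^sup>2) * indicator Q (A + x)) + 5 * ennreal ((f (A + x) - f x)\<^sup>2)" for x
  proof (cases "x \<in> E")
    case True
    have "(f x)\<^sup>2 \<le> 5/4 * (f (A + x))\<^sup>2 + 5 * (f (A + x) - f x)\<^sup>2"
    proof -
      have "f x = f (A + x) - (f (A + x) - f x)" by simp
      moreover have "(u - v)\<^sup>2 \<le> 5/4 * u\<^sup>2 + 5 * v\<^sup>2" for u v :: real
      proof -
        have "0 \<le> (u / 2 + 2 * v)\<^sup>2" by simp
        then show ?thesis by (simp add: power2_eq_square algebra_simps)
      qed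
      ultimately show ?thesis by metis
    qed
    then have "ennreal ((f x)\<^sup>2) \<le> ennreal (5/4 * (f (A + x))\<^sup>2 + 5 * (f (A + x) - f x)\<^sup>2)" by (rule ennreal_leI)
    also have "\<dots> = ennreal (5/4) * ennreal ((f (A + x))\<^sup>2) + ennreal 5 * ennreal ((f (A + x) - f x)\<^sup>2)"
    proof -
      have "ennreal (5/4 * (f (A + x))\<^sup>2) = ennreal (5/4) * ennreal ((f (A + x))\<^sup>2)"
        "ennreal (5 * (f (A + x) - f x)\<^sup>2) = ennreal 5 * ennreal ((f (A + x) - f x)\<^sup>2)"
        by (rule ennreal_mult; simp)+
      then show ?thesis by (subst ennreal_plus) (simp_all only:, simp_all)
    qed
    finally show ?thesis using True assms[OF True] by simp
  qed simp
  then have "mass f E \<le> (\<integral>\<^sup>+ x. ennreal (5/4) * (ennreal ((f (A + x))\<^sup>2) * indicator Q (A + x)) + 5 * ennreal ((f (A + x) - f x)\<^sup>2) \<partial>count_space UNIV)"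
    unfolding mass_def by (intro nn_integral_mono) auto
  also have "\<dots> = ennreal (5/4) * (\<integral>\<^sup>+ x. ennreal ((f (A + x))\<^sup>2) * indicator Q (A + x) \<partial>count_space UNIV) + 5 * variation f (- A)"
    unfolding variation_def sqnorm_def by (simp add: nn_integral_add nn_integral_cmult)
  also have "(\<integral>\<^sup>+ x. ennreal ((f (A + x))\<^sup>2) * indicator Q (A + x) \<partial>count_space UNIV) = mass f Q"
    unfolding mass_def
    using nn_integral_bij_count_space[OF bij_plus[of A], of "\<lambda>x. ennreal ((f x)\<^sup>2) * indicator Q x"] .
  finally show ?thesis .
qed

text \<open>
  If \<open>f\<close> varied little under \<open>A\<close> and \<open>B\<close>, the normalized
  measure with density \<open>f\<^sup>2\<close> would be nearly invariant. Then \<open>P \<union>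
  Q\<close> would have nearly full measure, while \<open>Y\<close>, disjoint from it, would have
  nearly half of it or more.
\<close>

lemma paradox_sqnorm_le:
  fixes f :: "'a::group_add \<Rightarrow> real"
  assumes disj: "P \<inter> Q = {}" "P \<inter> Y = {}" "Q \<inter> Y = {}"
    and A: "\<And>w. w \<notin> P \<Longrightarrow> A + w \<in> Q" and B: "\<And>w. w \<notin> Y \<Longrightarrow> B + w \<in> Y"
    and fin: "sqnorm f < \<top>"
  shows "sqnorm f \<le> 30 * (variation f (- A) + variation f (- B))"
proof (cases "variation f (- A) = \<top> \<or> variation f (- B) = \<top>")
  case True
  then show ?thesis by (auto simp: ennreal_mult_eq_top_iff)
next
  case False
  have mfin: "mass f E < \<top>" for E using mass_le_sqnorm[of f E] fin by (rule order_le_less_trans)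
  have 1: "mass f (- P) \<le> ennreal (5/4) * mass f Q + 5 * variation f (- A)"
    by (rule mass_shift_le) (use A in blast)
  have 2: "mass f (- Y) \<le> ennreal (5/4) * mass f Y + 5 * variation f (- B)"
    by (rule mass_shift_le) (use B in blast)
  have 3: "mass f P + mass f Q + mass f Y \<le> sqnorm f"
    using disj mass_le_sqnorm[of f "P \<union> Q \<union> Y"] by (simp add: mass_disjoint_Un Int_Un_distrib2)
  obtain p where p: "mass f P = ennreal p" "p \<ge> 0" using mfin[of P] by (cases "mass f P") auto
  obtain p' where p': "mass f (- P) = ennreal p'" "p' \<ge> 0" using mfin[of "- P"] by (cases "mass f (- P)") auto
  obtain q where q: "mass f Q = ennreal q" "q \<ge> 0" using mfin[of Q] by (cases "mass f Q") auto
  obtain y where y: "mass f Y = ennreal y" "y \<ge> 0" using mfin[of Y] by (cases "mass f Y") auto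
  obtain y' where y': "mass f (- Y) = ennreal y'" "y' \<ge> 0" using mfin[of "- Y"] by (cases "mass f (- Y)") auto
  obtain t where t: "sqnorm f = ennreal t" "t \<ge> 0" using fin by (cases "sqnorm f") auto
  obtain a where a: "variation f (- A) = ennreal a" "a \<ge> 0" using False by (cases "variation f (- A)") auto
  obtain b where b: "variation f (- B) = ennreal b" "b \<ge> 0" using False by (cases "variation f (- B)") auto
  have e5: "(5 :: ennreal) = ennreal 5" "(30 :: ennreal) = ennreal 30" by simp_all
  have "p' \<le> 5/4 * q + 5 * a"
    using 1 p' q a unfolding p' q a e5 by (simp add: ennreal_mult[symmetric] ennreal_plus[symmetric] del: ennreal_plus ennreal_numeral)
  moreover have "y' \<le> 5/4 * y + 5 * b"
    using 2 y' y b unfolding y' y b e5 by (simp add: ennreal_mult[symmetric] ennreal_plus[symmetric] del: ennreal_plus ennreal_numeral)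
  moreover have "p + q + y \<le> t"
    using 3 p q y t unfolding p q y t by (simp add: ennreal_plus[symmetric] del: ennreal_plus)
  moreover have "p + p' = t" "y + y' = t"
    using mass_Compl[of f P] mass_Compl[of f Y] p p' y y' t unfolding p p' y y' t
    by (simp_all add: ennreal_plus[symmetric] del: ennreal_plus)
  ultimately have *: "p' \<le> 5/4 * q + 5 * a" "y' \<le> 5/4 * y + 5 * b" "p + q + y \<le> t" "p + p' = t" "y + y' = t"
    by blast+
  then have y1: "y \<le> 1/4 * q + 5 * a" "t \<le> 9/4 * y + 5 * b" "q \<le> t" using p(2) q(2) y(2) by simp_all
  have "t \<le> 9/4 * (1/4 * t + 5 * a) + 5 * b" using y1 by (simp add: algebra_simps)
  then have "t \<le> 30 * (a + b)" using a(2) b(2) by (simp add: algebra_simps)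
  then show ?thesis unfolding t a b e5
    using a b by (simp add: ennreal_mult[symmetric] ennreal_plus[symmetric] del: ennreal_plus ennreal_numeral)
qed

text \<open>
  Jensen's inequality for the average \<open>g\<close> of the functions \<open>(f +
  f\<^sub>s)/2\<close>, combined with the parallelogram identity for each \<open>s\<close>;
  laziness is what makes \<open>f\<close> itself one of the two functions averaged.
\<close>

lemma lazy_contraction:
  fixes f g :: "'a::group_add \<Rightarrow> real" and \<mu> :: "'a pmf"
  assumes f: "\<And>x. f x \<ge> 0" and g: "\<And>x. g x \<ge> 0"
    and step: "\<And>x. ennreal (g x) = (\<integral>\<^sup>+ s. ennreal ((f x + f (- s + x)) / 2) \<partial>\<mu>)"
  shows "sqnorm g + ennreal (1/4) * energy \<mu> f \<le> sqnorm f"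
proof -
  have "sqnorm g \<le> (\<integral>\<^sup>+ x. \<integral>\<^sup>+ s. ennreal (((f x + f (- s + x)) / 2)\<^sup>2) \<partial>\<mu> \<partial>count_space UNIV)"
    unfolding sqnorm_def
  proof (intro nn_integral_mono)
    fix x
    have "ennreal ((g x)\<^sup>2) = (ennreal (g x))\<^sup>2" by (simp add: g ennreal_power)
    also have "\<dots> = (\<integral>\<^sup>+ s. ennreal ((f x + f (- s + x)) / 2) * 1 \<partial>\<mu>)\<^sup>2" by (simp add: step)
    also have "\<dots> \<le> (\<integral>\<^sup>+ s. (ennreal ((f x + f (- s + x)) / 2))\<^sup>2 \<partial>\<mu>) * (\<integral>\<^sup>+ s. 1\<^sup>2 \<partial>\<mu>)"
      by (rule Cauchy_Schwarz_nn_integral) auto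
    also have "\<dots> = (\<integral>\<^sup>+ s. ennreal (((f x + f (- s + x)) / 2)\<^sup>2) \<partial>\<mu>)"
      using f by (simp add: ennreal_power)
    finally show "ennreal ((g x)\<^sup>2) \<le> (\<integral>\<^sup>+ s. ennreal (((f x + f (- s + x)) / 2)\<^sup>2) \<partial>\<mu>)" .
  qed
  also have "\<dots> = (\<integral>\<^sup>+ s. \<integral>\<^sup>+ x. ennreal (((f x + f (- s + x)) / 2)\<^sup>2) \<partial>count_space UNIV \<partial>\<mu>)"
    by (rule nn_integral_pmf_count_space_swap)
  finally have 1: "sqnorm g \<le> (\<integral>\<^sup>+ s. \<integral>\<^sup>+ x. ennreal (((f x + f (- s + x)) / 2)\<^sup>2) \<partial>count_space UNIV \<partial>\<mu>)" .
  have 2: "ennreal (1/4) * energy \<mu> f =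
      (\<integral>\<^sup>+ s. \<integral>\<^sup>+ x. ennreal (((f (- s + x) - f x) / 2)\<^sup>2) \<partial>count_space UNIV \<partial>\<mu>)"
  proof -
    have "ennreal (((f (- s + x) - f x) / 2)\<^sup>2) = ennreal (1/4) * ennreal ((f (- s + x) - f x)\<^sup>2)" for s x
      by (simp add: ennreal_mult[symmetric] power_divide)
    then show ?thesis unfolding energy_def variation_def sqnorm_def by (simp add: nn_integral_cmult)
  qed
  have 3: "(\<integral>\<^sup>+ x. ennreal (((f x + f (- s + x)) / 2)\<^sup>2) \<partial>count_space UNIV) +
      (\<integral>\<^sup>+ x. ennreal (((f (- s + x) - f x) / 2)\<^sup>2) \<partial>count_space UNIV) = sqnorm f" for s
  proof -
    have "(\<integral>\<^sup>+ x. ennreal (((f x + f (- s + x)) / 2)\<^sup>2) \<partial>count_space UNIV) +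
      (\<integral>\<^sup>+ x. ennreal (((f (- s + x) - f x) / 2)\<^sup>2) \<partial>count_space UNIV) =
      (\<integral>\<^sup>+ x. ennreal (1/2) * ennreal ((f x)\<^sup>2) + ennreal (1/2) * ennreal ((f (- s + x))\<^sup>2) \<partial>count_space UNIV)"
    proof (subst nn_integral_add[symmetric]; (intro nn_integral_cong)?)
      fix x
      have "((f x + f (- s + x)) / 2)\<^sup>2 + ((f (- s + x) - f x) / 2)\<^sup>2 = 1/2 * (f x)\<^sup>2 + 1/2 * (f (- s + x))\<^sup>2"
        by (simp add: power2_eq_square field_simps)
      then have "ennreal (((f x + f (- s + x)) / 2)\<^sup>2 + ((f (- s + x) - f x) / 2)\<^sup>2) = ennreal (1/2 * (f x)\<^sup>2 + 1/2 * (f (- s + x))\<^sup>2)"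
        by simp
      then show "ennreal (((f x + f (- s + x)) / 2)\<^sup>2) + ennreal (((f (- s + x) - f x) / 2)\<^sup>2) =
         ennreal (1/2) * ennreal ((f x)\<^sup>2) + ennreal (1/2) * ennreal ((f (- s + x))\<^sup>2)"
        by (subst (asm) (1 2) ennreal_plus) (simp_all only: ennreal_mult zero_le_power2 zero_le_mult_iff, simp_all)
    qed auto
    also have "\<dots> = ennreal (1/2) * sqnorm f + ennreal (1/2) * sqnorm (\<lambda>x. f (- s + x))"
      unfolding sqnorm_def by (subst nn_integral_add) (auto simp: nn_integral_cmult)
    also have "\<dots> = sqnorm f" unfolding sqnorm_shift using half_add_half[of "sqnorm f"] by simp
    finally show ?thesis .
  qed
  have "sqnorm g + ennreal (1/4) * energy \<mu> f \<le>
     (\<integral>\<^sup>+ s. \<integral>\<^sup>+ x. ennreal (((f x + f (- s + x)) / 2)\<^sup>2) \<partial>count_space UNIV \<partial>\<mu>) +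
     (\<integral>\<^sup>+ s. \<integral>\<^sup>+ x. ennreal (((f (- s + x) - f x) / 2)\<^sup>2) \<partial>count_space UNIV \<partial>\<mu>)"
    unfolding 2 by (intro add_right_mono 1)
  also have "\<dots> = (\<integral>\<^sup>+ s. sqnorm f \<partial>\<mu>)"
    by (subst nn_integral_add[symmetric]) (auto simp: 3)
  also have "\<dots> = sqnorm f" by simp
  finally show ?thesis .
qed

lemma exponential_decay:
  fixes \<mu> :: "'a::group_add pmf" and A B :: 'a and P Q Y :: "'a set"
  assumes gen: "generated_semigroup (set_pmf \<mu>) = UNIV"
    and disj: "P \<inter> Q = {}" "P \<inter> Y = {}" "Q \<inter> Y = {}"
    and A: "\<And>w. w \<notin> P \<Longrightarrow> A + w \<in> Q" and B: "\<And>w. w \<notin> Y \<Longrightarrow> B + w \<in> Y"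
  shows "\<exists>r. 0 < r \<and> r < 1 \<and> (\<forall>n x z. prb (lazy \<mu>) n x z \<le> ennreal (r ^ n))"
proof -
  obtain C1 where C1: "C1 \<ge> 0" "\<And>f. variation f (- A) \<le> ennreal C1 * energy \<mu> f"
    using variation_le_energy[of "- A" \<mu>] gen by auto
  obtain C2 where C2: "C2 \<ge> 0" "\<And>f. variation f (- B) \<le> ennreal C2 * energy \<mu> f"
    using variation_le_energy[of "- B" \<mu>] gen by auto
  define C where "C = 30 * (C1 + C2) + 1"
  have C: "C \<ge> 1" using C1(1) C2(1) by (simp add: C_def)
  have energy_ge: "sqnorm f \<le> ennreal C * energy \<mu> f" if "sqnorm f < \<top>" for f
  proof -
    have "sqnorm f \<le> 30 * (variation f (- A) + variation f (- B))"
      by (rule paradox_sqnorm_le[OF disj A B that])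
    also have "\<dots> \<le> 30 * (ennreal C1 * energy \<mu> f + ennreal C2 * energy \<mu> f)"
      by (intro mult_left_mono add_mono C1 C2) auto
    also have "\<dots> = ennreal (30 * (C1 + C2)) * energy \<mu> f"
      using C1(1) C2(1) by (simp add: ennreal_mult ennreal_plus distrib_right mult.assoc)
    also have "\<dots> \<le> ennreal C * energy \<mu> f"
      unfolding C_def by (intro mult_right_mono ennreal_leI) auto
    finally show ?thesis .
  qed
  define u where "u n x = pmf (convolution_power (lazy \<mu>) n) x" for n x
  have u_prb: "prb (lazy \<mu>) n 0 x = ennreal (u n x)" for n x by (simp add: prb_eq_pmf u_def)
  have u_nonneg: "u n x \<ge> 0" for n x by (simp add: u_def)
  have u_step: "ennreal (u (Suc n) x) = (\<integral>\<^sup>+ s. ennreal ((u n x + u n (- s + x)) / 2) \<partial>\<mu>)" for n x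
  proof -
    have *: "prb (lazy \<mu>) n s x = ennreal (u n (- s + x))" for s
      using prb_translate[of "lazy \<mu>" n s 0 "- s + x"] by (simp add: u_prb add.assoc[symmetric])
    have "ennreal (u (Suc n) x) = inverse 2 * ennreal (u n x) + inverse 2 * (\<integral>\<^sup>+ s. ennreal (u n (- s + x)) \<partial>\<mu>)"
      unfolding u_prb[symmetric] by (simp add: nn_integral_lazy * u_prb)
    also have "\<dots> = (\<integral>\<^sup>+ s. inverse 2 * ennreal (u n x) + inverse 2 * ennreal (u n (- s + x)) \<partial>\<mu>)"
      by (simp add: nn_integral_add nn_integral_cmult)
    also have "(\<lambda>s. inverse 2 * ennreal (u n x) + inverse 2 * ennreal (u n (- s + x))) =
        (\<lambda>s. ennreal ((u n x + u n (- s + x)) / 2))"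
    proof
      fix s
      have "ennreal ((u n x + u n (- s + x)) / 2) = ennreal (1/2 * u n x + 1/2 * u n (- s + x))"
        by (simp add: field_simps)
      also have "\<dots> = ennreal (1/2) * ennreal (u n x) + ennreal (1/2) * ennreal (u n (- s + x))"
        using u_nonneg by (subst ennreal_plus) (simp_all only: ennreal_mult, simp_all add: u_nonneg)
      finally show "inverse 2 * ennreal (u n x) + inverse 2 * ennreal (u n (- s + x)) = ennreal ((u n x + u n (- s + x)) / 2)"
        by simp
    qed
    finally show ?thesis .
  qed
  define q where "q = 1 - 1 / (4 * C)"
  have q: "0 < q" "q < 1" using C by (auto simp: q_def field_simps)
  have decay: "sqnorm (u n) \<le> ennreal (q ^ n)" for n
  proof (induction n)
    case 0
    have "ennreal ((u 0 x)\<^sup>2) = 1 * indicator {0} x" for x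
      by (simp add: u_def convolution_power_def pmf_return indicator_def)
    then have "sqnorm (u 0) = (\<integral>\<^sup>+ x. 1 * indicator {0::'a} x \<partial>count_space UNIV)"
      unfolding sqnorm_def by (simp only:)
    also have "\<dots> = 1" by (subst nn_integral_indicator_singleton) auto
    finally show ?case by simp
  next
    case (Suc n)
    have fin: "sqnorm (u n) < \<top>" using Suc by (rule order_le_less_trans) simp
    obtain t where t: "sqnorm (u n) = ennreal t" "t \<ge> 0" using fin by (cases "sqnorm (u n)") auto
    have con: "sqnorm (u (Suc n)) + ennreal (1/4) * energy \<mu> (u n) \<le> sqnorm (u n)"
      by (rule lazy_contraction) (auto simp: u_nonneg u_step)
    have tq: "t \<le> q ^ n" using Suc t q by simp
    have "sqnorm (u (Suc n)) + ennreal (1/4) * energy \<mu> (u n) < \<top>"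
      using con fin by (rule order_le_less_trans)
    then have "sqnorm (u (Suc n)) < \<top>" "ennreal (1/4) * energy \<mu> (u n) < \<top>"
      by (simp_all only: ennreal_add_less_top)
    then obtain t' e where t': "sqnorm (u (Suc n)) = ennreal t'" "t' \<ge> 0"
      and e: "energy \<mu> (u n) = ennreal e" "e \<ge> 0"
      by (cases "sqnorm (u (Suc n))"; cases "energy \<mu> (u n)") (auto simp: ennreal_mult_top)
    have 1: "t' + 1/4 * e \<le> t"
      using con t t' e unfolding t t' e by (simp add: ennreal_mult[symmetric] ennreal_plus[symmetric] del: ennreal_plus)
    have "t \<le> C * e" using energy_ge[OF fin] C e t unfolding e t by (simp add: ennreal_mult[symmetric])
    then have "t / (4 * C) \<le> 1/4 * e" using C by (simp add: field_simps)
    then have "t' \<le> q * t" using 1 by (simp add: q_def algebra_simps)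
    also have "\<dots> \<le> q * q ^ n" using tq q by (intro mult_left_mono) auto
    finally show ?case unfolding t' by (intro ennreal_leI) simp
  qed
  define r where "r = sqrt q"
  have r: "0 < r" "r < 1" using q by (auto simp: r_def)
  have "prb (lazy \<mu>) n x z \<le> ennreal (r ^ n)" for n x z
  proof -
    define y where "y = - x + z"
    have "prb (lazy \<mu>) n x z = ennreal (u n y)" by (simp add: prb_eq_pmf u_def y_def)
    moreover have "u n y \<le> r ^ n"
    proof -
      have "ennreal ((u n y)\<^sup>2) \<le> sqnorm (u n)"
        unfolding sqnorm_def by (rule nn_integral_ge_point) simp
      then have "ennreal ((u n y)\<^sup>2) \<le> ennreal (q ^ n)" using decay by (rule order_trans)
      then have "(u n y)\<^sup>2 \<le> q ^ n" using q by simp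
      also have "q ^ n = (r * r) ^ n" using q(1) unfolding r_def by simp
      also have "\<dots> = (r ^ n)\<^sup>2" by (simp only: power2_eq_square power_mult_distrib)
      finally show ?thesis by (rule power2_le_imp_le) (use r in simp)
    qed
    ultimately show ?thesis by (simp add: ennreal_leI)
  qed
  then show ?thesis using r by blast
qed

context cayley_group begin

section \<open>Harnack inequality and the two easy cases\<close>

lemma ex_prb_pos:
  assumes "g \<in> generated_semigroup (set_pmf \<mu>)"
  shows "\<exists>n. prb \<mu> n 0 g > 0"
  using assms
proof induction
  case (incl s)
  have "ennreal (pmf \<mu> s) * of_bool (0 + s = s) \<le> (\<integral>\<^sup>+ t. of_bool (0 + t = s) \<partial>\<mu>)"
    by (rule nn_integral_pmf_ge)
  then have "ennreal (pmf \<mu> s) \<le> prb \<mu> 1 0 s" by simp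
  moreover have "0 < ennreal (pmf \<mu> s)" using incl by (simp add: pmf_positive)
  ultimately have "0 < prb \<mu> 1 0 s" by (rule order_less_le_trans[rotated])
  then show ?case by blast
next
  case (add g h)
  then obtain m n where "prb \<mu> m 0 g > 0" "prb \<mu> n 0 h > 0" by blast
  moreover have "prb \<mu> n g (g + h) = prb \<mu> n 0 h" using prb_translate[of \<mu> n g 0 h] by simp
  ultimately have "0 < prb \<mu> m 0 g * prb \<mu> n g (g + h)" by (simp add: ennreal_zero_less_mult_iff)
  also have "\<dots> \<le> prb \<mu> (m + n) 0 (g + h)" by (rule prb_mult_le)
  finally show ?case by blast
qed

text \<open>
  Every generator is reached with positive probability, and there are only finitely many of them.
\<close>

lemma ex_harnack:
  assumes "generated_semigroup (set_pmf \<mu>) = UNIV"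
  shows "\<exists>c>0. c \<le> 1 \<and> (\<forall>x y z. ennreal (c ^ N (- x + y)) * gr \<mu> y z \<le> gr \<mu> x z) \<and>
    (\<forall>x y z. gr \<mu> x y * ennreal (c ^ N (- y + z)) \<le> gr \<mu> x z)"
proof -
  have "\<exists>c::real. 0 < c \<and> c \<le> 1 \<and> (\<exists>n. ennreal c \<le> prb \<mu> n 0 s)" for s
  proof -
    obtain n where n: "prb \<mu> n 0 s > 0" using ex_prb_pos[of s \<mu>] assms by auto
    have fin: "prb \<mu> n 0 s < \<top>" using prb_le_1[of \<mu> n 0 s] by (rule order_le_less_trans) simp
    have "enn2real (prb \<mu> n 0 s) \<le> 1"
      using prb_le_1[of \<mu> n 0 s] by (metis enn2real_leI ennreal_1 zero_le_one)
    then show ?thesis using n fin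
      by (intro exI[of _ "enn2real (prb \<mu> n 0 s)"]) (auto simp: enn2real_positive_iff intro!: exI[of _ n])
  qed
  then obtain cs :: "'a \<Rightarrow> real" where cs: "\<And>s. 0 < cs s" "\<And>s. cs s \<le> 1" "\<And>s. \<exists>n. ennreal (cs s) \<le> prb \<mu> n 0 s"
    by metis
  define c where "c = Min (insert 1 (cs ` S))"
  have c: "0 < c" "c \<le> 1" unfolding c_def using finite_S cs(1) by (auto simp: Min_gr_iff)
  have step: "\<exists>n. ennreal c \<le> prb \<mu> n x (x + s)" if "s \<in> S" for s x
  proof -
    obtain n where n: "ennreal (cs s) \<le> prb \<mu> n 0 s" using cs(3) by blast
    have "c \<le> cs s" unfolding c_def using that finite_S by (intro Min_le) auto
    then have "ennreal c \<le> prb \<mu> n 0 s" using n ennreal_leI order_trans by blast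
    moreover have "prb \<mu> n x (x + s) = prb \<mu> n 0 s" using prb_translate[of \<mu> n x 0 s] by simp
    ultimately show ?thesis by metis
  qed
  have left: "ennreal (c ^ N g) * gr \<mu> (x + g) z \<le> gr \<mu> x z" for g x z
  proof (induction "N g" arbitrary: g)
    case 0
    then obtain ws where "length ws = 0" "sum_list ws = g" using ex_geodesic_word by metis
    then show ?case by simp
  next
    case (Suc k)
    then obtain h s where hs: "g = h + s" "N h = k" "s \<in> S" using N_Suc_split by metis
    obtain n where n: "ennreal c \<le> prb \<mu> n (x + h) (x + h + s)" using step[OF hs(3)] by blast
    have "ennreal (c ^ N g) * gr \<mu> (x + g) z = ennreal (c ^ k) * (ennreal c * gr \<mu> (x + h + s) z)"
      using c Suc(2)[symmetric] hs(1) by (simp add: ennreal_mult ac_simps)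
    also have "\<dots> \<le> ennreal (c ^ k) * (prb \<mu> n (x + h) (x + h + s) * gr \<mu> (x + h + s) z)"
      by (intro mult_left_mono mult_right_mono n) auto
    also have "\<dots> \<le> ennreal (c ^ k) * gr \<mu> (x + h) z"
      by (intro mult_left_mono prb_mult_gr_le) auto
    also have "\<dots> \<le> gr \<mu> x z" using Suc(1)[of h] hs(2) by simp
    finally show ?case .
  qed
  have right: "gr \<mu> x y * ennreal (c ^ N g) \<le> gr \<mu> x (y + g)" for g x y
  proof (induction "N g" arbitrary: g)
    case 0
    then obtain ws where "length ws = 0" "sum_list ws = g" using ex_geodesic_word by metis
    then show ?case by simp
  next
    case (Suc k)
    then obtain h s where hs: "g = h + s" "N h = k" "s \<in> S" using N_Suc_split by metis
    obtain n where n: "ennreal c \<le> prb \<mu> n (y + h) (y + h + s)" using step[OF hs(3)] by blast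
    have "gr \<mu> x y * ennreal (c ^ N g) = gr \<mu> x y * ennreal (c ^ k) * ennreal c"
      using c Suc(2)[symmetric] by (simp add: ennreal_mult ac_simps)
    also have "\<dots> \<le> gr \<mu> x (y + h) * prb \<mu> n (y + h) (y + h + s)"
      using Suc(1)[of h] hs(2) n by (intro mult_mono) auto
    also have "\<dots> \<le> gr \<mu> x (y + h + s)" by (rule gr_mult_prb_le)
    finally show ?case using hs(1) by (simp add: add.assoc)
  qed
  have "ennreal (c ^ N (- x + y)) * gr \<mu> y z \<le> gr \<mu> x z" for x y z
    using left[of "- x + y" x z] by (simp add: add.assoc[symmetric])
  moreover have "gr \<mu> x y * ennreal (c ^ N (- y + z)) \<le> gr \<mu> x z" for x y z
    using right[of x y "- y + z"] by (simp add: add.assoc[symmetric])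
  ultimately show ?thesis using c by blast
qed

end

locale harnack_walk = cayley_group S for S :: "'a::group_add set" +
  fixes \<mu> :: "'a pmf" and c :: real
  assumes c_pos: "0 < c" and c_le_1: "c \<le> 1"
    and harnack_left: "ennreal (c ^ N (- x + y)) * gr \<mu> y z \<le> gr \<mu> x z"
    and harnack_right: "gr \<mu> x y * ennreal (c ^ N (- y + z)) \<le> gr \<mu> x z"
    and gr_finite_0: "gr \<mu> 0 0 < \<top>"
begin

lemma gr_finite: "gr \<mu> x z < \<top>"
proof -
  have "gr \<mu> z z = gr \<mu> 0 0" using gr_translate[of \<mu> z 0 0] by simp
  then have "ennreal (c ^ N (- z + x)) * gr \<mu> x z < \<top>"
    using harnack_left[of z x z] gr_finite_0 by (simp add: order_le_less_trans)
  then show ?thesis using c_pos by (auto simp: ennreal_mult_less_top)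
qed

lemma gr_to_0_ge: "ennreal (c ^ N x) \<le> gr \<mu> x 0"
proof -
  have "ennreal (c ^ N x) * 1 \<le> ennreal (c ^ N (- x + 0)) * gr \<mu> 0 0"
    using hit_refl[of \<mu> "{}" 0] by (intro mult_mono) auto
  also have "\<dots> \<le> gr \<mu> x 0" by (rule harnack_left)
  finally show ?thesis by simp
qed

lemma gr_from_0_ge: "ennreal (c ^ N z) \<le> gr \<mu> 0 z"
proof -
  have "1 * ennreal (c ^ N z) \<le> gr \<mu> 0 0 * ennreal (c ^ N (- 0 + z))"
    using hit_refl[of \<mu> "{}" 0] by (intro mult_mono) auto
  also have "\<dots> \<le> gr \<mu> 0 z" by (rule harnack_right)
  finally show ?thesis by simp
qed

lemma harnack_mult_left: "gr \<mu> y z \<le> ennreal ((1 / c) ^ N (- x + y)) * gr \<mu> x z"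
proof -
  have "gr \<mu> y z = ennreal ((1 / c) ^ N (- x + y)) * (ennreal (c ^ N (- x + y)) * gr \<mu> y z)"
    using c_pos by (simp add: mult.assoc[symmetric] ennreal_mult[symmetric] power_mult_distrib[symmetric])
  also have "\<dots> \<le> ennreal ((1 / c) ^ N (- x + y)) * gr \<mu> x z"
    by (intro mult_left_mono harnack_left) simp
  finally show ?thesis .
qed

lemma harnack_mult_right: "gr \<mu> x y \<le> ennreal ((1 / c) ^ N (- y + z)) * gr \<mu> x z"
proof -
  have "gr \<mu> x y = ennreal ((1 / c) ^ N (- y + z)) * (gr \<mu> x y * ennreal (c ^ N (- y + z)))"
    using c_pos by (simp add: mult.left_commute[of _ "gr \<mu> x y"] ennreal_mult[symmetric] power_mult_distrib[symmetric])
  also have "\<dots> \<le> ennreal ((1 / c) ^ N (- y + z)) * gr \<mu> x z"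
    by (intro mult_left_mono harnack_right) simp
  finally show ?thesis .
qed

lemma ancona_near:
  assumes "N x \<le> R \<or> N z \<le> R"
  shows "gr \<mu> x z \<le> ennreal ((1 / c) ^ (2 * R)) * (gr \<mu> x 0 * gr \<mu> 0 z)"
proof -
  have c1: "1 \<le> 1 / c" using c_pos c_le_1 by simp
  have pw: "(1 / c) ^ n * (1 / c) ^ n \<le> (1 / c) ^ (2 * R)" if "n \<le> R" for n
    unfolding power_add[symmetric] using that c1 by (intro power_increasing) auto
  show ?thesis
  proof (cases "N x \<le> R")
    case True
    have "1 \<le> ennreal ((1 / c) ^ N x) * gr \<mu> x 0"
      using harnack_mult_left[of 0 0 x] hit_refl[of \<mu> "{}" 0] by (simp add: order_trans)
    then have "1 * gr \<mu> x z \<le> (ennreal ((1 / c) ^ N x) * gr \<mu> x 0) * (ennreal ((1 / c) ^ N x) * gr \<mu> 0 z)"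
      using harnack_mult_left[of x z 0] by (intro mult_mono) auto
    also have "\<dots> = ennreal ((1 / c) ^ N x * (1 / c) ^ N x) * (gr \<mu> x 0 * gr \<mu> 0 z)"
      using c_pos by (simp add: ennreal_mult ac_simps)
    also have "\<dots> \<le> ennreal ((1 / c) ^ (2 * R)) * (gr \<mu> x 0 * gr \<mu> 0 z)"
      by (intro mult_right_mono ennreal_leI pw[OF True]) simp
    finally show ?thesis by simp
  next
    case False
    then have Nz: "N z \<le> R" using assms by simp
    have "1 \<le> ennreal ((1 / c) ^ N z) * gr \<mu> 0 z"
      using harnack_mult_right[of 0 0 z] hit_refl[of \<mu> "{}" 0] by (simp add: order_trans)
    then have "gr \<mu> x z * 1 \<le> (ennreal ((1 / c) ^ N z) * gr \<mu> x 0) * (ennreal ((1 / c) ^ N z) * gr \<mu> 0 z)"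
      using harnack_mult_right[of x z 0] by (intro mult_mono) auto
    also have "\<dots> = ennreal ((1 / c) ^ N z * (1 / c) ^ N z) * (gr \<mu> x 0 * gr \<mu> 0 z)"
      using c_pos by (simp add: ennreal_mult ac_simps)
    also have "\<dots> \<le> ennreal ((1 / c) ^ (2 * R)) * (gr \<mu> x 0 * gr \<mu> 0 z)"
      by (intro mult_right_mono ennreal_leI pw[OF Nz]) simp
    finally show ?thesis by simp
  qed
qed

text \<open>
  The walk from \<open>V\<close> to its complement makes a jump \<open>s\<close> from some
  \<open>v \<in> V\<close> to \<open>v + s \<notin> V\<close>. By the Harnack inequality the walks
  before and after the jump compare with walks to and from the identity, with constants \<open>a ^
  N v\<close> and \<open>a ^ N (v + s)\<close>. The hypothesis bounds \<open>N v + N (v +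
  s)\<close> by \<open>N s + k\<close>, so for fixed \<open>s\<close> the number of possible
  \<open>v\<close> is at most exponential in \<open>N s\<close>.
\<close>

lemma ancona_across:
  assumes cross: "\<And>v w. v \<in> V \<Longrightarrow> w \<notin> V \<Longrightarrow> N v + N w \<le> N (- v + w) + k"
    and moment: "\<And>a. a \<ge> 1 \<Longrightarrow> (\<integral>\<^sup>+ s. ennreal (a ^ N s) \<partial>\<mu>) < \<top>"
  shows "\<exists>C\<ge>0. \<forall>x z. x \<in> V \<longrightarrow> z \<notin> V \<longrightarrow> gr \<mu> x z \<le> ennreal C * (gr \<mu> x 0 * gr \<mu> 0 z)"
proof -
  define a where "a = 1 / c"
  have a1: "1 \<le> a" using c_pos c_le_1 by (simp add: a_def)
  define b where "b = real (Suc (card S)) * a"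
  have b1: "1 \<le> b" unfolding b_def using mult_mono[of 1 "real (Suc (card S))" 1 a] a1 by simp
  define I where "I = (\<integral>\<^sup>+ s. ennreal (b ^ N s) \<partial>\<mu>)"
  have I: "I < \<top>" unfolding I_def by (rule moment[OF b1])
  define C where "C = enn2real (ennreal (b ^ k) * I)"
  have C: "ennreal C = ennreal (b ^ k) * I"
    unfolding C_def using I by (simp add: ennreal_mult_less_top)
  have "gr \<mu> x z \<le> ennreal C * (gr \<mu> x 0 * gr \<mu> 0 z)" if x: "x \<in> V" and z: "z \<notin> V" for x z
  proof -
    define leave where "leave v = of_bool (v \<in> V) * (\<integral>\<^sup>+ s. of_bool (v + s \<notin> V) * gr \<mu> (v + s) z \<partial>\<mu>)" for v
    define u where "u x = (\<integral>\<^sup>+ v. gr \<mu> x v * leave v \<partial>count_space UNIV)" for x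
    have u_rec: "u x = leave x + (\<integral>\<^sup>+ s. u (x + s) \<partial>\<mu>)" for x
    proof -
      have "u x = (\<integral>\<^sup>+ v. leave v * indicator {x} v + (\<integral>\<^sup>+ s. gr \<mu> (x + s) v * leave v \<partial>\<mu>) \<partial>count_space UNIV)"
        unfolding u_def
      proof (intro nn_integral_cong)
        fix v
        have "gr \<mu> x v * leave v = of_bool (x = v) * leave v + (\<integral>\<^sup>+ s. gr \<mu> (x + s) v \<partial>\<mu>) * leave v"
          by (subst hit_rec) (simp add: distrib_right)
        moreover have "of_bool (x = v) * leave v = leave v * indicator {x} v" by (simp add: indicator_def)
        moreover have "(\<integral>\<^sup>+ s. gr \<mu> (x + s) v \<partial>\<mu>) * leave v = (\<integral>\<^sup>+ s. gr \<mu> (x + s) v * leave v \<partial>\<mu>)"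
          by (rule nn_integral_multc[symmetric]) simp
        ultimately show "gr \<mu> x v * leave v = leave v * indicator {x} v + (\<integral>\<^sup>+ s. gr \<mu> (x + s) v * leave v \<partial>\<mu>)"
          by (simp only:)
      qed
      also have "\<dots> = leave x + (\<integral>\<^sup>+ v. \<integral>\<^sup>+ s. gr \<mu> (x + s) v * leave v \<partial>\<mu> \<partial>count_space UNIV)"
        by (subst nn_integral_add) auto
      also have "(\<integral>\<^sup>+ v. \<integral>\<^sup>+ s. gr \<mu> (x + s) v * leave v \<partial>\<mu> \<partial>count_space UNIV) = (\<integral>\<^sup>+ s. u (x + s) \<partial>\<mu>)"
        unfolding u_def by (rule nn_integral_pmf_count_space_swap)
      finally show ?thesis .
    qed
    \<comment> \<open>\<open>u x\<close> is the expected contribution of all jumps out of \<open>V\<close>.\<close>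
    have part: "tsum \<mu> {} n x z \<le> u x + of_bool (x \<notin> V) * gr \<mu> x z" for n x
    proof (induction n arbitrary: x)
      case (Suc n)
      show ?case
      proof (cases "x \<in> V")
        case False
        then show ?thesis using tsum_le_hit[of \<mu> "{}" "Suc n" x z] by (simp add: add_increasing)
      next
        case True
        then have "x \<noteq> z" using z by blast
        then have "tsum \<mu> {} (Suc n) x z = (\<integral>\<^sup>+ s. tsum \<mu> {} n (x + s) z \<partial>\<mu>)" by (simp add: tsum_Suc)
        also have "\<dots> \<le> (\<integral>\<^sup>+ s. u (x + s) + of_bool (x + s \<notin> V) * gr \<mu> (x + s) z \<partial>\<mu>)"
          by (intro nn_integral_mono Suc)
        also have "\<dots> = (\<integral>\<^sup>+ s. u (x + s) \<partial>\<mu>) + leave x"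
          unfolding leave_def using True by (simp add: nn_integral_add)
        also have "\<dots> = u x" by (subst u_rec) (simp add: add.commute)
        finally show ?thesis using True by simp
      qed
    qed simp
    have ball: "(\<integral>\<^sup>+ v. of_bool (v \<in> V \<and> v + s \<notin> V) * ennreal (a ^ (N v + N (v + s))) \<partial>count_space UNIV) \<le> ennreal (b ^ k) * ennreal (b ^ N s)" for s
    proof -
      let ?m = "N s + k"
      have "of_bool (v \<in> V \<and> v + s \<notin> V) * ennreal (a ^ (N v + N (v + s))) \<le> ennreal (a ^ ?m) * indicator {v. N v \<le> ?m} v" for v
      proof (cases "v \<in> V \<and> v + s \<notin> V")
        case True
        then have "N v + N (v + s) \<le> ?m" using cross[of v "v + s"] by (simp add: add.assoc[symmetric])
        then show ?thesis using True a1 by (simp add: ennreal_leI power_increasing)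
      qed (auto simp: of_bool_def)
      then have "(\<integral>\<^sup>+ v. of_bool (v \<in> V \<and> v + s \<notin> V) * ennreal (a ^ (N v + N (v + s))) \<partial>count_space UNIV) \<le>
          (\<integral>\<^sup>+ v. ennreal (a ^ ?m) * indicator {v. N v \<le> ?m} v \<partial>count_space UNIV)"
        by (intro nn_integral_mono) auto
      also have "\<dots> = ennreal (a ^ ?m) * of_nat (card {v. N v \<le> ?m})"
        by (subst nn_integral_cmult_indicator) (auto simp: emeasure_count_space_finite finite_ball)
      also have "\<dots> = ennreal (a ^ ?m * card {v. N v \<le> ?m})"
        using a1 by (simp add: ennreal_mult ennreal_of_nat_eq_real_of_nat)
      also have "\<dots> \<le> ennreal (a ^ ?m * real (Suc (card S) ^ ?m))"
        using a1 card_ball[of ?m] by (intro ennreal_leI mult_left_mono of_nat_mono) auto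
      also have "a ^ ?m * real (Suc (card S) ^ ?m) = b ^ k * b ^ N s"
        unfolding b_def by (simp add: power_add power_mult_distrib)
      also have "ennreal (b ^ k * b ^ N s) = ennreal (b ^ k) * ennreal (b ^ N s)"
        using b1 by (intro ennreal_mult) auto
      finally show ?thesis .
    qed
    have "gr \<mu> x z \<le> u x"
      using hit_le[OF part, of x] x by simp
    also have "u x = (\<integral>\<^sup>+ v. \<integral>\<^sup>+ s. of_bool (v \<in> V \<and> v + s \<notin> V) * (gr \<mu> x v * gr \<mu> (v + s) z) \<partial>\<mu> \<partial>count_space UNIV)"
      unfolding u_def leave_def
      by (auto intro!: nn_integral_cong simp: nn_integral_cmult[symmetric] of_bool_def)
    also have "\<dots> = (\<integral>\<^sup>+ s. \<integral>\<^sup>+ v. of_bool (v \<in> V \<and> v + s \<notin> V) * (gr \<mu> x v * gr \<mu> (v + s) z) \<partial>count_space UNIV \<partial>\<mu>)"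
      by (rule nn_integral_pmf_count_space_swap)
    also have "\<dots> \<le> (\<integral>\<^sup>+ s. \<integral>\<^sup>+ v. of_bool (v \<in> V \<and> v + s \<notin> V) * ennreal (a ^ (N v + N (v + s))) * (gr \<mu> x 0 * gr \<mu> 0 z) \<partial>count_space UNIV \<partial>\<mu>)"
    proof (intro nn_integral_mono)
      fix s v
      have "gr \<mu> x v * gr \<mu> (v + s) z \<le> (ennreal (a ^ N v) * gr \<mu> x 0) * (ennreal (a ^ N (v + s)) * gr \<mu> 0 z)"
        using harnack_mult_right[of x v 0] harnack_mult_left[of "v + s" z 0]
        unfolding a_def by (intro mult_mono) auto
      also have "\<dots> = ennreal (a ^ (N v + N (v + s))) * (gr \<mu> x 0 * gr \<mu> 0 z)"
        using a1 by (simp add: power_add ennreal_mult ac_simps)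
      finally show "of_bool (v \<in> V \<and> v + s \<notin> V) * (gr \<mu> x v * gr \<mu> (v + s) z) \<le>
        of_bool (v \<in> V \<and> v + s \<notin> V) * ennreal (a ^ (N v + N (v + s))) * (gr \<mu> x 0 * gr \<mu> 0 z)"
        unfolding mult.assoc by (intro mult_left_mono) auto
    qed
    also have "\<dots> = (\<integral>\<^sup>+ s. (\<integral>\<^sup>+ v. of_bool (v \<in> V \<and> v + s \<notin> V) * ennreal (a ^ (N v + N (v + s))) \<partial>count_space UNIV) * (gr \<mu> x 0 * gr \<mu> 0 z) \<partial>\<mu>)"
      by (simp add: nn_integral_multc)
    also have "\<dots> \<le> (\<integral>\<^sup>+ s. (ennreal (b ^ k) * ennreal (b ^ N s)) * (gr \<mu> x 0 * gr \<mu> 0 z) \<partial>\<mu>)"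
      by (intro nn_integral_mono mult_right_mono ball) auto
    also have "\<dots> = ennreal C * (gr \<mu> x 0 * gr \<mu> 0 z)"
      unfolding C I_def by (simp add: nn_integral_multc nn_integral_cmult)
    finally show ?thesis .
  qed
  moreover have "C \<ge> 0" by (simp add: C_def)
  ultimately show ?thesis by blast
qed

end

section \<open>Multiscale induction under exponential decay\<close>

lemma interpolate_le:
  fixes t a b \<theta> :: real
  assumes "0 \<le> t" "t \<le> a" "t \<le> b" "0 \<le> \<theta>" "\<theta> \<le> 1"
  shows "t \<le> a powr \<theta> * b powr (1 - \<theta>)"
proof (cases "t = 0")
  case False
  then have "t = t powr \<theta> * t powr (1 - \<theta>)" using assms by (simp add: powr_add[symmetric])
  also have "\<dots> \<le> a powr \<theta> * b powr (1 - \<theta>)"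
    using assms by (intro mult_mono powr_mono2) auto
  finally show ?thesis .
qed simp

lemma ex_interpolation_exponent:
  fixes E r :: real
  assumes "1 \<le> E" "0 < r" "r < 1"
  shows "\<exists>\<theta>. 0 < \<theta> \<and> \<theta> \<le> 1 \<and> E powr \<theta> * r powr (1 - \<theta>) < 1"
proof -
  define d where "d = ln E - ln r"
  have lnr: "ln r < 0" using assms by simp
  have d: "0 < - ln r" "- ln r \<le> d" using assms lnr by (auto simp: d_def)
  define \<theta> where "\<theta> = - ln r / (2 * d)"
  have \<theta>: "0 < \<theta>" "\<theta> \<le> 1" using d by (auto simp: \<theta>_def field_simps)
  have "\<theta> * d = - ln r / 2" using d by (simp add: \<theta>_def)
  then have "\<theta> * ln E + (1 - \<theta>) * ln r < 0" using lnr by (simp add: d_def algebra_simps)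
  moreover have "E powr \<theta> * r powr (1 - \<theta>) = exp (\<theta> * ln E + (1 - \<theta>) * ln r)"
    using assms by (simp add: powr_def exp_add)
  ultimately show ?thesis using \<theta> by (intro exI[of _ \<theta>]) simp
qed

context floyd_group begin

text \<open>
  An exponential Chebyshev bound for the length of a walk that avoids the ball of radius
  \<open>n\<close>. A jump of length at most \<open>n div 2\<close> from outside the ball stays
  outside the ball of radius \<open>n div 2\<close> and so moves the walk by at most its length
  times \<open>\<beta>\<close>. Longer jumps are charged the full amount \<open>Lc\<close>;
  truncating the distance at \<open>Lc\<close> makes this admissible.
\<close>

lemma taboo_floyd_bound:
  fixes n :: nat and Lc E :: real and \<mu> :: "'a pmf"
  defines "\<beta> \<equiv> F (n div 2)"
  assumes Lc: "0 \<le> Lc"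
    and E: "(\<integral>\<^sup>+ s. ennreal (exp (if N s \<le> n div 2 then real (N s) else Lc)) \<partial>\<mu>) \<le> ennreal E"
  shows "taboo \<mu> {g. N g \<le> n} k x w \<le> ennreal (E ^ k * exp (- min Lc (D x w / \<beta>)))"
proof (induction k arbitrary: x)
  case 0
  show ?case using Lc by simp
next
  case (Suc k)
  have \<beta>: "\<beta> > 0" unfolding \<beta>_def by (rule F_pos)
  have E0: "0 \<le> E"
  proof (rule ccontr)
    assume "\<not> 0 \<le> E"
    then have "(\<integral>\<^sup>+ s. ennreal (exp (if N s \<le> n div 2 then real (N s) else Lc)) \<partial>\<mu>) = 0"
      using E by (simp add: ennreal_neg)
    moreover have "(\<integral>\<^sup>+ s. 1 \<partial>\<mu>) \<le> (\<integral>\<^sup>+ s. ennreal (exp (if N s \<le> n div 2 then real (N s) else Lc)) \<partial>\<mu>)"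
      using Lc by (intro nn_integral_mono) auto
    ultimately show False by simp
  qed
  let ?c = "\<lambda>s. if N s \<le> n div 2 then real (N s) else Lc"
  let ?\<phi> = "\<lambda>x. min Lc (D x w / \<beta>)"
  show ?case
  proof (cases "N x \<le> n")
    case True
    then show ?thesis by simp
  next
    case False
    have jump: "?\<phi> x \<le> ?c s + ?\<phi> (x + s)" for s
    proof (cases "N s \<le> n div 2")
      case True
      have "D x (x + s) \<le> N s * F (N x - N s)" by (rule D_le_mult)
      also have "\<dots> \<le> N s * \<beta>" unfolding \<beta>_def
        using True False by (intro mult_left_mono F_antimono) auto
      finally have "D x w \<le> N s * \<beta> + D (x + s) w" using D_triangle[of x w "x + s"] by linarith
      then have "D x w / \<beta> \<le> (N s * \<beta> + D (x + s) w) / \<beta>" using \<beta> by (intro divide_right_mono) auto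
      also have "\<dots> = N s + D (x + s) w / \<beta>" using \<beta> by (simp add: add_divide_distrib)
      finally show ?thesis using True by auto
    next
      case False
      have "0 \<le> D (x + s) w / \<beta>" using \<beta> by simp
      then show ?thesis using False Lc by auto
    qed
    have "taboo \<mu> {g. N g \<le> n} (Suc k) x w \<le> (\<integral>\<^sup>+ s. ennreal (E ^ k * exp (- ?\<phi> (x + s))) \<partial>\<mu>)"
      using False by (auto intro!: nn_integral_mono Suc)
    also have "\<dots> \<le> (\<integral>\<^sup>+ s. ennreal (E ^ k * exp (- ?\<phi> x)) * ennreal (exp (?c s)) \<partial>\<mu>)"
    proof (intro nn_integral_mono)
      fix s
      have "exp (- ?\<phi> (x + s)) \<le> exp (- ?\<phi> x + ?c s)" unfolding exp_le_cancel_iff using jump[of s] by linarith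
      then have "E ^ k * exp (- ?\<phi> (x + s)) \<le> E ^ k * (exp (- ?\<phi> x) * exp (?c s))"
        unfolding exp_add using E0 by (intro mult_left_mono) auto
      then have "ennreal (E ^ k * exp (- ?\<phi> (x + s))) \<le> ennreal (E ^ k * exp (- ?\<phi> x) * exp (?c s))"
        by (intro ennreal_leI) (simp only: mult.assoc)
      also have "\<dots> = ennreal (E ^ k * exp (- ?\<phi> x)) * ennreal (exp (?c s))"
        using E0 by (intro ennreal_mult) auto
      finally show "ennreal (E ^ k * exp (- ?\<phi> (x + s))) \<le> ennreal (E ^ k * exp (- ?\<phi> x)) * ennreal (exp (?c s))" .
    qed
    also have "\<dots> = ennreal (E ^ k * exp (- ?\<phi> x)) * (\<integral>\<^sup>+ s. ennreal (exp (?c s)) \<partial>\<mu>)"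
      by (rule nn_integral_cmult) simp
    also have "\<dots> \<le> ennreal (E ^ k * exp (- ?\<phi> x)) * ennreal E"
      by (intro mult_left_mono E) simp
    also have "\<dots> = ennreal (E ^ Suc k * exp (- ?\<phi> x))"
      using E0 by (simp add: ennreal_mult[symmetric] ac_simps)
    finally show ?thesis .
  qed
qed

text \<open>
  For few steps the previous bound is good, for many steps exponential decay is; interpolating
  between the two gives a geometric series in the number of steps.
\<close>

lemma hit_floyd_bound:
  fixes n :: nat and Lc E r \<theta> :: real and \<mu> :: "'a pmf"
  assumes Lc: "0 \<le> Lc"
    and E: "(\<integral>\<^sup>+ s. ennreal (exp (if N s \<le> n div 2 then real (N s) else Lc)) \<partial>\<mu>) \<le> ennreal E"
    and E1: "1 \<le> E"
    and decay: "\<And>k x z. prb \<mu> k x z \<le> ennreal (r ^ k)" and r: "0 < r"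
    and \<theta>: "0 \<le> \<theta>" "\<theta> \<le> 1" "E powr \<theta> * r powr (1 - \<theta>) < 1"
    and far: "Lc * F (n div 2) \<le> D x w"
  shows "hit \<mu> {g. N g \<le> n} x w \<le> ennreal (exp (- \<theta> * Lc) / (1 - E powr \<theta> * r powr (1 - \<theta>)))"
proof -
  let ?q = "E powr \<theta> * r powr (1 - \<theta>)"
  have q: "0 \<le> ?q" by simp
  have \<beta>: "F (n div 2) > 0" by (rule F_pos)
  have "min Lc (D x w / F (n div 2)) = Lc" using far \<beta> by (simp add: min_def pos_le_divide_eq)
  then have b1: "taboo \<mu> {g. N g \<le> n} k x w \<le> ennreal (E ^ k * exp (- Lc))" for k
    using taboo_floyd_bound[OF Lc E, of k x w] by simp
  have b2: "taboo \<mu> {g. N g \<le> n} k x w \<le> ennreal (r ^ k)" for k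
    using taboo_le_prb decay by (rule order_trans)
  have b: "taboo \<mu> {g. N g \<le> n} k x w \<le> ennreal (exp (- \<theta> * Lc) * ?q ^ k)" for k
  proof -
    have "taboo \<mu> {g. N g \<le> n} k x w < \<top>" using b2 by (rule order_le_less_trans) simp
    then obtain t where t: "taboo \<mu> {g. N g \<le> n} k x w = ennreal t" "t \<ge> 0"
      by (cases "taboo \<mu> {g. N g \<le> n} k x w") auto
    have "t \<le> E ^ k * exp (- Lc)" "t \<le> r ^ k"
      using b1[of k] b2[of k] t E1 r by simp_all
    then have "t \<le> (E ^ k * exp (- Lc)) powr \<theta> * (r ^ k) powr (1 - \<theta>)"
      using t(2) \<theta> by (intro interpolate_le) auto
    also have "(E ^ k * exp (- Lc)) powr \<theta> = (E powr \<theta>) ^ k * exp (- \<theta> * Lc)"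
      using E1 by (simp add: powr_mult powr_power powr_realpow[symmetric] powr_powr mult.commute exp_powr_real)
    also have "(r ^ k) powr (1 - \<theta>) = (r powr (1 - \<theta>)) ^ k"
      using r by (simp add: powr_power powr_realpow[symmetric] powr_powr mult.commute)
    finally have "t \<le> exp (- \<theta> * Lc) * ?q ^ k" by (simp add: power_mult_distrib ac_simps)
    then show ?thesis unfolding t by (rule ennreal_leI)
  qed
  have "hit \<mu> {g. N g \<le> n} x w \<le> (\<Sum>k. ennreal (exp (- \<theta> * Lc) * ?q ^ k))"
    unfolding hit_def by (intro suminf_le b) auto
  also have "\<dots> = ennreal (\<Sum>k. exp (- \<theta> * Lc) * ?q ^ k)"
    using q \<theta>(3) by (intro suminf_ennreal2 summable_mult summable_geometric) auto
  also have "(\<Sum>k. exp (- \<theta> * Lc) * ?q ^ k) = exp (- \<theta> * Lc) / (1 - ?q)"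
    using q \<theta>(3) by (subst suminf_mult) (auto simp: suminf_geometric summable_geometric)
  finally show ?thesis .
qed

lemma gr_le_of_decay:
  assumes decay: "\<And>k x z. prb \<mu> k x z \<le> ennreal (r ^ k)" and r: "0 < r" "r < 1"
  shows "gr \<mu> x z \<le> ennreal (1 / (1 - r))"
proof -
  have "gr \<mu> x z \<le> (\<Sum>k. ennreal (r ^ k))" unfolding hit_def by (intro suminf_le decay) auto
  also have "\<dots> = ennreal (\<Sum>k. r ^ k)" using r by (intro suminf_ennreal2 summable_geometric) auto
  also have "(\<Sum>k. r ^ k) = 1 / (1 - r)" using r by (intro suminf_geometric) auto
  finally show ?thesis .
qed

text \<open>
  First visit of the walk to the ball of radius \<open>n\<close>: the points \<open>w\<close> of
  the ball that are Floyd-far from \<open>x\<close> contribute a negligible amount, and for the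
  others the inequality is assumed, with a smaller threshold. The family \<open>W\<close> makes
  the constants \<open>M\<close> and \<open>n0\<close> common to the walk and its reversal.
\<close>

lemma ancona_one_scale:
  fixes c r :: real and m :: "real \<Rightarrow> real" and W :: "'a pmf set"
  assumes walk: "\<And>\<mu>. \<mu> \<in> W \<Longrightarrow> harnack_walk S \<mu> c"
    and decay: "\<And>\<mu> k x z. \<mu> \<in> W \<Longrightarrow> prb \<mu> k x z \<le> ennreal (r ^ k)" and r: "0 < r" "r < 1"
    and moment: "\<And>\<mu> a. \<mu> \<in> W \<Longrightarrow> 1 \<le> a \<Longrightarrow> (\<integral>\<^sup>+ s. ennreal (a ^ N s) \<partial>measure_pmf \<mu>) \<le> ennreal (m a)"
    and c: "0 < c" "c \<le> 1"
  shows "\<exists>M>0. \<exists>n0. \<forall>\<mu>\<in>W. \<forall>n\<ge>n0. \<forall>H\<ge>0. \<forall>t z. M * n * F (n div 2) \<le> t \<longrightarrow> N z \<le> 2 * n \<longrightarrow>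
      (\<forall>w. N w \<le> n \<longrightarrow> t - M * n * F (n div 2) \<le> D w z \<longrightarrow> gr \<mu> w z \<le> ennreal H * (gr \<mu> w 0 * gr \<mu> 0 z)) \<longrightarrow>
      (\<forall>x. N x \<le> 2 * n \<longrightarrow> t \<le> D x z \<longrightarrow> gr \<mu> x z \<le> ennreal (H + (1 / 2) ^ n) * (gr \<mu> x 0 * gr \<mu> 0 z))"
proof -
  define E where "E = \<bar>m (exp 1)\<bar> + 1"
  have E1: "1 \<le> E" by (simp add: E_def)
  obtain \<theta> where \<theta>: "0 < \<theta>" "\<theta> \<le> 1" "E powr \<theta> * r powr (1 - \<theta>) < 1"
    using ex_interpolation_exponent[OF E1 r] by blast
  define q where "q = E powr \<theta> * r powr (1 - \<theta>)"
  have q: "0 \<le> q" "q < 1" using \<theta> by (auto simp: q_def)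
  define b where "b = real (Suc (card S))"
  have b1: "1 \<le> b" by (simp add: b_def)
  define K where "K = 1 / (1 - q) * (1 + 1 / (1 - r))"
  have K1: "1 \<le> K"
    unfolding K_def using q r mult_mono[of 1 "1 / (1 - q)" 1 "1 + 1 / (1 - r)"] by simp
  \<comment> \<open>\<open>M\<close> is chosen so that the error, \<open>K\<close> times the size \<open>b ^
    n\<close> of the ball times \<open>exp (- \<theta> M n)\<close>, is below \<open>(1/2) ^
    n\<close> times the Harnack lower bound \<open>c ^ (4 n)\<close> for \<open>G(x,0)
    G(0,z)\<close>.\<close>
  define M where "M = (ln (2 * b * K) - 4 * ln c) / \<theta> + 1"
  have "0 \<le> ln (2 * b * K)" using b1 K1 mult_mono[of 1 b 1 K] by (intro ln_ge_zero) simp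
  moreover have "ln c \<le> 0" using c by simp
  ultimately have "0 \<le> ln (2 * b * K) - 4 * ln c" by linarith
  then have M0: "0 < M" unfolding M_def using \<theta>(1) by (intro add_nonneg_pos divide_nonneg_pos) auto
  have Mexp: "exp (- \<theta> * M) * b * K \<le> c ^ 4 / 2"
  proof -
    have "ln (2 * b * K) - 4 * ln c \<le> \<theta> * M" using \<theta>(1) by (simp add: M_def field_simps)
    then have "exp (- \<theta> * M) \<le> exp (4 * ln c - ln (2 * b * K))" by simp
    also have "\<dots> = c ^ 4 / (2 * b * K)"
      using c b1 K1 by (simp add: exp_diff exp_of_nat_mult[of 4, simplified])
    finally show ?thesis using b1 K1 by (simp add: field_simps)
  qed
  \<comment> \<open>A jump longer than \<open>n div 2\<close> costs \<open>M n \<le> 2 (M + 1) N s -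
    n\<close>, whose exponential has mean at most \<open>exp (- n) m(a)\<close>.\<close>
  define a where "a = exp (2 * (M + 1))"
  have a1: "1 \<le> a" using M0 by (simp add: a_def)
  obtain n0 where n0: "ln (1 + \<bar>m a\<bar>) \<le> real n0" using real_arch_simple by blast
  have goal: "gr \<mu> x z \<le> ennreal (H + (1 / 2) ^ n) * (gr \<mu> x 0 * gr \<mu> 0 z)"
    if \<mu>: "\<mu> \<in> W" and n: "Suc n0 \<le> n" and H: "0 \<le> H"
      and t: "M * n * F (n div 2) \<le> t" and Nz: "N z \<le> 2 * n"
      and IH: "\<And>w. N w \<le> n \<Longrightarrow> t - M * n * F (n div 2) \<le> D w z \<Longrightarrow> gr \<mu> w z \<le> ennreal H * (gr \<mu> w 0 * gr \<mu> 0 z)"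
      and Nx: "N x \<le> 2 * n" and Dxz: "t \<le> D x z"
    for \<mu> n H t z x
  proof -
    interpret harnack_walk S \<mu> c by (rule walk[OF \<mu>])
    define Lc where "Lc = M * real n"
    have Lc0: "0 \<le> Lc" using M0 by (simp add: Lc_def)
    define B where "B = {g. N g \<le> n}"
    have finB: "finite B" unfolding B_def by (rule finite_ball)
    have cost: "(\<integral>\<^sup>+ s. ennreal (exp (if N s \<le> n div 2 then real (N s) else Lc)) \<partial>\<mu>) \<le> ennreal E"
    proof -
      \<comment> \<open>Below the threshold the cost is \<open>N s\<close>; above it, \<open>2 N s \<ge>
        n\<close>.\<close>
      have pt: "ennreal (exp (if N s \<le> n div 2 then real (N s) else Lc)) \<le>
          ennreal (exp 1 ^ N s) + ennreal (exp (- real n)) * ennreal (a ^ N s)" for s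
      proof (cases "N s \<le> n div 2")
        case True
        then show ?thesis by (simp add: exp_of_nat_mult[symmetric] add_increasing2)
      next
        case False
        then have "real n \<le> 2 * real (N s)" by linarith
        then have "(M + 1) * real n \<le> (M + 1) * (2 * real (N s))" using M0 by (intro mult_left_mono) auto
        then have "Lc \<le> - real n + real (N s) * (2 * (M + 1))" by (simp add: Lc_def algebra_simps)
        then have "exp Lc \<le> exp (- real n) * a ^ N s"
          unfolding a_def exp_of_nat_mult[symmetric] exp_add[symmetric] by (simp only: exp_le_cancel_iff)
        then have "ennreal (exp Lc) \<le> ennreal (exp (- real n)) * ennreal (a ^ N s)"
          using a1 by (simp add: ennreal_mult[symmetric] ennreal_leI)
        then show ?thesis using False by (simp add: add_increasing)
      qed
      have "(\<integral>\<^sup>+ s. ennreal (exp (if N s \<le> n div 2 then real (N s) else Lc)) \<partial>\<mu>) \<le>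
          (\<integral>\<^sup>+ s. ennreal (exp 1 ^ N s) + ennreal (exp (- real n)) * ennreal (a ^ N s) \<partial>\<mu>)"
        by (intro nn_integral_mono pt)
      also have "\<dots> = (\<integral>\<^sup>+ s. ennreal (exp 1 ^ N s) \<partial>\<mu>) + ennreal (exp (- real n)) * (\<integral>\<^sup>+ s. ennreal (a ^ N s) \<partial>\<mu>)"
        by (simp add: nn_integral_add nn_integral_cmult)
      also have "\<dots> \<le> ennreal (m (exp 1)) + ennreal (exp (- real n)) * ennreal (m a)"
        by (intro add_mono mult_left_mono moment \<mu> a1) auto
      also have "\<dots> \<le> ennreal \<bar>m (exp 1)\<bar> + ennreal (exp (- real n)) * ennreal \<bar>m a\<bar>"
        by (intro add_mono mult_left_mono ennreal_leI) auto
      also have "ennreal (exp (- real n)) * ennreal \<bar>m a\<bar> \<le> ennreal 1"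
      proof -
        have "1 + \<bar>m a\<bar> = exp (ln (1 + \<bar>m a\<bar>))" by (intro exp_ln[symmetric]) simp
        also have "\<dots> \<le> exp (real n)" unfolding exp_le_cancel_iff using n0 n by linarith
        finally have "\<bar>m a\<bar> \<le> exp (real n)" by simp
        then have "exp (- real n) * \<bar>m a\<bar> \<le> 1" by (simp add: exp_minus field_simps)
        then show ?thesis by (simp only: ennreal_mult[symmetric] exp_ge_zero abs_ge_zero ennreal_leI)
      qed
      also have "ennreal \<bar>m (exp 1)\<bar> + ennreal 1 = ennreal E"
        unfolding E_def by (rule ennreal_plus[symmetric]) auto
      finally show ?thesis by (simp add: add_left_mono)
    qed
    have bad: "hit \<mu> B u w \<le> ennreal (exp (- \<theta> * Lc) / (1 - q))" if "M * n * F (n div 2) \<le> D u w" for u w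
      unfolding B_def q_def
      by (rule hit_floyd_bound[OF Lc0 cost E1 decay[OF \<mu>] r(1)]) (use \<theta> that in \<open>auto simp: Lc_def\<close>)
    have grle: "gr \<mu> u w \<le> ennreal (1 / (1 - r))" for u w
      by (rule gr_le_of_decay[OF decay[OF \<mu>] r])
    define \<delta> where "\<delta> = exp (- \<theta> * Lc) / (1 - q)"
    have \<delta>0: "0 \<le> \<delta>" using q by (simp add: \<delta>_def)
    have "gr \<mu> x z \<le> (if z \<in> B then 0 else hit \<mu> B x z) + (\<Sum>w\<in>B. hit \<mu> B x w * gr \<mu> w z)"
      by (rule gr_le_hit_decomposition[OF finB])
    also have "(if z \<in> B then 0 else hit \<mu> B x z) \<le> ennreal \<delta>"
      using bad[of x z] t Dxz unfolding \<delta>_def by auto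
    also have "(\<Sum>w\<in>B. hit \<mu> B x w * gr \<mu> w z) \<le>
       (\<Sum>w\<in>B. ennreal H * (hit \<mu> B x w * gr \<mu> w 0) * gr \<mu> 0 z + ennreal \<delta> * ennreal (1 / (1 - r)))"
    proof (rule sum_mono)
      fix w assume "w \<in> B"
      show "hit \<mu> B x w * gr \<mu> w z \<le> ennreal H * (hit \<mu> B x w * gr \<mu> w 0) * gr \<mu> 0 z + ennreal \<delta> * ennreal (1 / (1 - r))"
      proof (cases "M * n * F (n div 2) \<le> D x w")
        case True
        have "hit \<mu> B x w * gr \<mu> w z \<le> ennreal \<delta> * ennreal (1 / (1 - r))"
          using bad[OF True] grle[of w z] unfolding \<delta>_def by (intro mult_mono) auto
        then show ?thesis by (rule add_increasing[OF zero_le])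
      next
        case False
        have "t - M * n * F (n div 2) \<le> D w z" using False Dxz D_triangle[of x z w] by linarith
        then have "gr \<mu> w z \<le> ennreal H * (gr \<mu> w 0 * gr \<mu> 0 z)" using IH[of w] \<open>w \<in> B\<close> by (simp add: B_def)
        then have "hit \<mu> B x w * gr \<mu> w z \<le> hit \<mu> B x w * (ennreal H * (gr \<mu> w 0 * gr \<mu> 0 z))"
          by (rule mult_left_mono) simp
        also have "\<dots> = ennreal H * (hit \<mu> B x w * gr \<mu> w 0) * gr \<mu> 0 z" by (simp only: ac_simps)
        finally show ?thesis by (rule add_increasing2[OF zero_le])
      qed
    qed
    also have "\<dots> = ennreal H * (\<Sum>w\<in>B. hit \<mu> B x w * gr \<mu> w 0) * gr \<mu> 0 z + of_nat (card B) * (ennreal \<delta> * ennreal (1 / (1 - r)))"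
      by (simp add: sum.distrib sum_distrib_left sum_distrib_right)
    also have "\<dots> \<le> ennreal H * gr \<mu> x 0 * gr \<mu> 0 z + ennreal (b ^ n) * (ennreal \<delta> * ennreal (1 / (1 - r)))"
    proof (intro add_mono mult_right_mono mult_left_mono hit_decomposition_le_gr finB)
      have "real (card B) \<le> b ^ n" using card_ball[of n] unfolding B_def b_def
        by (metis of_nat_mono of_nat_power)
      then show "of_nat (card B) \<le> ennreal (b ^ n)"
        by (simp add: ennreal_of_nat_eq_real_of_nat ennreal_leI)
    qed auto
    also have "ennreal \<delta> + (ennreal H * gr \<mu> x 0 * gr \<mu> 0 z + ennreal (b ^ n) * (ennreal \<delta> * ennreal (1 / (1 - r)))) =
       ennreal H * gr \<mu> x 0 * gr \<mu> 0 z + (ennreal \<delta> + ennreal (b ^ n) * (ennreal \<delta> * ennreal (1 / (1 - r))))"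
      by (simp only: ac_simps)
    also have "ennreal \<delta> + ennreal (b ^ n) * (ennreal \<delta> * ennreal (1 / (1 - r))) = ennreal (\<delta> + b ^ n * (\<delta> * (1 / (1 - r))))"
    proof -
      have p: "0 \<le> 1 / (1 - r)" "0 \<le> b ^ n" using r b1 by auto
      have e1: "ennreal (\<delta> * (1 / (1 - r))) = ennreal \<delta> * ennreal (1 / (1 - r))"
        by (rule ennreal_mult[OF \<delta>0 p(1)])
      have e2: "ennreal (b ^ n * (\<delta> * (1 / (1 - r)))) = ennreal (b ^ n) * ennreal (\<delta> * (1 / (1 - r)))"
        by (rule ennreal_mult[OF p(2) mult_nonneg_nonneg[OF \<delta>0 p(1)]])
      show ?thesis unfolding e1[symmetric] e2[symmetric]
        by (rule ennreal_plus[symmetric, OF \<delta>0 mult_nonneg_nonneg[OF p(2) mult_nonneg_nonneg[OF \<delta>0 p(1)]]])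
    qed
    also have "\<dots> \<le> ennreal ((1 / 2) ^ n * (c ^ N x * c ^ N z))"
    proof (rule ennreal_leI)
      have bn: "1 \<le> b ^ n" using b1 by simp
      have "\<delta> + b ^ n * (\<delta> * (1 / (1 - r))) \<le> b ^ n * \<delta> + b ^ n * (\<delta> * (1 / (1 - r)))"
        using mult_right_mono[OF bn \<delta>0] by simp
      also have "\<dots> = exp (- \<theta> * Lc) * b ^ n * K"
        unfolding \<delta>_def K_def by (simp add: algebra_simps add_divide_distrib)
      also have "\<dots> \<le> exp (- \<theta> * Lc) * b ^ n * K ^ n"
        using b1 K1 n by (intro mult_left_mono self_le_power) auto
      also have "exp (- \<theta> * Lc) = exp (- \<theta> * M) ^ n"
        by (simp add: Lc_def exp_of_nat_mult[symmetric] ac_simps)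
      also have "exp (- \<theta> * M) ^ n * b ^ n * K ^ n = (exp (- \<theta> * M) * b * K) ^ n" by (simp add: power_mult_distrib)
      also have "\<dots> \<le> (c ^ 4 / 2) ^ n" using b1 K1 by (intro power_mono Mexp) auto
      also have "\<dots> = (1 / 2) ^ n * (c ^ (2 * n) * c ^ (2 * n))"
        by (simp add: power_divide power_mult[symmetric] power_add[symmetric])
      also have "\<dots> \<le> (1 / 2) ^ n * (c ^ N x * c ^ N z)"
        using c Nx Nz by (intro mult_left_mono mult_mono power_decreasing) auto
      finally show "\<delta> + b ^ n * (\<delta> * (1 / (1 - r))) \<le> (1 / 2) ^ n * (c ^ N x * c ^ N z)" .
    qed
    also have "\<dots> = ennreal ((1 / 2) ^ n) * (ennreal (c ^ N x) * ennreal (c ^ N z))"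
      using c by (simp add: ennreal_mult)
    also have "\<dots> \<le> ennreal ((1 / 2) ^ n) * (gr \<mu> x 0 * gr \<mu> 0 z)"
      by (intro mult_left_mono mult_mono gr_to_0_ge gr_from_0_ge) auto
    also have "ennreal H * gr \<mu> x 0 * gr \<mu> 0 z + ennreal ((1 / 2) ^ n) * (gr \<mu> x 0 * gr \<mu> 0 z) = ennreal (H + (1 / 2) ^ n) * (gr \<mu> x 0 * gr \<mu> 0 z)"
      using H by (simp add: ennreal_plus distrib_right mult.assoc)
    finally show ?thesis by (simp add: add_left_mono add_right_mono add_mono)
  qed
  show ?thesis
    by (intro exI[of _ M] exI[of _ "Suc n0"] conjI M0 ballI allI impI) (rule goal, auto)
qed


text \<open>
  The inequality at scale \<open>2n\<close> follows from that at scale \<open>n\<close> in two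
  applications of the previous lemma: first for the reversed walk, which moves the end point
  \<open>z\<close>, then for the walk itself, which moves \<open>x\<close>. The constants \<open>H
  k\<close> stay bounded and the thresholds \<open>T k\<close> stay below \<open>t\<close>.
\<close>

lemma ancona_of_decay:
  fixes c r :: real and m :: "real \<Rightarrow> real"
  assumes walk: "harnack_walk S \<mu> c"
    and decay: "\<And>k x z. prb \<mu> k x z \<le> ennreal (r ^ k)" and r: "0 < r" "r < 1"
    and moment: "\<And>a. 1 \<le> a \<Longrightarrow> (\<integral>\<^sup>+ s. ennreal (a ^ N s) \<partial>\<mu>) \<le> ennreal (m a)"
    and t: "0 < t"
  shows "\<exists>C\<ge>0. \<forall>x z. t \<le> D x z \<longrightarrow> gr \<mu> x z \<le> ennreal C * (gr \<mu> x 0 * gr \<mu> 0 z)"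
proof -
  interpret harnack_walk S \<mu> c by (rule walk)
  let ?\<nu> = "map_pmf uminus \<mu>"
  have walk': "harnack_walk S ?\<nu> c"
  proof
    show "ennreal (c ^ N (- x + y)) * gr ?\<nu> y z \<le> gr ?\<nu> x z" for x y z
      using harnack_right[of z y x] N_dist_commute[of x y] by (simp add: gr_reversed mult.commute)
    show "gr ?\<nu> x y * ennreal (c ^ N (- y + z)) \<le> gr ?\<nu> x z" for x y z
      using harnack_left[of z y x] N_dist_commute[of z y] by (simp add: gr_reversed mult.commute)
  qed (use c_pos c_le_1 gr_finite_0 in \<open>simp_all add: gr_reversed\<close>)
  have "\<exists>M>0. \<exists>n0. \<forall>\<mu>\<in>{\<mu>, ?\<nu>}. \<forall>n\<ge>n0. \<forall>H\<ge>0. \<forall>t z. M * n * F (n div 2) \<le> t \<longrightarrow> N z \<le> 2 * n \<longrightarrow>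
      (\<forall>w. N w \<le> n \<longrightarrow> t - M * n * F (n div 2) \<le> D w z \<longrightarrow> gr \<mu> w z \<le> ennreal H * (gr \<mu> w 0 * gr \<mu> 0 z)) \<longrightarrow>
      (\<forall>x. N x \<le> 2 * n \<longrightarrow> t \<le> D x z \<longrightarrow> gr \<mu> x z \<le> ennreal (H + (1 / 2) ^ n) * (gr \<mu> x 0 * gr \<mu> 0 z))"
      (is "\<exists>M>0. \<exists>n0. ?step M n0")
    by (rule ancona_one_scale[where c = c and r = r and m = m])
       (use walk walk' decay moment r c_pos c_le_1 in \<open>auto simp: prb_reversed\<close>)
  then obtain M n0 where M: "M > 0" and step: "?step M n0" by blast
  have forward: "gr \<mu> x z \<le> ennreal (H + (1 / 2) ^ n) * (gr \<mu> x 0 * gr \<mu> 0 z)"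
    if "n0 \<le> n" "0 \<le> H" "M * real n * F (n div 2) \<le> t" "N z \<le> 2 * n"
      "\<And>w. N w \<le> n \<Longrightarrow> t - M * real n * F (n div 2) \<le> D w z \<Longrightarrow> gr \<mu> w z \<le> ennreal H * (gr \<mu> w 0 * gr \<mu> 0 z)"
      "N x \<le> 2 * n" "t \<le> D x z" for n H t z x
    using bspec[OF step, of \<mu>] that by simp
  have backward: "gr \<mu> w z \<le> ennreal (H + (1 / 2) ^ n) * (gr \<mu> w 0 * gr \<mu> 0 z)"
    if "n0 \<le> n" "0 \<le> H" "M * real n * F (n div 2) \<le> t" "N w \<le> 2 * n"
      "\<And>x. N x \<le> n \<Longrightarrow> t - M * real n * F (n div 2) \<le> D w x \<Longrightarrow> gr \<mu> w x \<le> ennreal H * (gr \<mu> w 0 * gr \<mu> 0 x)"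
      "N z \<le> 2 * n" "t \<le> D w z" for n H t z w
  proof -
    have hyp: "gr ?\<nu> x w \<le> ennreal H * (gr ?\<nu> x 0 * gr ?\<nu> 0 w)" if "N x \<le> n" "t - M * real n * F (n div 2) \<le> D x w" for x
      using \<open>\<And>x. N x \<le> n \<Longrightarrow> t - M * real n * F (n div 2) \<le> D w x \<Longrightarrow> _ x\<close>[OF that(1)] that(2) D_commute[of w x]
      by (simp add: gr_reversed mult.commute)
    have "gr ?\<nu> z w \<le> ennreal (H + (1 / 2) ^ n) * (gr ?\<nu> z 0 * gr ?\<nu> 0 w)"
      using bspec[OF step, of ?\<nu>] that(1-4,6,7) hyp D_commute[of w z] by simp
    then show ?thesis by (simp add: gr_reversed mult.commute)
  qed
  define eps where "eps k = M * real (2 ^ k) * F (2 ^ k div 2)" for k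
  have eps0: "0 \<le> eps k" for k using M by (simp add: eps_def)
  have "summable F \<longleftrightarrow> summable (\<lambda>k. 2 ^ k * F (2 ^ k))"
    by (rule condensation_test) (auto intro: F_antimono simp del: of_nat_Suc)
  then have "summable (\<lambda>k. 2 ^ k * F (2 ^ k))" using F_summable by (simp only:)
  then have "summable (\<lambda>k. 2 * M * (2 ^ k * F (2 ^ k)))" by (rule summable_mult)
  moreover have "eps (Suc k) = 2 * M * (2 ^ k * F (2 ^ k))" for k by (simp add: eps_def)
  ultimately have "summable (\<lambda>k. eps (Suc k))" by simp
  then have eps_summable: "summable eps" by (simp only: summable_Suc_iff)
  obtain k2 where k2: "\<And>k. k \<ge> k2 \<Longrightarrow> norm (\<Sum>i. eps (i + k)) < t / 4"
    using suminf_exist_split[OF _ eps_summable, of "t / 4"] t by auto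
  define k1 where "k1 = k2 + n0"
  have sum_eps: "(\<Sum>i<k. eps (i + k1)) \<le> t / 4" for k
  proof -
    have "(\<Sum>i<k. eps (i + k1)) \<le> (\<Sum>i. eps (i + k1))"
      using eps0 eps_summable by (intro sum_le_suminf) (auto simp: summable_iff_shift)
    then show ?thesis using k2[of k1] by (simp add: k1_def)
  qed
  have n0_le: "n0 \<le> 2 ^ (k + k1)" for k
  proof -
    have "n0 \<le> k + k1" by (simp add: k1_def)
    also have "\<dots> \<le> 2 ^ (k + k1)" by (rule less_imp_le[OF less_exp])
    finally show ?thesis .
  qed
  define H0 where "H0 = (1 / c) ^ (2 * 2 ^ k1)"
  have H0: "0 \<le> H0" using c_pos by (simp add: H0_def)
  define H where "H k = H0 + 2 * (\<Sum>i<k. (1 / 2 :: real) ^ i)" for k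
  define T where "T k = t / 2 + 2 * (\<Sum>i<k. eps (i + k1))" for k
  have H_nonneg: "0 \<le> H k" for k unfolding H_def using H0 by (intro add_nonneg_nonneg mult_nonneg_nonneg sum_nonneg) auto
  have T_nonneg: "0 \<le> T k" for k unfolding T_def using t eps0 by (intro add_nonneg_nonneg mult_nonneg_nonneg sum_nonneg) auto
  have scale: "gr \<mu> x z \<le> ennreal (H k) * (gr \<mu> x 0 * gr \<mu> 0 z)"
    if "N x \<le> 2 ^ (k + k1)" "N z \<le> 2 ^ (k + k1)" "T k \<le> D x z" for k x z
    using that
  proof (induction k arbitrary: x z)
    case 0
    then show ?case using ancona_near[of x "2 ^ k1" z] by (simp add: H_def H0_def)
  next
    case (Suc k)
    let ?n = "2 ^ (k + k1) :: nat"
    let ?e = "eps (k + k1)"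
    have e: "M * real ?n * F (?n div 2) = ?e" by (simp add: eps_def)
    have half: "(1 / 2 :: real) ^ ?n \<le> (1 / 2) ^ k"
    proof (rule power_decreasing)
      have "k \<le> k + k1" by simp
      also have "\<dots> \<le> ?n" by (rule less_imp_le[OF less_exp])
      finally show "k \<le> ?n" .
    qed auto
    have mid: "gr \<mu> w z \<le> ennreal (H k + (1 / 2) ^ ?n) * (gr \<mu> w 0 * gr \<mu> 0 z)"
      if w: "N w \<le> ?n" "T k + ?e \<le> D w z" for w
    proof (rule backward[OF n0_le H_nonneg])
      show "M * real ?n * F (?n div 2) \<le> T k + ?e" unfolding e using T_nonneg[of k] by simp
      show "N w \<le> 2 * ?n" using w by simp
      show "N z \<le> 2 * ?n" using Suc.prems by simp
      show "T k + ?e \<le> D w z" by (rule w)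
      show "gr \<mu> w x \<le> ennreal (H k) * (gr \<mu> w 0 * gr \<mu> 0 x)"
        if "N x \<le> ?n" "T k + ?e - M * real ?n * F (?n div 2) \<le> D w x" for x
        using that w unfolding e by (intro Suc.IH) auto
    qed
    have "gr \<mu> x z \<le> ennreal (H k + (1 / 2) ^ ?n + (1 / 2) ^ ?n) * (gr \<mu> x 0 * gr \<mu> 0 z)"
    proof (rule forward[OF n0_le])
      show "0 \<le> H k + (1 / 2) ^ ?n" using H_nonneg[of k] by simp
      show "M * real ?n * F (?n div 2) \<le> T (Suc k)" unfolding e using T_nonneg[of k] eps0[of "k + k1"] by (simp add: T_def)
      show "N z \<le> 2 * ?n" "N x \<le> 2 * ?n" using Suc.prems by simp_all
      show "T (Suc k) \<le> D x z" by (rule Suc.prems)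
      show "gr \<mu> w z \<le> ennreal (H k + (1 / 2) ^ ?n) * (gr \<mu> w 0 * gr \<mu> 0 z)"
        if "N w \<le> ?n" "T (Suc k) - M * real ?n * F (?n div 2) \<le> D w z" for w
        using that unfolding e by (intro mid) (auto simp: T_def)
    qed
    also have "\<dots> \<le> ennreal (H (Suc k)) * (gr \<mu> x 0 * gr \<mu> 0 z)"
      using half by (intro mult_right_mono ennreal_leI) (auto simp: H_def)
    finally show ?case .
  qed
  have "gr \<mu> x z \<le> ennreal (H0 + 4) * (gr \<mu> x 0 * gr \<mu> 0 z)" if "t \<le> D x z" for x z
  proof -
    define k where "k = N x + N z"
    have "k \<le> k + k1" by simp
    also have "\<dots> \<le> 2 ^ (k + k1)" by (rule less_imp_le[OF less_exp])
    finally have xz: "N x \<le> 2 ^ (k + k1)" "N z \<le> 2 ^ (k + k1)" by (auto simp: k_def)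
    have "T k \<le> D x z" using sum_eps[of k] that by (simp add: T_def)
    from scale[OF xz this] have "gr \<mu> x z \<le> ennreal (H k) * (gr \<mu> x 0 * gr \<mu> 0 z)" .
    also have "\<dots> \<le> ennreal (H0 + 4) * (gr \<mu> x 0 * gr \<mu> 0 z)"
    proof (intro mult_right_mono ennreal_leI)
      have "(\<Sum>i<k. (1 / 2 :: real) ^ i) \<le> (\<Sum>i. (1 / 2) ^ i)"
        by (intro sum_le_suminf summable_geometric) auto
      also have "\<dots> = 2" by (subst suminf_geometric) auto
      finally show "H k \<le> H0 + 4" by (simp add: H_def)
    qed simp
    finally show ?thesis .
  qed
  then show ?thesis using H0 by (intro exI[of _ "H0 + 4"]) auto
qed

lemma ancona_inequality:
  assumes gen: "generated_semigroup (set_pmf \<mu>) = UNIV"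
    and fin: "gr \<mu> 0 0 < \<top>"
    and moment: "\<And>a. 1 \<le> a \<Longrightarrow> (\<integral>\<^sup>+ s. ennreal (a ^ N s) \<partial>\<mu>) < \<top>"
    and t: "0 < t"
  shows "\<exists>C\<ge>0. \<forall>x z. t \<le> D x z \<longrightarrow> gr \<mu> x z \<le> ennreal C * (gr \<mu> x 0 * gr \<mu> 0 z)"
proof -
  obtain c where "c > 0" "c \<le> 1" "\<forall>x y z. ennreal (c ^ N (- x + y)) * gr \<mu> y z \<le> gr \<mu> x z"
    "\<forall>x y z. gr \<mu> x y * ennreal (c ^ N (- y + z)) \<le> gr \<mu> x z"
    using ex_harnack[OF gen] by blast
  then interpret harnack_walk S \<mu> c using fin by unfold_locales auto
  show ?thesis
  proof (cases rule: floyd_trichotomy)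
    case small
    from small[OF t] obtain R where R: "\<And>x z. t \<le> D x z \<Longrightarrow> N x \<le> R \<or> N z \<le> R" by blast
    show ?thesis
      using ancona_near[OF R] c_pos by (intro exI[of _ "(1 / c) ^ (2 * R)"]) auto
  next
    case (paradoxical P Q Y A B)
    obtain r where r: "0 < r" "r < 1" "\<And>n x z. prb (lazy \<mu>) n x z \<le> ennreal (r ^ n)"
      using exponential_decay[OF gen paradoxical] by blast
    have lazy: "gr (lazy \<mu>) x z = 2 * gr \<mu> x z" for x z by (rule gr_lazy) (rule gr_finite)
    have walk: "harnack_walk S (lazy \<mu>) c"
    proof
      show "ennreal (c ^ N (- x + y)) * gr (lazy \<mu>) y z \<le> gr (lazy \<mu>) x z" for x y z
        using mult_left_mono[OF harnack_left[of x y z], of 2] by (simp add: lazy ac_simps)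
      show "gr (lazy \<mu>) x y * ennreal (c ^ N (- y + z)) \<le> gr (lazy \<mu>) x z" for x y z
        using mult_left_mono[OF harnack_right[of x y z], of 2] by (simp add: lazy ac_simps)
    qed (use c_pos c_le_1 fin in \<open>simp_all add: lazy ennreal_mult_less_top\<close>)
    define m where "m a = enn2real (\<integral>\<^sup>+ s. ennreal (a ^ N s) \<partial>lazy \<mu>)" for a
    have "ennreal (1/2) < \<top>" by (rule ennreal_less_top)
    then have half: "inverse 2 < (\<top> :: ennreal)" by simp
    have m: "(\<integral>\<^sup>+ s. ennreal (a ^ N s) \<partial>lazy \<mu>) \<le> ennreal (m a)" if "1 \<le> a" for a
      unfolding m_def nn_integral_lazy using moment[OF that]
      by (subst ennreal_enn2real) (auto simp: ennreal_mult_less_top half)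
    obtain C where C: "C \<ge> 0" "\<And>x z. t \<le> D x z \<Longrightarrow>
        gr (lazy \<mu>) x z \<le> ennreal C * (gr (lazy \<mu>) x 0 * gr (lazy \<mu>) 0 z)"
      using ancona_of_decay[OF walk r(3) r(1,2) m t] by blast
    have "gr \<mu> x z \<le> ennreal (4 * C) * (gr \<mu> x 0 * gr \<mu> 0 z)" if "t \<le> D x z" for x z
    proof -
      have "gr \<mu> x z \<le> 2 * gr \<mu> x z" by (simp add: mult_2)
      also have "\<dots> \<le> ennreal C * ((2 * gr \<mu> x 0) * (2 * gr \<mu> 0 z))" using C(2)[OF that] by (simp only: lazy)
      also have "\<dots> = ennreal (4 * C) * (gr \<mu> x 0 * gr \<mu> 0 z)"
      proof -
        have "ennreal C * ((2 * gr \<mu> x 0) * (2 * gr \<mu> 0 z)) = (2 * 2) * (ennreal C * (gr \<mu> x 0 * gr \<mu> 0 z))"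
          by (simp only: ac_simps)
        also have "\<dots> = (4 * ennreal C) * (gr \<mu> x 0 * gr \<mu> 0 z)" by (simp add: mult.assoc)
        also have "4 * ennreal C = ennreal (4 * C)" using C(1) by (simp add: ennreal_mult)
        finally show ?thesis .
      qed
      finally show ?thesis .
    qed
    then show ?thesis using C(1) by (intro exI[of _ "4 * C"]) auto
  next
    case (two_ended V k)
    have cross: "N v + N w \<le> N (- v + w) + k" if "v \<in> V" "w \<notin> V" for v w
      using two_ended that unfolding two_ended_by_def by blast
    have cross': "N v + N w \<le> N (- v + w) + k" if "v \<in> - V" "w \<notin> - V" for v w
      using cross[of w v] that N_dist_commute[of v w] by simp
    obtain C1 where C1: "C1 \<ge> 0" "\<And>x z. x \<in> V \<Longrightarrow> z \<notin> V \<Longrightarrow> gr \<mu> x z \<le> ennreal C1 * (gr \<mu> x 0 * gr \<mu> 0 z)"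
      using ancona_across[OF cross moment] by blast
    obtain C2 where C2: "C2 \<ge> 0" "\<And>x z. x \<in> - V \<Longrightarrow> z \<notin> - V \<Longrightarrow> gr \<mu> x z \<le> ennreal C2 * (gr \<mu> x 0 * gr \<mu> 0 z)"
      using ancona_across[OF cross' moment] by blast
    obtain R where R: "\<And>x z. (x \<in> V \<longleftrightarrow> z \<in> V) \<Longrightarrow> t \<le> D x z \<Longrightarrow> N x \<le> R \<or> N z \<le> R"
      using two_ended t unfolding two_ended_by_def by blast
    define C where "C = C1 + C2 + (1 / c) ^ (2 * R)"
    have C: "0 \<le> C" "C1 \<le> C" "C2 \<le> C" "(1 / c) ^ (2 * R) \<le> C" using C1(1) C2(1) c_pos by (auto simp: C_def)
    have "gr \<mu> x z \<le> ennreal C * (gr \<mu> x 0 * gr \<mu> 0 z)" if "t \<le> D x z" for x z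
    proof -
      have up: "gr \<mu> x z \<le> ennreal C * (gr \<mu> x 0 * gr \<mu> 0 z)"
        if "gr \<mu> x z \<le> ennreal C' * (gr \<mu> x 0 * gr \<mu> 0 z)" "C' \<le> C" for C'
        using that(1) by (rule order_trans) (intro mult_right_mono ennreal_leI that(2), simp)
      consider "x \<in> V \<longleftrightarrow> z \<in> V" | "x \<in> V" "z \<notin> V" | "x \<notin> V" "z \<in> V" by blast
      then show ?thesis
      proof cases
        case 1
        then show ?thesis using up[OF ancona_near[OF R] C(4)] \<open>t \<le> D x z\<close> by simp
      next
        case 2
        then show ?thesis using up[OF C1(2) C(2)] by simp
      next
        case 3
        then show ?thesis using up[OF C2(2) C(3)] by simp
      qed
    qed
    then show ?thesis using C(1) by blast
  qed
qed

end

section \<open>Conclusion\<close>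

lemma exponential_moments:
  assumes "finite (set_pmf \<mu>) \<or> superexponential_moment S \<mu>" and "1 \<le> a"
  shows "(\<integral>\<^sup>+ s. ennreal (a ^ word_norm S s) \<partial>\<mu>) < \<top>"
  using assms(1)
proof
  assume "finite (set_pmf \<mu>)"
  then show ?thesis
    by (simp add: nn_integral_measure_pmf_finite ennreal_mult_less_top)
next
  assume "superexponential_moment S \<mu>"
  then have "(\<lambda>g. (a + 1) ^ word_norm S g * pmf \<mu> g) summable_on UNIV"
    using assms(2) unfolding superexponential_moment_def by auto
  then have "(\<lambda>g. norm ((a + 1) ^ word_norm S g * pmf \<mu> g)) summable_on UNIV"
    by (rule summable_on_iff_abs_summable_on_real[THEN iffD1])
  then have "integrable (count_space UNIV) (\<lambda>g. (a + 1) ^ word_norm S g * pmf \<mu> g)"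
    unfolding abs_summable_on_def[symmetric] by (rule abs_summable_equivalent[THEN iffD1])
  then have fin: "(\<integral>\<^sup>+ g. ennreal ((a + 1) ^ word_norm S g * pmf \<mu> g) \<partial>count_space UNIV) < \<top>"
    using assms(2) by (simp add: integrable_iff_bounded)
  have "(\<integral>\<^sup>+ s. ennreal (a ^ word_norm S s) \<partial>\<mu>) \<le>
      (\<integral>\<^sup>+ g. ennreal ((a + 1) ^ word_norm S g * pmf \<mu> g) \<partial>count_space UNIV)"
    unfolding nn_integral_measure_pmf
  proof (rule nn_integral_mono)
    fix g
    have "a ^ word_norm S g * pmf \<mu> g \<le> (a + 1) ^ word_norm S g * pmf \<mu> g"
      using assms(2) by (intro mult_right_mono power_mono) auto
    then show "ennreal (pmf \<mu> g) * ennreal (a ^ word_norm S g) \<le> ennreal ((a + 1) ^ word_norm S g * pmf \<mu> g)"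
      using assms(2) by (simp add: ennreal_mult[symmetric] mult.commute ennreal_leI)
  qed
  then show ?thesis using fin by (rule order_le_less_trans)
qed

lemma green_eq:
  assumes "gr \<mu> x z < \<top>"
  shows "gr \<mu> x z = ennreal (green \<mu> x z)"
proof -
  have nonneg: "0 \<le> transition_prob \<mu> n x z" for n by (simp add: transition_prob_def)
  have eq: "gr \<mu> x z = (\<Sum>n. ennreal (transition_prob \<mu> n x z))"
    by (simp add: hit_def prb_eq_pmf transition_prob_def)
  then have "summable (\<lambda>n. transition_prob \<mu> n x z)"
    using assms nonneg by (intro summable_suminf_not_top) auto
  then show ?thesis unfolding eq green_def using nonneg by (intro suminf_ennreal2)
qed

theorem theorem1p1:
  fixes S :: "'a::group_add set" and f :: "real \<Rightarrow> real" and \<mu> :: "'a pmf"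
  assumes "infinite (UNIV :: 'a set)"
    and "finite_symmetric_generating_set S"
    and "floyd_function f"
    and "generated_semigroup (set_pmf \<mu>) = UNIV"
    and "transient \<mu>"
    and "finite (set_pmf \<mu>) \<or>
         (superexponential_moment S \<mu> \<and>
          (\<exists>\<alpha>::real. \<alpha> > 0 \<and> ((\<lambda>x. x powr (2 + \<alpha>) * f x) \<longlongrightarrow> 0) at_top))"
  shows "\<exists>A :: real \<Rightarrow> real.
           (\<forall>t>0. A t > 0) \<and> strict_antimono_on {0<..} A \<and>
           (\<forall>x y z. x \<noteq> z \<longrightarrow>
              green_dist \<mu> x y + green_dist \<mu> y z
                \<le> green_dist \<mu> x z + A (floyd_dist S f y x z))"
proof -
  interpret floyd_group S f using assms(2,3) by unfold_locales
  have moment: "\<And>a. 1 \<le> a \<Longrightarrow> (\<integral>\<^sup>+ s. ennreal (a ^ N s) \<partial>\<mu>) < \<top>"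
    using assms(6) by (intro exponential_moments) auto
  have fin: "gr \<mu> 0 0 < \<top>" by (rule transient_imp_gr_finite[OF countable_UNIV_group assms(5)])
  obtain c where "c > 0" "c \<le> 1" "\<forall>x y z. ennreal (c ^ N (- x + y)) * gr \<mu> y z \<le> gr \<mu> x z"
    "\<forall>x y z. gr \<mu> x y * ennreal (c ^ N (- y + z)) \<le> gr \<mu> x z"
    using ex_harnack[OF assms(4)] by blast
  then interpret harnack_walk S \<mu> c using fin by unfold_locales auto
  have green: "gr \<mu> x z = ennreal (green \<mu> x z)" for x z by (rule green_eq[OF gr_finite])
  have green_pos: "0 < green \<mu> x z" for x z
  proof -
    have "0 < ennreal (c ^ N (- x + z)) * gr \<mu> z z"
      using c_pos hit_refl[of \<mu> "{}" z] by (auto simp: ennreal_zero_less_mult_iff intro: order_less_le_trans[of 0 1])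
    also have "\<dots> \<le> gr \<mu> x z" by (rule harnack_left)
    finally show ?thesis by (simp add: green)
  qed
  define gap where "gap x y z = green_dist \<mu> x y + green_dist \<mu> y z - green_dist \<mu> x z" for x y z
  have gap_bound: "\<exists>K. \<forall>x y z. t \<le> floyd_dist S f y x z \<longrightarrow> gap x y z \<le> K" if t: "t > 0" for t
  proof -
    obtain C where C: "C \<ge> 0" "\<And>x z. t \<le> D x z \<Longrightarrow> gr \<mu> x z \<le> ennreal C * (gr \<mu> x 0 * gr \<mu> 0 z)"
      using ancona_inequality[OF assms(4) fin moment t] by blast
    define C' where "C' = max C 1"
    have "gap x y z \<le> ln (C' * green \<mu> 0 0)" if far: "t \<le> floyd_dist S f y x z" for x y z
    proof -
      have "t \<le> D (- y + x) (- y + z)" using far by (simp only: floyd_dist_translate)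
      from C(2)[OF this] have "gr \<mu> x z \<le> ennreal C * (gr \<mu> x y * gr \<mu> y z)"
        using gr_translate[of \<mu> "- y" x z] gr_translate[of \<mu> "- y" x y] gr_translate[of \<mu> "- y" y z] by simp
      then have "green \<mu> x z \<le> C * (green \<mu> x y * green \<mu> y z)"
        using C(1) green_pos[of x y] green_pos[of y z] by (simp add: green ennreal_mult[symmetric] less_imp_le)
      also have "\<dots> \<le> C' * (green \<mu> x y * green \<mu> y z)"
        unfolding C'_def using green_pos[of x y] green_pos[of y z] by (intro mult_right_mono) auto
      finally have le: "green \<mu> x z * green \<mu> 0 0 / (green \<mu> x y * green \<mu> y z) \<le> C' * green \<mu> 0 0"
        using green_pos[of x y] green_pos[of y z] green_pos[of 0 0] by (simp add: divide_le_eq mult_right_mono ac_simps)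
      have "gap x y z = ln (green \<mu> x z * green \<mu> 0 0 / (green \<mu> x y * green \<mu> y z))"
        unfolding gap_def green_dist_def
        using green_pos[of x y] green_pos[of y z] green_pos[of x z] green_pos[of 0 0]
        by (simp add: ln_div ln_mult)
      also have "\<dots> \<le> ln (C' * green \<mu> 0 0)"
        using le green_pos[of x z] green_pos[of x y] green_pos[of y z] green_pos[of 0 0]
        by (intro ln_mono) auto
      finally show ?thesis .
    qed
    then show ?thesis by blast
  qed
  have "\<exists>K. \<forall>x y z. 1 / (real n + 1) \<le> floyd_dist S f y x z \<longrightarrow> gap x y z \<le> K" for n :: nat
    by (rule gap_bound) simp
  then obtain K where K: "\<And>n x y z. 1 / (real n + 1) \<le> floyd_dist S f y x z \<Longrightarrow> gap x y z \<le> K n"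
    by metis
  \<comment> \<open>Summing \<open>\<bar>K n\<bar>\<close> makes the bound monotone in \<open>t\<close>, and
    \<open>1 / t\<close> makes it strictly decreasing.\<close>
  define A where "A t = (\<Sum>n\<le>nat \<lceil>1 / t\<rceil>. \<bar>K n\<bar>) + 1 / t" for t
  have A_pos: "A t > 0" if "t > 0" for t
    unfolding A_def using that by (intro add_nonneg_pos sum_nonneg) auto
  have A_mono: "A t < A s" if "0 < s" "s < t" for s t
  proof -
    have inv: "1 / t < 1 / s" using that by (intro divide_strict_left_mono) auto
    then have "nat \<lceil>1 / t\<rceil> \<le> nat \<lceil>1 / s\<rceil>" by (intro nat_mono ceiling_mono) simp
    then have "(\<Sum>n\<le>nat \<lceil>1 / t\<rceil>. \<bar>K n\<bar>) \<le> (\<Sum>n\<le>nat \<lceil>1 / s\<rceil>. \<bar>K n\<bar>)"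
      by (intro sum_mono2) auto
    with inv show ?thesis unfolding A_def by linarith
  qed
  have gap_A: "gap x y z \<le> A (floyd_dist S f y x z)" if "x \<noteq> z" for x y z
  proof -
    define t where "t = floyd_dist S f y x z"
    have t: "t > 0" unfolding t_def floyd_dist_translate using that by (intro D_pos) simp
    define n where "n = nat \<lceil>1 / t\<rceil>"
    have "1 / t \<le> real n" unfolding n_def using t by (simp add: real_nat_ceiling_ge)
    then have "1 / (real n + 1) \<le> t" using t by (simp add: field_simps)
    then have "gap x y z \<le> K n" unfolding t_def by (rule K)
    also have "\<dots> \<le> \<bar>K n\<bar>" by simp
    also have "\<dots> \<le> (\<Sum>n\<le>n. \<bar>K n\<bar>)" by (intro member_le_sum) auto
    also have "\<dots> \<le> A t" unfolding A_def n_def[symmetric] using t by simp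
    finally show ?thesis unfolding t_def .
  qed
  show ?thesis
  proof (intro exI[of _ A] conjI allI impI)
    show "strict_antimono_on {0<..} A" using A_mono by (intro monotone_onI) auto
    show "green_dist \<mu> x y + green_dist \<mu> y z \<le> green_dist \<mu> x z + A (floyd_dist S f y x z)" if "x \<noteq> z" for x y z
      using gap_A[OF that, of y] unfolding gap_def by linarith
  qed (rule A_pos)
qed

end
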